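(* There is a strongly polynomial time algorithm that, given as input (the rational coefficients of) a univariate polynomial matrix $P(t)$ with values in the real symmetric $n\times n$ matrices, decides whether $P(t)\succeq 0$ for all $t\in\mathbb{R}$.
   Context: A univariate polynomial matrix $P(t)=P_0+P_1t+\dots+P_dt^d$ (with each $P_i$ a real symmetric $n\times n$ matrix) is a matrix whose entries are polynomials in the single variable $t$; $M\succeq 0$ means that the symmetric matrix $M$ is positive semidefinite. Computation is in the Turing model. The input consists of the rational coefficients of the entries of $P(t)$, so the dimension of the input is the total number of coefficients, $\binom{n+1}{2}(d+1)$; its encoding length is the number of bits needed to write it in binary. A strongly polynomial time algorithm is one such that (i) it consists of the elementary arithmetic operations addition, subtraction, comparison, multiplication and division; (ii) the number of elementary operations is bounded by a polynomial in the dimension of the input; and (iii) the encoding length of the numbers occurring during the algorithm is bounded by a polynomial function of the encoding length of the input. *)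

theory Defs
  imports
    Complex_Main
    "HOL-Library.Log_Nat"
    "HOL-Computational_Algebra.Polynomial"
    "Jordan_Normal_Form.Matrix"
begin

section \<open>Strongly polynomial algorithms\<close>

text \<open>
  Encoding lengths: a rational \<open>p/q\<close> is stored in lowest terms with \<open>q > 0\<close>, as the pair of the
  integers \<open>p\<close> and \<open>q\<close>.  An integer takes a sign bit and its binary digits;
  \<open>floorlog 2 m\<close> is the number of binary digits of \<open>m\<close>, that is, \<open>\<lceil>log 2 (m + 1)\<rceil>\<close>.
\<close>

definition int_bits :: "int \<Rightarrow> nat" where
  "int_bits z = 1 + floorlog 2 (nat \<bar>z\<bar>)"

definition rat_bits :: "rat \<Rightarrow> nat" where
  "rat_bits r = (case quotient_of r of (p, q) \<Rightarrow> int_bits p + int_bits q)"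

text \<open>
  Algorithms are programs of a random access machine over the rationals.  Registers and arrays are
  named by natural numbers; a program mentions only finitely many of them, so that a single
  program has to treat inputs of all dimensions through indirectly addressed array cells.  The
  indices are themselves numbers held in registers, so the computation of indices and the control
  of loops are counted, and their numbers measured, like everything else.
\<close>

record state =
  reg :: "nat \<Rightarrow> rat"
  mem :: "nat \<Rightarrow> nat \<Rightarrow> rat"

datatype arith = Add | Sub | Mul | Div

datatype cmp = Less | Leq | Equal

datatype com =
    Skip
  | Const nat rat
  | Copy nat nat
  | Arith nat arith nat nat
  | Read nat nat nat
  | Write nat nat nat
  | Seq com com
  | If cmp nat nat com com
  | While cmp nat nat com

fun arith_val :: "arith \<Rightarrow> rat \<Rightarrow> rat \<Rightarrow> rat" where
  "arith_val Add u v = u + v"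
| "arith_val Sub u v = u - v"
| "arith_val Mul u v = u * v"
| "arith_val Div u v = u / v"

fun cmp_val :: "cmp \<Rightarrow> rat \<Rightarrow> rat \<Rightarrow> bool" where
  "cmp_val Less u v \<longleftrightarrow> u < v"
| "cmp_val Leq u v \<longleftrightarrow> u \<le> v"
| "cmp_val Equal u v \<longleftrightarrow> u = v"

text \<open>
  \<open>exec c s T V s'\<close>: started in \<open>s\<close>, the program \<open>c\<close> halts in \<open>s'\<close> after \<open>T\<close> elementary operations
  (arithmetic, comparisons and data transfers all cost 1), and \<open>V\<close> is the set of all numbers
  stored on the way.  A run gets stuck, and hence has no final state, on a division by zero and on
  an array access whose index is not a natural number.
\<close>

inductive exec :: "com \<Rightarrow> state \<Rightarrow> nat \<Rightarrow> rat set \<Rightarrow> state \<Rightarrow> bool" where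
  Skip: "exec Skip s 0 {} s"
| Const: "exec (Const x q) s 1 {q} (s\<lparr>reg := (reg s)(x := q)\<rparr>)"
| Copy: "exec (Copy x y) s 1 {reg s y} (s\<lparr>reg := (reg s)(x := reg s y)\<rparr>)"
| Arith: "\<lbrakk>op = Div \<longrightarrow> reg s z \<noteq> 0; v = arith_val op (reg s y) (reg s z)\<rbrakk>
    \<Longrightarrow> exec (Arith x op y z) s 1 {v} (s\<lparr>reg := (reg s)(x := v)\<rparr>)"
| Read: "reg s i = of_nat k
    \<Longrightarrow> exec (Read x a i) s 1 {mem s a k} (s\<lparr>reg := (reg s)(x := mem s a k)\<rparr>)"
| Write: "reg s i = of_nat k
    \<Longrightarrow> exec (Write a i x) s 1 {reg s x}
          (s\<lparr>mem := (mem s)(a := (mem s a)(k := reg s x))\<rparr>)"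
| Seq: "\<lbrakk>exec c1 s T1 V1 s1; exec c2 s1 T2 V2 s2\<rbrakk>
    \<Longrightarrow> exec (Seq c1 c2) s (T1 + T2) (V1 \<union> V2) s2"
| IfTrue: "\<lbrakk>cmp_val b (reg s x) (reg s y); exec c1 s T V s'\<rbrakk>
    \<Longrightarrow> exec (If b x y c1 c2) s (1 + T) V s'"
| IfFalse: "\<lbrakk>\<not> cmp_val b (reg s x) (reg s y); exec c2 s T V s'\<rbrakk>
    \<Longrightarrow> exec (If b x y c1 c2) s (1 + T) V s'"
| WhileFalse: "\<not> cmp_val b (reg s x) (reg s y)
    \<Longrightarrow> exec (While b x y c) s 1 {} s"
| WhileTrue: "\<lbrakk>cmp_val b (reg s x) (reg s y); exec c s T1 V1 s1;
      exec (While b x y c) s1 T2 V2 s2\<rbrakk>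
    \<Longrightarrow> exec (While b x y c) s (1 + T1 + T2) (V1 \<union> V2) s2"

inductive_cases exec_elims:
  "exec Skip s T V s'"
  "exec (Const x q) s T V s'"
  "exec (Copy x y) s T V s'"
  "exec (Arith x op y z) s T V s'"
  "exec (Read x a i) s T V s'"
  "exec (Write a i x) s T V s'"
  "exec (Seq c1 c2) s T V s'"
  "exec (If b x y c1 c2) s T V s'"
  "exec (While b x y c) s T V s'"

lemma exec_deterministic:
  "exec c s T V s' \<Longrightarrow> exec c s T' V' s'' \<Longrightarrow> T' = T \<and> V' = V \<and> s'' = s'"
proof (induction arbitrary: T' V' s'' rule: exec.induct)
  case (Skip s)
  then show ?case by (rule exec_elims(1)) simp
next
  case (Const x q s)
  then show ?case by (rule exec_elims(2)) simp
next
  case (Copy x y s)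
  then show ?case by (rule exec_elims(3)) simp
next
  case (Arith op s z v y x)
  from Arith.prems show ?case by (rule exec_elims(4)) (simp add: Arith.hyps)
next
  case (Read s i k x a)
  from Read.prems show ?case by (rule exec_elims(5)) (use Read.hyps in simp)
next
  case (Write s i k a x)
  from Write.prems show ?case by (rule exec_elims(6)) (use Write.hyps in simp)
next
  case (Seq c1 s T1 V1 s1 c2 T2 V2 s2)
  from Seq.prems show ?case
  proof (rule exec_elims(7), goal_cases)
    case (1 T1' V1' s1' T2' V2')
    from Seq.IH(1)[OF 1(3)] have "T1' = T1" "V1' = V1" "s1' = s1" by simp_all
    with Seq.IH(2) 1 show ?case by metis
  qed
next
  case (IfTrue b s x y c1 T V s' c2)
  from IfTrue.prems show ?case
  proof (rule exec_elims(8), goal_cases)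
    case (1 T0)
    with IfTrue.IH[OF 1(3)] show ?case by simp
  next
    case (2 T0)
    with IfTrue.hyps(1) show ?case by simp
  qed
next
  case (IfFalse b s x y c2 T V s' c1)
  from IfFalse.prems show ?case
  proof (rule exec_elims(8), goal_cases)
    case (1 T0)
    with IfFalse.hyps(1) show ?case by simp
  next
    case (2 T0)
    with IfFalse.IH[OF 2(3)] show ?case by simp
  qed
next
  case (WhileFalse b s x y c)
  from WhileFalse.prems show ?case
  proof (rule exec_elims(9), goal_cases)
    case 1
    then show ?case by simp
  next
    case (2 T1 V1 s1 T2 V2)
    with WhileFalse.hyps show ?case by simp
  qed
next
  case (WhileTrue b s x y c T1 V1 s1 T2 V2 s2)
  from WhileTrue.prems show ?case
  proof (rule exec_elims(9), goal_cases)
    case 1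
    with WhileTrue.hyps(1) show ?case by simp
  next
    case (2 T1' V1' s1' T2' V2')
    from WhileTrue.IH(1)[OF 2(4)] have "T1' = T1" "V1' = V1" "s1' = s1" by simp_all
    with WhileTrue.IH(2) 2 show ?case by (metis plus_1_eq_Suc add_Suc)
  qed
qed

text \<open>
  The input data \<open>xs\<close> are put into array \<open>0\<close>, and the size parameters \<open>ps\<close>, which tell the program
  how to read the data, into the first registers.
\<close>

definition init_state :: "nat list \<Rightarrow> rat list \<Rightarrow> state" where
  "init_state ps xs =
     \<lparr>reg = (\<lambda>i. if i < length ps then of_nat (ps ! i) else 0),
      mem = (\<lambda>a k. if a = 0 \<and> k < length xs then xs ! k else 0)\<rparr>"

text \<open>
  The program \<open>c\<close> decides the property \<open>Q\<close> of the instances in \<open>I\<close> in strongly polynomial time.  The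
  dimension of the input is the number \<open>length xs\<close> of its data, and its encoding length is the sum
  of their encoding lengths.  The answer is left in register \<open>0\<close>.
\<close>

definition decides_strongly_poly ::
  "com \<Rightarrow> 'i set \<Rightarrow> ('i \<Rightarrow> nat list) \<Rightarrow> ('i \<Rightarrow> rat list) \<Rightarrow> ('i \<Rightarrow> bool) \<Rightarrow> bool" where
  "decides_strongly_poly c I params input Q \<longleftrightarrow>
     (\<exists>p q :: nat poly. \<forall>x\<in>I. \<exists>T V s'.
        exec c (init_state (params x) (input x)) T V s' \<and>
        reg s' 0 = (if Q x then 1 else 0) \<and>
        T \<le> poly p (length (input x)) \<and>
        (\<forall>v \<in> of_nat ` set (params x) \<union> set (input x) \<union> V.
           rat_bits v \<le> poly q (sum_list (map rat_bits (input x)))))"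

section \<open>Polynomial matrices\<close>

definition sym_mat :: "'a mat \<Rightarrow> bool" where
  "sym_mat A \<longleftrightarrow> square_mat A \<and> A\<^sup>T = A"

definition psd :: "real mat \<Rightarrow> bool" where
  "psd A \<longleftrightarrow> sym_mat A \<and> (\<forall>v \<in> carrier_vec (dim_row A). 0 \<le> v \<bullet> (A *\<^sub>v v))"

definition eval_polymat :: "rat poly mat \<Rightarrow> real \<Rightarrow> real mat" where
  "eval_polymat P t = map_mat (\<lambda>p. poly (map_poly of_rat p) t) P"

text \<open>
  An instance is a triple \<open>(n, d, P)\<close>, where \<open>P = P\<^sub>0 + P\<^sub>1 t + \<dots> + P\<^sub>d t\<^sup>d\<close> is a symmetric
  \<open>n \<times> n\<close> polynomial matrix; \<open>P\<^sub>d = 0\<close> is allowed.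
\<close>

definition polymat_instances :: "(nat \<times> nat \<times> rat poly mat) set" where
  "polymat_instances =
     {(n, d, P). 1 \<le> n \<and> P \<in> carrier_mat n n \<and> sym_mat P \<and>
        (\<forall>i<n. \<forall>j<n. degree (P $$ (i, j)) \<le> d)}"

text \<open>By symmetry, the coefficients of the entries on and below the diagonal suffice.\<close>

definition polymat_coeffs :: "nat \<Rightarrow> nat \<Rightarrow> rat poly mat \<Rightarrow> rat list" where
  "polymat_coeffs n d P =
     [coeff (P $$ (i, j)) k. i \<leftarrow> [0..<n], j \<leftarrow> [0..<Suc i], k \<leftarrow> [0..<Suc d]]"

lemma length_polymat_coeffs:
  "length (polymat_coeffs n d P) = ((n + 1) choose 2) * (d + 1)"
proof (induction n)
  case (Suc n)
  have "length (polymat_coeffs (Suc n) d P) = length (polymat_coeffs n d P) + (n + 1) * (d + 1)"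
    by (simp add: polymat_coeffs_def length_concat comp_def sum_list_triv algebra_simps)
  moreover have "(Suc n + 1) choose 2 = ((n + 1) choose 2) + (n + 1)"
    by (simp add: numeral_2_eq_2)
  ultimately show ?case
    using Suc.IH by (simp add: algebra_simps)
qed (simp add: polymat_coeffs_def)

end

theory Submission
  imports
    Defs
    "Jordan_Normal_Form.Schur_Decomposition"
begin

text \<open>
  Put \<open>A = - P(t)\<close> and \<open>det (1 - x A) = \<Sum>k. c\<^sub>k(t) x ^ k\<close>.  As all eigenvalues are real, \<open>P(t)\<close> is positive
  semidefinite iff \<open>c\<^sub>k(t) \<ge> 0\<close> for all \<open>k\<close>, so that it has to be decided whether each of the univariate
  polynomials \<open>f = c\<^sub>k\<close> is nonnegative on the real line.  For \<open>S > deg f\<close> the function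
  \<open>f / (1 + t\<^sup>2) ^ S\<close> vanishes at infinity; hence \<open>f\<close> is nonnegative iff it is nonnegative at its real
  critical points, which are the real roots of a polynomial \<open>g\<close>.  Let \<open>H(w)\<close> be the Hankel matrix with the entries
  \<open>\<Sum>w(\<alpha>) \<alpha> ^ (i + j)\<close>, the sum ranging over all complex roots \<open>\<alpha>\<close> of \<open>g\<close>.  A real root counts as an
  eigenvalue of \<open>H(w)\<close> of the sign of \<open>w(\<alpha>)\<close>, and a conjugate pair with \<open>w(\<alpha>) \<noteq> 0\<close> as one positive
  and one negative eigenvalue.  So \<open>f\<close> is nonnegative iff \<open>H(f)\<close> and \<open>H(f\<^sup>2)\<close> have the same number of
  positive eigenvalues.  This number is the number of sign changes of the coefficients of
  \<open>det (1 - x H)\<close>, by Descartes' rule for polynomials with only real roots.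

  The coefficients of \<open>det (1 - x A)\<close> come from the Faddeev--LeVerrier recursion and the power sums of the roots
  of \<open>g\<close> from Newton's identities.  All this takes polynomially many operations, and all numbers that
  occur have a common denominator whose length is polynomially bounded, since the only divisors are
  small integers and the leading coefficients of the polynomials \<open>g\<close>.
\<close>

section \<open>The source language and its compilation\<close>

text \<open>The obstacle is the length of the numbers: a division by a computed quantity can
  introduce new denominators at every step. Hence one number \<open>B\<close> is fixed in advance,
  every value is certified as an integer over \<open>B ^ e\<close> of absolute value at most
  \<open>B ^ e\<close>, and only \<open>e\<close> is tracked. In the recursions one factor of each
  product is always a fixed datum (an entry of \<open>A\<close>, a coefficient of \<open>f\<close>
  or of \<open>g\<close>), never two iterates, so \<open>e\<close> grows linearly with the number of
  steps. \<open>B\<close> arises in two stages: \<open>B0\<close>, a factorial times the sizes of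
  the data, suffices for the polynomials \<open>f\<close> and \<open>g\<close>, whose computation
  divides by small integers only; then the integers \<open>B0 ^ e * \<bar>lc\<bar>\<close>, for the
  leading coefficients \<open>lc\<close> of all \<open>g\<close>, are multiplied into
  \<open>B\<close>. The weight \<open>1 + t\<^sup>2\<close> spares all case distinctions about signs
  at infinity, and gives a nonzero \<open>g\<close> even for a nonzero constant \<open>f\<close>.
  Multiple roots of \<open>g\<close> merely scale a square by a positive factor, and roots of
  \<open>f\<close> drop out of both forms, so no gcd is taken. Determinants never occur in the
  proof: Newton's identities identify the computed coefficients as symmetric functions of the
  eigenvalues.\<close>

definition run :: "rat set \<Rightarrow> com \<Rightarrow> state \<Rightarrow> nat \<Rightarrow> (state \<Rightarrow> bool) \<Rightarrow> bool" where
  "run W c s \<tau> Q \<longleftrightarrow> (\<exists>T V s'. exec c s T V s' \<and> T \<le> \<tau> \<and> V \<subseteq> W \<and> Q s')"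

lemma run_Skip: "Q s \<Longrightarrow> run W Skip s 0 Q"
  unfolding run_def by (blast intro: exec.Skip)

lemma run_Const: "q \<in> W \<Longrightarrow> Q (s\<lparr>reg := (reg s)(x := q)\<rparr>) \<Longrightarrow> run W (Const x q) s 1 Q"
  unfolding run_def using exec.Const by blast

lemma run_Copy: "reg s y \<in> W \<Longrightarrow> Q (s\<lparr>reg := (reg s)(x := reg s y)\<rparr>) \<Longrightarrow> run W (Copy x y) s 1 Q"
  unfolding run_def using exec.Copy by blast

lemma run_Arith:
  assumes "op = Div \<Longrightarrow> reg s z \<noteq> 0" "arith_val op (reg s y) (reg s z) \<in> W"
    "Q (s\<lparr>reg := (reg s)(x := arith_val op (reg s y) (reg s z))\<rparr>)"
  shows "run W (Arith x op y z) s 1 Q"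
  unfolding run_def
  by (rule exI[of _ 1], rule exI[of _ "{arith_val op (reg s y) (reg s z)}"])
    (use assms exec.Arith[of op s z] in blast)

lemma run_Read: "reg s i = of_nat k \<Longrightarrow> mem s a k \<in> W \<Longrightarrow>
    Q (s\<lparr>reg := (reg s)(x := mem s a k)\<rparr>) \<Longrightarrow> run W (Read x a i) s 1 Q"
  unfolding run_def using exec.Read by blast

lemma run_Write: "reg s i = of_nat k \<Longrightarrow> reg s x \<in> W \<Longrightarrow>
    Q (s\<lparr>mem := (mem s)(a := (mem s a)(k := reg s x))\<rparr>) \<Longrightarrow> run W (Write a i x) s 1 Q"
  unfolding run_def using exec.Write by blast

text \<open>The postcondition of the first command is itself a \<open>run\<close>, so compiled code
  is verified by applying the rules in program order. One fixed set \<open>W\<close> of admissible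
  numbers makes the bounds on sizes compose without unions.\<close>

lemma run_Seq: "run W c1 s \<tau>1 (\<lambda>s'. run W c2 s' \<tau>2 Q) \<Longrightarrow> run W (Seq c1 c2) s (\<tau>1 + \<tau>2) Q"
  unfolding run_def by (meson Un_subset_iff add_mono exec.Seq)

lemma run_If:
  assumes "cmp_val b (reg s x) (reg s y) \<Longrightarrow> run W c1 s \<tau>1 Q"
    "\<not> cmp_val b (reg s x) (reg s y) \<Longrightarrow> run W c2 s \<tau>2 Q"
  shows "run W (If b x y c1 c2) s (1 + \<tau>1 + \<tau>2) Q"
proof (cases "cmp_val b (reg s x) (reg s y)")
  case True
  then obtain T V s' where "exec c1 s T V s'" "T \<le> \<tau>1" "V \<subseteq> W" "Q s'"
    using assms(1) unfolding run_def by blast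
  then show ?thesis unfolding run_def using exec.IfTrue[of b s x y, OF True]
    by (intro exI[of _ "1 + T"] exI[of _ V] exI[of _ s']) auto
next
  case False
  then obtain T V s' where "exec c2 s T V s'" "T \<le> \<tau>2" "V \<subseteq> W" "Q s'"
    using assms(2) unfolding run_def by blast
  then show ?thesis unfolding run_def using exec.IfFalse[of b s x y, OF False]
    by (intro exI[of _ "1 + T"] exI[of _ V] exI[of _ s']) auto
qed

lemma run_mono: "run W c s \<tau> Q \<Longrightarrow> (\<And>s'. Q s' \<Longrightarrow> Q' s') \<Longrightarrow> run W c s \<tau> Q'"
  unfolding run_def by blast

lemma run_time: "run W c s \<tau> Q \<Longrightarrow> \<tau> \<le> \<tau>' \<Longrightarrow> run W c s \<tau>' Q"
  unfolding run_def by (meson order_trans)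

text \<open>By \<open>idx\<close> the invariant determines the counter, so there are exactly
  \<open>n\<close> rounds and the induction runs on \<open>n - k\<close>. A round costs its test and
  its body; \<open>2 + \<tau>\<close> leaves one unit of slack.\<close>

lemma run_counted:
  assumes step: "\<And>k s. k < n \<Longrightarrow> J k s \<Longrightarrow> run W body s \<tau> (J (Suc k))"
    and idx: "\<And>k s. J k s \<Longrightarrow> reg s i = of_nat k \<and> reg s b = of_nat n"
    and start: "J 0 s"
  shows "run W (While Less i b body) s (1 + n * (2 + \<tau>)) (J n)"
proof -
  have "k \<le> n \<Longrightarrow> J k s \<Longrightarrow> run W (While Less i b body) s (1 + (n - k) * (2 + \<tau>)) (J n)" for k s
  proof (induction "n - k" arbitrary: k s)
    case 0
    then have "k = n" "\<not> cmp_val Less (reg s i) (reg s b)" using idx[of k s] by auto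
    with 0 show ?case unfolding run_def
      using exec.WhileFalse[of Less s i b body]
      by (intro exI[of _ 1] exI[of _ "{}"] exI[of _ s]) simp
  next
    case (Suc m)
    then have kn: "k < n" and m: "m = n - Suc k" by auto
    have c: "cmp_val Less (reg s i) (reg s b)" using idx[OF Suc.prems(2)] kn by simp
    from step[OF kn Suc.prems(2)] obtain T1 V1 s1 where
      1: "exec body s T1 V1 s1" "T1 \<le> \<tau>" "V1 \<subseteq> W" "J (Suc k) s1" unfolding run_def by blast
    from Suc.hyps(1)[OF m _ 1(4)] kn obtain T2 V2 s2 where
      2: "exec (While Less i b body) s1 T2 V2 s2" "T2 \<le> 1 + (n - Suc k) * (2 + \<tau>)" "V2 \<subseteq> W" "J n s2"
      unfolding run_def by auto
    have "(n - k) * (2 + \<tau>) = (n - Suc k) * (2 + \<tau>) + (2 + \<tau>)"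
      using kn by (metis Suc_diff_Suc add.commute mult_Suc)
    then have "1 + T1 + T2 \<le> 1 + (n - k) * (2 + \<tau>)" using 1(2) 2(2) by linarith
    then show ?case unfolding run_def using exec.WhileTrue[OF c 1(1) 2(1)] 1 2
      by (intro exI[of _ "1 + T1 + T2"] exI[of _ "V1 \<union> V2"] exI[of _ s2]) blast
  qed
  from this[of 0 s] start show ?thesis by simp
qed

text \<open>Addresses and loop bounds have a type of their own, because a run gets stuck at an index
  that is no natural number. \<open>NHalf\<close> serves the triangular numbers in the layout of the
  input.\<close>

datatype nexp = NC nat | NV nat | NAdd nexp nexp | NMul nexp nexp | NSub nexp nexp | NHalf nexp

datatype exp =
    EC rat
  | EN nexp
  | Get nat nexp
  | Bin arith exp exp
  | Sum nat nexp exp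
  | Cond cmp exp exp exp exp

text \<open>Only counted loops, with the bound evaluated before the first round: the running time is
  then bounded by a fixed polynomial in any common bound on the loop lengths, whatever the data
  are.\<close>

datatype hcom =
    HSkip
  | Asg nat nexp
  | Put nat nexp exp
  | HSeq hcom hcom
  | HIf cmp exp exp hcom hcom
  | HFor nat nexp hcom

record hstate =
  hreg :: "nat \<Rightarrow> nat"
  hmem :: "nat \<Rightarrow> nat \<Rightarrow> rat"

abbreviation setr :: "hstate \<Rightarrow> nat \<Rightarrow> nat \<Rightarrow> hstate" where
  "setr h x k \<equiv> h\<lparr>hreg := (hreg h)(x := k)\<rparr>"

abbreviation setm :: "hstate \<Rightarrow> nat \<Rightarrow> nat \<Rightarrow> rat \<Rightarrow> hstate" where
  "setm h a k v \<equiv> h\<lparr>hmem := (hmem h)(a := (hmem h a)(k := v))\<rparr>"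

primrec nev :: "nexp \<Rightarrow> hstate \<Rightarrow> nat" where
  "nev (NC k) h = k"
| "nev (NV x) h = hreg h x"
| "nev (NAdd a b) h = nev a h + nev b h"
| "nev (NMul a b) h = nev a h * nev b h"
| "nev (NSub a b) h = nev a h - nev b h"
| "nev (NHalf a) h = nev a h div 2"

primrec ev :: "exp \<Rightarrow> hstate \<Rightarrow> rat" where
  "ev (EC q) h = q"
| "ev (EN e) h = of_nat (nev e h)"
| "ev (Get a i) h = hmem h a (nev i h)"
| "ev (Bin op a b) h = arith_val op (ev a h) (ev b h)"
| "ev (Sum x n e) h = (\<Sum>k<nev n h. ev e (setr h x k))"
| "ev (Cond b e1 e2 e3 e4) h = (if cmp_val b (ev e1 h) (ev e2 h) then ev e3 h else ev e4 h)"

text \<open>Registers below \<open>named\<close> are the variables of the source program, those above are temporary.\<close>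

definition named :: nat where "named = 32"

primrec ncomp :: "nexp \<Rightarrow> nat \<Rightarrow> com" where
  "ncomp (NC k) t = Const t (of_nat k)"
| "ncomp (NV x) t = Copy t x"
| "ncomp (NAdd a b) t = Seq (ncomp a t) (Seq (ncomp b (t + 1)) (Arith t Add t (t + 1)))"
| "ncomp (NMul a b) t = Seq (ncomp a t) (Seq (ncomp b (t + 1)) (Arith t Mul t (t + 1)))"
| "ncomp (NSub a b) t = Seq (ncomp a t) (Seq (ncomp b (t + 1)) (Arith t Sub t (t + 1)))"
| "ncomp (NHalf a) t = Seq (ncomp a t) (Seq (Const (t + 1) 2) (Arith t Div t (t + 1)))"

primrec ntime :: "nexp \<Rightarrow> nat" where
  "ntime (NC k) = 1"
| "ntime (NV x) = 1"
| "ntime (NAdd a b) = ntime a + (ntime b + 1)"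
| "ntime (NMul a b) = ntime a + (ntime b + 1)"
| "ntime (NSub a b) = ntime a + (ntime b + 1)"
| "ntime (NHalf a) = ntime a + (1 + 1)"

text \<open>Evaluation on a stack of registers: the result arrives in \<open>t\<close>, and
  everything from \<open>t\<close> upwards is scratch. In \<open>Sum\<close>, \<open>t\<close> keeps
  the bound, \<open>t + 1\<close> the outer value of the summation variable, \<open>t + 2\<close>
  the partial sum and \<open>t + 3\<close> the counter.\<close>

primrec comp :: "exp \<Rightarrow> nat \<Rightarrow> com" where
  "comp (EC q) t = Const t q"
| "comp (EN e) t = ncomp e t"
| "comp (Get a i) t = Seq (ncomp i t) (Read t a t)"
| "comp (Bin op a b) t = Seq (comp a t) (Seq (comp b (t + 1)) (Arith t op t (t + 1)))"
| "comp (Sum x n e) t =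
    Seq (ncomp n t) (Seq (Copy (t + 1) x) (Seq (Const (t + 2) 0) (Seq (Const (t + 3) 0)
     (Seq (While Less (t + 3) t
        (Seq (Copy x (t + 3)) (Seq (comp e (t + 4)) (Seq (Arith (t + 2) Add (t + 2) (t + 4))
          (Seq (Const (t + 4) 1) (Arith (t + 3) Add (t + 3) (t + 4)))))))
      (Seq (Copy x (t + 1)) (Copy t (t + 2)))))))"
| "comp (Cond b e1 e2 e3 e4) t =
    Seq (comp e1 t) (Seq (comp e2 (t + 1)) (If b t (t + 1) (comp e3 t) (comp e4 t)))"

text \<open>\<open>L\<close> stands for a bound on all loop lengths; a conditional is charged for
  both branches.\<close>

primrec etime :: "nat \<Rightarrow> exp \<Rightarrow> nat" where
  "etime L (EC q) = 1"
| "etime L (EN e) = ntime e"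
| "etime L (Get a i) = ntime i + 1"
| "etime L (Bin op a b) = etime L a + (etime L b + 1)"
| "etime L (Sum x n e) = ntime n + 6 + L * (etime L e + 6)"
| "etime L (Cond b e1 e2 e3 e4) = etime L e1 + (etime L e2 + (1 + etime L e3 + etime L e4))"

text \<open>In \<open>HFor\<close> the counter lives in \<open>t + 1\<close>, apart from the
  variable \<open>x\<close>, which is loaded from it before each round and restored from
  \<open>t + 2\<close> afterwards. So the body cannot disturb the loop, and \<open>x\<close> keeps
  its outer value.\<close>

primrec hcomp :: "hcom \<Rightarrow> nat \<Rightarrow> com" where
  "hcomp HSkip t = Skip"
| "hcomp (Asg x e) t = Seq (ncomp e t) (Copy x t)"
| "hcomp (Put a i e) t = Seq (ncomp i t) (Seq (comp e (t + 1)) (Write a t (t + 1)))"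
| "hcomp (HSeq c d) t = Seq (hcomp c t) (hcomp d t)"
| "hcomp (HIf b e1 e2 c d) t =
    Seq (comp e1 t) (Seq (comp e2 (t + 1)) (If b t (t + 1) (hcomp c t) (hcomp d t)))"
| "hcomp (HFor x n c) t =
    Seq (ncomp n t) (Seq (Const (t + 1) 0) (While Less (t + 1) t
      (Seq (Copy (t + 2) x) (Seq (Copy x (t + 1)) (Seq (hcomp c (t + 3))
        (Seq (Copy x (t + 2)) (Seq (Const (t + 3) 1) (Arith (t + 1) Add (t + 1) (t + 3)))))))))"

primrec htime :: "nat \<Rightarrow> hcom \<Rightarrow> nat" where
  "htime L HSkip = 0"
| "htime L (Asg x e) = ntime e + 1"
| "htime L (Put a i e) = ntime i + (etime L e + 1)"
| "htime L (HSeq c d) = htime L c + htime L d"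
| "htime L (HIf b e1 e2 c d) = etime L e1 + (etime L e2 + (1 + htime L c + htime L d))"
| "htime L (HFor x n c) = ntime n + 2 + L * (htime L c + 7)"

section \<open>Running times as polynomials in the loop bound\<close>

lemma etime_poly: "\<exists>p. \<forall>L. etime L e = poly p L"
proof (induction e)
  case (Sum x n e)
  then obtain p where "\<forall>L. etime L e = poly p L" by blast
  then show ?case by (intro exI[of _ "[:ntime n + 6:] + [:0, 1:] * (p + [:6:])"]) simp
next
  case (Bin op a b)
  then obtain p q where "\<forall>L. etime L a = poly p L" "\<forall>L. etime L b = poly q L" by blast
  then show ?case by (intro exI[of _ "p + (q + [:1:])"]) simp
next
  case (Cond b e1 e2 e3 e4)
  then obtain p q r s where "\<forall>L. etime L e1 = poly p L" "\<forall>L. etime L e2 = poly q L"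
    "\<forall>L. etime L e3 = poly r L" "\<forall>L. etime L e4 = poly s L" by blast
  then show ?case by (intro exI[of _ "p + (q + ([:1:] + r + s))"]) simp
next
  case (EC q) show ?case by (intro exI[of _ "[:1:]"]) simp
next
  case (EN n) show ?case by (intro exI[of _ "[:ntime n:]"]) simp
next
  case (Get a i) show ?case by (intro exI[of _ "[:ntime i + 1:]"]) simp
qed

lemma htime_poly: "\<exists>p. \<forall>L. htime L c = poly p L"
proof (induction c)
  case (HFor x n c)
  then obtain p where "\<forall>L. htime L c = poly p L" by blast
  then show ?case by (intro exI[of _ "[:ntime n + 2:] + [:0, 1:] * (p + [:7:])"]) simp
next
  case (HSeq a b)
  then obtain p q where "\<forall>L. htime L a = poly p L" "\<forall>L. htime L b = poly q L" by blast
  then show ?case by (intro exI[of _ "p + q"]) simp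
next
  case (HIf b e1 e2 e3 e4)
  then obtain r s where *: "\<forall>L. htime L e3 = poly r L" "\<forall>L. htime L e4 = poly s L" by blast
  obtain p q where "\<forall>L. etime L e1 = poly p L" "\<forall>L. etime L e2 = poly q L"
    using etime_poly by metis
  with * show ?case by (intro exI[of _ "p + (q + ([:1:] + r + s))"]) simp
next
  case HSkip show ?case by (intro exI[of _ 0]) simp
next
  case (Asg x n) show ?case by (intro exI[of _ "[:ntime n + 1:]"]) simp
next
  case (Put a i e)
  obtain q where "\<forall>L. etime L e = poly q L" using etime_poly by metis
  then show ?case by (intro exI[of _ "[:ntime i:] + (q + [:1:])"]) simp
qed

section \<open>Exponents that bound sizes and denominators\<close>

primrec ndg :: "nexp \<Rightarrow> nat" where
  "ndg (NC k) = 1"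
| "ndg (NV x) = 1"
| "ndg (NAdd a b) = max (ndg a) (ndg b) + 1"
| "ndg (NMul a b) = ndg a + ndg b"
| "ndg (NSub a b) = max (ndg a) (ndg b)"
| "ndg (NHalf a) = ndg a"

text \<open>\<open>\<delta> a\<close> is the exponent granted to the entries of array
  \<open>a\<close>. Division costs only one because \<open>chk\<close> demands that the inverse of
  the divisor lies in \<open>cls 1\<close>; a sum costs one because it has at most
  \<open>L \<le> B\<close> terms. The tests of \<open>Cond\<close> do not enter its value and are
  bounded separately in \<open>chk\<close>.\<close>

primrec dg :: "(nat \<Rightarrow> nat) \<Rightarrow> exp \<Rightarrow> nat" where
  "dg \<delta> (EC q) = 1"
| "dg \<delta> (EN e) = ndg e"
| "dg \<delta> (Get a i) = \<delta> a"
| "dg \<delta> (Bin op a b) = (case op of Mul \<Rightarrow> dg \<delta> a + dg \<delta> b | Div \<Rightarrow> dg \<delta> a + 1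
      | _ \<Rightarrow> max (dg \<delta> a) (dg \<delta> b) + 1)"
| "dg \<delta> (Sum x n e) = dg \<delta> e + 1"
| "dg \<delta> (Cond b e1 e2 e3 e4) = max (dg \<delta> e3) (dg \<delta> e4)"

text \<open>\<open>L\<close> bounds the loop lengths and the contents of the named registers;
  \<open>E\<close> is the exponent that all stored numbers have to respect.\<close>

locale sized =
  fixes B L E :: nat
  assumes L2: "2 \<le> L" and LB: "L \<le> B" and E1: "1 \<le> E"
begin

text \<open>If \<open>B\<close> is a common denominator of the data that also exceeds their absolute values and \<open>L\<close>, then
  \<open>cls e\<close> contains the values of integer polynomials of degree \<open>e\<close> in the data, up to an increase of the
  exponent that pays for the number of summands; \<open>dg\<close> computes such an exponent for an expression.\<close>

definition cls :: "nat \<Rightarrow> rat set" where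
  "cls e = {x. of_nat (B ^ e) * x \<in> \<int> \<and> \<bar>x\<bar> \<le> of_nat (B ^ e)}"

lemma B2: "2 \<le> B" using L2 LB by simp

lemma cls_mono: assumes "x \<in> cls e" "e \<le> e'" shows "x \<in> cls e'"
proof -
  have "(of_nat (B ^ e') :: rat) * x = of_nat (B ^ (e' - e)) * (of_nat (B ^ e) * x)"
    using assms(2) by (simp flip: power_add mult.assoc)
  also have "\<dots> \<in> \<int>" by (rule Ints_mult[OF Ints_of_nat]) (use assms(1) in \<open>simp add: cls_def\<close>)
  finally have "of_nat (B ^ e') * x \<in> \<int>" .
  moreover have "(of_nat (B ^ e) :: rat) \<le> of_nat (B ^ e')"
    using assms(2) B2 by (intro of_nat_mono power_increasing) auto
  ultimately show ?thesis using assms(1) by (simp add: cls_def)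
qed

lemma cls_of_nat: "k \<le> B ^ e \<Longrightarrow> of_nat k \<in> cls e"
  using of_nat_mono[of k "B ^ e", where 'a = rat] by (simp add: cls_def)

lemma cls_mult: assumes "x \<in> cls e" "y \<in> cls f" shows "x * y \<in> cls (e + f)"
proof -
  have "of_nat (B ^ (e + f)) * (x * y) = (of_nat (B ^ e) * x) * (of_nat (B ^ f) * y)"
    by (simp add: power_add)
  also have "\<dots> \<in> \<int>" using assms by (auto simp: cls_def)
  finally have "of_nat (B ^ (e + f)) * (x * y) \<in> \<int>" .
  moreover have "\<bar>x\<bar> * \<bar>y\<bar> \<le> of_nat (B ^ e) * of_nat (B ^ f)"
    using assms by (intro mult_mono) (auto simp: cls_def)
  ultimately show ?thesis by (simp add: cls_def abs_mult power_add)
qed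

lemma cls_minus: "x \<in> cls e \<Longrightarrow> - x \<in> cls e"
  by (auto simp: cls_def)

lemma cls_sum:
  assumes "finite A" "card A \<le> B" "\<And>k. k \<in> A \<Longrightarrow> f k \<in> cls e"
  shows "sum f A \<in> cls (e + 1)"
proof -
  have "of_nat (B ^ (e + 1)) * sum f A = of_nat B * (\<Sum>k\<in>A. of_nat (B ^ e) * f k)"
    by (simp add: sum_distrib_left mult.assoc)
  also have "\<dots> \<in> \<int>"
    by (rule Ints_mult[OF Ints_of_nat], rule Ints_sum) (use assms(3) in \<open>simp add: cls_def\<close>)
  finally have "of_nat (B ^ (e + 1)) * sum f A \<in> \<int>" .
  moreover have "\<bar>sum f A\<bar> \<le> of_nat (B ^ (e + 1))"
  proof -
    have "\<bar>sum f A\<bar> \<le> (\<Sum>k\<in>A. \<bar>f k\<bar>)" by (rule sum_abs)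
    also have "\<dots> \<le> (\<Sum>k\<in>A. of_nat (B ^ e))" using assms(3) by (intro sum_mono) (auto simp: cls_def)
    also have "\<dots> = of_nat (card A * B ^ e)" by simp
    also have "\<dots> \<le> of_nat (B ^ (e + 1))" using assms(2) by (intro of_nat_mono) simp
    finally show ?thesis .
  qed
  ultimately show ?thesis by (simp add: cls_def)
qed

lemma cls_add: assumes "x \<in> cls e" "y \<in> cls f" shows "x + y \<in> cls (max e f + 1)"
proof -
  \<comment> \<open>Two terms are summed over \<open>bool\<close>, so that \<open>cls_sum\<close>
    applies with cardinality \<open>2 \<le> B\<close>.\<close>
  have "sum (\<lambda>b. if b then x else y) UNIV \<in> cls (max e f + 1)"
    using assms B2 by (intro cls_sum) (auto intro: cls_mono)
  then show ?thesis by (simp add: UNIV_bool add.commute)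
qed

lemma cls_diff: assumes "x \<in> cls e" "y \<in> cls f" shows "x - y \<in> cls (max e f + 1)"
  using cls_add[OF assms(1) cls_minus[OF assms(2)]] by simp

lemma cls_0: "0 \<in> cls e" by (simp add: cls_def)

lemma cls_1: "1 \<in> cls e" using cls_of_nat[of 1 e] B2 by simp

text \<open>The machine subtracts and halves rationals. Under these side conditions truncated
  subtraction and \<open>div\<close> agree with that, so every compiled index is a natural
  number.\<close>

primrec nok :: "nexp \<Rightarrow> hstate \<Rightarrow> bool" where
  "nok (NC k) h \<longleftrightarrow> k \<le> L"
| "nok (NV x) h \<longleftrightarrow> x < named"
| "nok (NAdd a b) h \<longleftrightarrow> nok a h \<and> nok b h"
| "nok (NMul a b) h \<longleftrightarrow> nok a h \<and> nok b h"
| "nok (NSub a b) h \<longleftrightarrow> nok a h \<and> nok b h \<and> nev b h \<le> nev a h"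
| "nok (NHalf a) h \<longleftrightarrow> nok a h \<and> even (nev a h)"

text \<open>What a run of \<open>comp e\<close> needs: no division by zero, legal indices, bounded
  sizes. Values that are stored but do not enter the exponent of the result (indices, loop bounds,
  divisors, tests) are bounded by \<open>E\<close> on their own.\<close>

primrec chk :: "(nat \<Rightarrow> nat) \<Rightarrow> exp \<Rightarrow> hstate \<Rightarrow> bool" where
  "chk \<delta> (EC q) h \<longleftrightarrow> q \<in> cls 1"
| "chk \<delta> (EN e) h \<longleftrightarrow> nok e h"
| "chk \<delta> (Get a i) h \<longleftrightarrow> nok i h \<and> ndg i \<le> E \<and> hmem h a (nev i h) \<in> cls (\<delta> a)"
| "chk \<delta> (Bin op a b) h \<longleftrightarrow> chk \<delta> a h \<and> chk \<delta> b h \<and>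
    (op = Div \<longrightarrow> ev b h \<noteq> 0 \<and> inverse (ev b h) \<in> cls 1 \<and> dg \<delta> b \<le> E)"
| "chk \<delta> (Sum x n e) h \<longleftrightarrow> x < named \<and> nok n h \<and> ndg n \<le> E \<and> nev n h \<le> L \<and>
    (\<forall>k<nev n h. chk \<delta> e (setr h x k))"
| "chk \<delta> (Cond b e1 e2 e3 e4) h \<longleftrightarrow> chk \<delta> e1 h \<and> chk \<delta> e2 h \<and> dg \<delta> e1 \<le> E \<and> dg \<delta> e2 \<le> E \<and>
    (if cmp_val b (ev e1 h) (ev e2 h) then chk \<delta> e3 h else chk \<delta> e4 h)"

definition okh :: "hstate \<Rightarrow> bool" where
  "okh h \<longleftrightarrow> (\<forall>x<named. hreg h x \<le> L)"

definition corr :: "hstate \<Rightarrow> state \<Rightarrow> bool" where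
  "corr h s \<longleftrightarrow> mem s = hmem h \<and> (\<forall>x<named. reg s x = of_nat (hreg h x))"

definition keep :: "nat \<Rightarrow> state \<Rightarrow> state \<Rightarrow> bool" where
  "keep t s s' \<longleftrightarrow> mem s' = mem s \<and> (\<forall>x<t. reg s' x = reg s x)"

lemma corr_keep: "corr h s \<Longrightarrow> keep t s s' \<Longrightarrow> named \<le> t \<Longrightarrow> corr h s'"
  by (auto simp: corr_def keep_def)

lemma okh_setr: "okh h \<Longrightarrow> k \<le> L \<Longrightarrow> okh (setr h x k)"
  by (auto simp: okh_def)

lemma nev_cls: "nok e h \<Longrightarrow> okh h \<Longrightarrow> nev e h \<le> B ^ ndg e"
proof (induction e)
  case (NAdd a b)
  have "nev a h \<le> B ^ max (ndg a) (ndg b)" "nev b h \<le> B ^ max (ndg a) (ndg b)"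
    using NAdd B2 by (auto intro: order_trans power_increasing)
  then have "nev a h + nev b h \<le> 2 * B ^ max (ndg a) (ndg b)" by simp
  also have "\<dots> \<le> B ^ (max (ndg a) (ndg b) + 1)" using B2 by simp
  finally show ?case by simp
next
  case (NMul a b) then show ?case by (simp add: power_add mult_mono)
next
  case (NSub a b)
  then have "nev a h \<le> B ^ max (ndg a) (ndg b)"
    using B2 by (auto intro: order_trans power_increasing)
  then show ?case by simp
qed (use LB B2 in \<open>auto simp: okh_def\<close>)

lemma ndg_pos: "1 \<le> ndg e" by (induction e) auto

lemma ev_cls: "chk \<delta> e h \<Longrightarrow> okh h \<Longrightarrow> ev e h \<in> cls (dg \<delta> e)"
proof (induction e arbitrary: h)
  case (EN e) then show ?case by (simp add: cls_of_nat nev_cls)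
next
  case (Bin op a b)
  then have *: "ev a h \<in> cls (dg \<delta> a)" "ev b h \<in> cls (dg \<delta> b)" by auto
  show ?case
  proof (cases op)
    case Div
    with Bin have "ev a h * inverse (ev b h) \<in> cls (dg \<delta> a + 1)" by (intro cls_mult *) auto
    with Div show ?thesis by (simp add: divide_inverse)
  qed (use cls_add[OF *] cls_diff[OF *] cls_mult[OF *] in auto)
next
  case (Sum x n e)
  have "ev e (setr h x k) \<in> cls (dg \<delta> e)" if "k < nev n h" for k
    using Sum.prems that by (intro Sum.IH okh_setr) auto
  then show ?case using Sum.prems LB cls_sum[of "{..<nev n h}" "\<lambda>k. ev e (setr h x k)"] by auto
next
  case (Cond b e1 e2 e3 e4)
  show ?case
  proof (cases "cmp_val b (ev e1 h) (ev e2 h)")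
    case True
    with Cond show ?thesis using cls_mono[of "ev e3 h" "dg \<delta> e3"] by simp
  next
    case False
    with Cond show ?thesis using cls_mono[of "ev e4 h" "dg \<delta> e4"] by simp
  qed
qed auto

lemma of_nat_cls: "k \<le> L \<Longrightarrow> of_nat k \<in> cls E"
  using cls_of_nat[of k 1] LB E1 cls_mono[of "of_nat k" 1 E] by simp

lemma ncomp_run:
  assumes "nok e h" "ndg e \<le> E" "corr h s" "okh h" "named \<le> t"
  shows "run (cls E) (ncomp e t) s (ntime e) (\<lambda>s'. keep t s s' \<and> reg s' t = of_nat (nev e h))"
  using assms
proof (induction e arbitrary: s t)
  case (NC k)
  then show ?case unfolding ncomp.simps ntime.simps
    by (intro run_Const of_nat_cls) (auto simp: keep_def)
next
  case (NV x)
  then have "reg s x = of_nat (hreg h x)" "hreg h x \<le> L" by (auto simp: corr_def okh_def)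
  with NV show ?case unfolding ncomp.simps ntime.simps
    by (intro run_Copy) (auto simp: keep_def of_nat_cls)
next
  case (NAdd a b)
  have *: "of_nat (nev a h) + of_nat (nev b h) \<in> cls E"
    using ev_cls[of _ "EN (NAdd a b)" h] NAdd.prems cls_mono by auto
  show ?case unfolding ncomp.simps ntime.simps
    apply (rule run_Seq)
    apply (rule run_mono[OF NAdd.IH(1)])
    subgoal using NAdd.prems by simp
    subgoal using NAdd.prems by simp
    subgoal using NAdd.prems by simp
    subgoal using NAdd.prems by simp
    subgoal using NAdd.prems by simp
    apply (rule run_Seq)
    apply (rule run_mono[OF NAdd.IH(2)])
    subgoal using NAdd.prems by simp
    subgoal using NAdd.prems by simp
    subgoal using NAdd.prems by (auto intro: corr_keep)
    subgoal using NAdd.prems by simp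
    subgoal using NAdd.prems by simp
    subgoal using * by (intro run_Arith) (auto simp: keep_def)
    done
next
  case (NMul a b)
  have *: "of_nat (nev a h) * of_nat (nev b h) \<in> cls E"
    using ev_cls[of _ "EN (NMul a b)" h] NMul.prems cls_mono by auto
  show ?case unfolding ncomp.simps ntime.simps
    apply (rule run_Seq)
    apply (rule run_mono[OF NMul.IH(1)])
    subgoal using NMul.prems by simp
    subgoal using NMul.prems by simp
    subgoal using NMul.prems by simp
    subgoal using NMul.prems by simp
    subgoal using NMul.prems by simp
    apply (rule run_Seq)
    apply (rule run_mono[OF NMul.IH(2)])
    subgoal using NMul.prems by simp
    subgoal using NMul.prems by simp
    subgoal using NMul.prems by (auto intro: corr_keep)
    subgoal using NMul.prems by simp
    subgoal using NMul.prems by simp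
    subgoal using * by (intro run_Arith) (auto simp: keep_def)
    done
next
  case (NSub a b)
  have eq: "of_nat (nev a h) - of_nat (nev b h) = (of_nat (nev (NSub a b) h) :: rat)"
    using NSub.prems by (simp add: of_nat_diff)
  have *: "of_nat (nev a h) - of_nat (nev b h) \<in> cls E"
    unfolding eq using ev_cls[of _ "EN (NSub a b)" h] NSub.prems cls_mono by auto
  show ?case unfolding ncomp.simps ntime.simps
    apply (rule run_Seq)
    apply (rule run_mono[OF NSub.IH(1)])
    subgoal using NSub.prems by simp
    subgoal using NSub.prems by simp
    subgoal using NSub.prems by simp
    subgoal using NSub.prems by simp
    subgoal using NSub.prems by simp
    apply (rule run_Seq)
    apply (rule run_mono[OF NSub.IH(2)])
    subgoal using NSub.prems by simp
    subgoal using NSub.prems by simp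
    subgoal using NSub.prems by (auto intro: corr_keep)
    subgoal using NSub.prems by simp
    subgoal using NSub.prems by simp
    subgoal for s1 s2
      by (intro run_Arith; use * in \<open>simp add: keep_def eq del: nev.simps\<close>)
    done
next
  case (NHalf a)
  have eq: "of_nat (nev a h) / 2 = (of_nat (nev (NHalf a) h) :: rat)"
    using NHalf.prems by (auto simp: of_nat_div)
  have *: "of_nat (nev a h) / 2 \<in> cls E"
    unfolding eq using ev_cls[of _ "EN (NHalf a)" h] NHalf.prems cls_mono by auto
  have 2: "(2::rat) \<in> cls E" using of_nat_cls[of 2] L2 by simp
  show ?case unfolding ncomp.simps ntime.simps
    apply (rule run_Seq)
    apply (rule run_mono[OF NHalf.IH(1)])
    subgoal using NHalf.prems by simp
    subgoal using NHalf.prems by simp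
    subgoal using NHalf.prems by simp
    subgoal using NHalf.prems by simp
    subgoal using NHalf.prems by simp
    apply (rule run_Seq)
    apply (rule run_Const[OF 2])
    subgoal for s1
      by (intro run_Arith; use * in \<open>simp add: keep_def eq del: nev.simps\<close>)
    done
qed

end

section \<open>Correctness of compiled expressions and commands\<close>

context sized
begin

lemma comp_run:
  assumes "chk \<delta> e h" "dg \<delta> e \<le> E" "corr h s" "okh h" "named \<le> t"
  shows "run (cls E) (comp e t) s (etime L e) (\<lambda>s'. keep t s s' \<and> reg s' t = ev e h)"
  using assms
proof (induction e arbitrary: h s t)
  case (EC q)
  then show ?case unfolding comp.simps etime.simps
    by (intro run_Const) (auto simp: keep_def intro: cls_mono)
next
  case (EN n)
  then show ?case using ncomp_run[of n h s t] by simp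
next
  case (Get a i)
  have v: "hmem h a (nev i h) \<in> cls E" using Get.prems cls_mono by auto
  show ?case unfolding comp.simps etime.simps
    apply (rule run_Seq)
    apply (rule run_mono[OF ncomp_run[of i h]])
    subgoal using Get.prems by simp
    subgoal using Get.prems by simp
    subgoal using Get.prems by simp
    subgoal using Get.prems by simp
    subgoal using Get.prems by simp
    apply (rule run_Read[of _ _ "nev i h"])
    subgoal by simp
    subgoal using v Get.prems by (simp add: keep_def corr_def)
    subgoal using v Get.prems by (simp add: keep_def corr_def)
    done
next
  case (Bin op a b)
  have dgE: "dg \<delta> a \<le> E" "dg \<delta> b \<le> E" using Bin.prems by (auto split: arith.splits)
  have v: "arith_val op (ev a h) (ev b h) \<in> cls E"
    using ev_cls[OF Bin.prems(1,4)] Bin.prems(2) cls_mono by (simp del: dg.simps)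
  show ?case unfolding comp.simps etime.simps
    apply (rule run_Seq)
    apply (rule run_mono[OF Bin.IH(1)[of h]])
    subgoal using Bin.prems by simp
    subgoal using dgE by simp
    subgoal using Bin.prems by simp
    subgoal using Bin.prems by simp
    subgoal using Bin.prems by simp
    apply (rule run_Seq)
    apply (rule run_mono[OF Bin.IH(2)[of h]])
    subgoal using Bin.prems by simp
    subgoal using dgE by simp
    subgoal using Bin.prems by (auto intro: corr_keep)
    subgoal using Bin.prems by simp
    subgoal using Bin.prems by simp
    subgoal for s1 s2
      using v Bin.prems(1) by (intro run_Arith) (auto simp add: keep_def)
    done
next
  case (Cond b e1 e2 e3 e4)
  show ?case unfolding comp.simps etime.simps
    apply (rule run_Seq)
    apply (rule run_mono[OF Cond.IH(1)[of h]])
    subgoal using Cond.prems by simp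
    subgoal using Cond.prems by simp
    subgoal using Cond.prems by simp
    subgoal using Cond.prems by simp
    subgoal using Cond.prems by simp
    apply (rule run_Seq)
    apply (rule run_mono[OF Cond.IH(2)[of h]])
    subgoal using Cond.prems by simp
    subgoal using Cond.prems by simp
    subgoal using Cond.prems by (auto intro: corr_keep)
    subgoal using Cond.prems by simp
    subgoal using Cond.prems by simp
    subgoal for s1 s2
      apply (rule run_If)
      subgoal
        apply (rule run_mono[OF Cond.IH(3)[of h]])
        subgoal using Cond.prems by (simp add: keep_def)
        subgoal using Cond.prems by simp
        subgoal using Cond.prems by (auto intro: corr_keep)
        subgoal using Cond.prems by simp
        subgoal using Cond.prems by simp
        subgoal by (auto simp: keep_def)
        done
      subgoal
        apply (rule run_mono[OF Cond.IH(4)[of h]])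
        subgoal using Cond.prems by (simp add: keep_def)
        subgoal using Cond.prems by simp
        subgoal using Cond.prems by (auto intro: corr_keep)
        subgoal using Cond.prems by simp
        subgoal using Cond.prems by simp
        subgoal by (auto simp: keep_def)
        done
      done
    done
next
  case (Sum x n e)
  let ?m = "nev n h"
  let ?S = "\<lambda>k. \<Sum>i<k. ev e (setr h x i)"
  have x: "x < named" "nok n h" "ndg n \<le> E" "?m \<le> L" "dg \<delta> e \<le> E"
    and ce: "\<And>k. k < ?m \<Longrightarrow> chk \<delta> e (setr h x k)" using Sum.prems by auto
  have hx: "reg s x = of_nat (hreg h x)" "hreg h x \<le> L"
    using Sum.prems x by (auto simp: corr_def okh_def)
  \<comment> \<open>Every partial sum is stored, so each needs a bound. \<open>cls_sum\<close> gives
    \<open>dg \<delta> e + 1\<close> for all of them; adding term by term with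
    \<open>cls_add\<close> would cost one exponent per term.\<close>
  have part: "?S k \<in> cls E" if "k \<le> ?m" for k
  proof -
    have "?S k \<in> cls (dg \<delta> e + 1)"
      using that x LB by (intro cls_sum) (auto intro!: ev_cls ce okh_setr Sum.prems)
    then show ?thesis using Sum.prems(2) cls_mono by auto
  qed
  \<comment> \<open>Register \<open>x\<close> is left out of the frame: it holds the summation index
    until it is restored after the loop.\<close>
  define J where "J k s' \<longleftrightarrow> mem s' = mem s \<and> (\<forall>y<t. y \<noteq> x \<longrightarrow> reg s' y = reg s y) \<and>
    reg s' t = of_nat ?m \<and> reg s' (t + 1) = reg s x \<and> reg s' (t + 2) = ?S k \<and>
    reg s' (t + 3) = of_nat k" for k and s' :: state
  have xt: "x < t" using x Sum.prems by simp
  have body: "run (cls E) (Seq (Copy x (t + 3)) (Seq (comp e (t + 4)) (Seq (Arith (t + 2) Add (t + 2) (t + 4))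
          (Seq (Const (t + 4) 1) (Arith (t + 3) Add (t + 3) (t + 4)))))) s' (1 + (etime L e + (1 + (1 + 1)))) (J (Suc k))"
    if k: "k < ?m" and j: "J k s'" for k s'
    apply (rule run_Seq)
    apply (rule run_Copy)
    subgoal using j k x by (simp add: J_def of_nat_cls)
    apply (rule run_Seq)
    apply (rule run_mono[OF Sum.IH[of "setr h x k"]])
    subgoal using ce[OF k] .
    subgoal using x by simp
    subgoal using j Sum.prems x by (auto simp: J_def corr_def)
    subgoal using k x Sum.prems by (intro okh_setr) auto
    subgoal using Sum.prems by simp
    apply (rule run_Seq)
    apply (rule run_Arith)
    subgoal by simp
    subgoal using j part[of "Suc k"] k xt by (simp add: J_def keep_def)
    apply (rule run_Seq)
    apply (rule run_Const)
    subgoal using cls_1 .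
    apply (rule run_Arith)
    subgoal by simp
    subgoal using j k xt x of_nat_cls[of "Suc k"] by (simp add: J_def keep_def add.commute)
    subgoal using j k xt by (auto simp add: J_def keep_def add.commute)
    done
  have "etime L (Sum x n e) \<ge> ntime n + (1 + (1 + (1 + (1 + ?m * (2 + (1 + (etime L e + (1 + (1 + 1))))) + (1 + 1)))))"
    using mult_le_mono1[OF x(4), of "etime L e + 6"] by (simp add: algebra_simps)
  then show ?case unfolding comp.simps
    apply (rule run_time[rotated])
    apply (rule run_Seq)
    apply (rule run_mono[OF ncomp_run[of n h]])
    subgoal using x by simp
    subgoal using x by simp
    subgoal using Sum.prems by simp
    subgoal using Sum.prems by simp
    subgoal using Sum.prems by simp
    apply (rule run_Seq)
    apply (rule run_Copy)
    subgoal using xt hx by (simp add: keep_def of_nat_cls)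
    apply (rule run_Seq)
    apply (rule run_Const[OF cls_0])
    apply (rule run_Seq)
    apply (rule run_Const[OF cls_0])
    apply (rule run_Seq)
    apply (rule run_mono[OF run_counted[of ?m J, OF body]])
    subgoal by simp
    subgoal by simp
    subgoal by (simp add: J_def)
    subgoal using xt by (auto simp: J_def keep_def)
    apply (rule run_Seq)
    apply (rule run_Copy)
    subgoal using hx by (simp add: J_def of_nat_cls)
    apply (rule run_Copy)
    subgoal using xt part[of ?m] by (simp add: J_def)
    subgoal using xt by (auto simp: J_def keep_def)
    done
qed

text \<open>Weakest preconditions with the obligations on sizes built in. The exponents
  \<open>\<delta>\<close> are chosen anew at each \<open>Put\<close> and each test, so they may grow
  from one round to the next. A loop invariant refers to states in which the loop variable has its
  outer value.\<close>

primrec wp :: "hcom \<Rightarrow> (hstate \<Rightarrow> bool) \<Rightarrow> hstate \<Rightarrow> bool" where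
  "wp HSkip Q h \<longleftrightarrow> Q h"
| "wp (Asg x e) Q h \<longleftrightarrow> x < named \<and> nok e h \<and> ndg e \<le> E \<and> nev e h \<le> L \<and> Q (setr h x (nev e h))"
| "wp (Put a i e) Q h \<longleftrightarrow> nok i h \<and> ndg i \<le> E \<and> (\<exists>\<delta>. chk \<delta> e h \<and> dg \<delta> e \<le> E) \<and>
    Q (setm h a (nev i h) (ev e h))"
| "wp (HSeq c d) Q h \<longleftrightarrow> wp c (wp d Q) h"
| "wp (HIf b e1 e2 c d) Q h \<longleftrightarrow>
    (\<exists>\<delta>. chk \<delta> e1 h \<and> chk \<delta> e2 h \<and> dg \<delta> e1 \<le> E \<and> dg \<delta> e2 \<le> E) \<and>
    (if cmp_val b (ev e1 h) (ev e2 h) then wp c Q h else wp d Q h)"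
| "wp (HFor x n c) Q h \<longleftrightarrow> x < named \<and> nok n h \<and> ndg n \<le> E \<and> nev n h \<le> L \<and>
    (\<exists>I. I 0 h \<and> (\<forall>k<nev n h. \<forall>h'. I k h' \<longrightarrow>
        wp c (\<lambda>h''. I (Suc k) (setr h'' x (hreg h' x))) (setr h' x k)) \<and>
      (\<forall>h'. I (nev n h) h' \<longrightarrow> Q h'))"

text \<open>The frame on the registers from \<open>named\<close> up to \<open>t\<close> is what
  allows an enclosing loop to keep its bound, its counter and the saved variable there.\<close>

lemma hcomp_run:
  assumes "wp c Q h" "corr h s" "okh h" "named \<le> t"
  shows "run (cls E) (hcomp c t) s (htime L c)
    (\<lambda>s'. \<exists>h'. corr h' s' \<and> okh h' \<and> Q h' \<and> (\<forall>x. named \<le> x \<and> x < t \<longrightarrow> reg s' x = reg s x))"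
  using assms
proof (induction c arbitrary: Q h s t)
  case HSkip
  then show ?case unfolding hcomp.simps htime.simps by (intro run_Skip) auto
next
  case (Asg x e)
  show ?case unfolding hcomp.simps htime.simps
    apply (rule run_Seq)
    apply (rule run_mono[OF ncomp_run[of e h]])
    subgoal using Asg.prems by simp
    subgoal using Asg.prems by simp
    subgoal using Asg.prems by simp
    subgoal using Asg.prems by simp
    subgoal using Asg.prems by simp
    apply (rule run_Copy)
    subgoal using Asg.prems by (simp add: of_nat_cls)
    subgoal using Asg.prems
      by (intro exI[of _ "setr h x (nev e h)"]) (auto simp: corr_def keep_def okh_def)
    done
next
  case (Put a i e)
  then obtain \<delta> where \<delta>: "chk \<delta> e h" "dg \<delta> e \<le> E" by auto
  have v: "ev e h \<in> cls E" using ev_cls[OF \<delta>(1) Put.prems(3)] \<delta>(2) cls_mono by simp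
  show ?case unfolding hcomp.simps htime.simps
    apply (rule run_Seq)
    apply (rule run_mono[OF ncomp_run[of i h]])
    subgoal using Put.prems by simp
    subgoal using Put.prems by simp
    subgoal using Put.prems by simp
    subgoal using Put.prems by simp
    subgoal using Put.prems by simp
    apply (rule run_Seq)
    apply (rule run_mono[OF comp_run[OF \<delta>]])
    subgoal using Put.prems by (auto intro: corr_keep)
    subgoal using Put.prems by simp
    subgoal using Put.prems by simp
    apply (rule run_Write[of _ _ "nev i h"])
    subgoal by (simp add: keep_def)
    subgoal using v by simp
    subgoal using Put.prems
      by (intro exI[of _ "setm h a (nev i h) (ev e h)"]) (auto simp: corr_def keep_def okh_def)
    done
next
  case (HSeq c d)
  show ?case unfolding hcomp.simps htime.simps
    apply (rule run_Seq)
    apply (rule run_mono[OF HSeq.IH(1)[of "wp d Q" h s t]])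
    subgoal using HSeq.prems by simp
    subgoal using HSeq.prems by simp
    subgoal using HSeq.prems by simp
    subgoal using HSeq.prems by simp
    apply (elim exE conjE)
    subgoal for s' h'
      by (rule run_mono[OF HSeq.IH(2)[of Q h' s' t]]) (use HSeq.prems in auto)
    done
next
  case (HIf b e1 e2 c d)
  then obtain \<delta> where \<delta>: "chk \<delta> e1 h" "chk \<delta> e2 h" "dg \<delta> e1 \<le> E" "dg \<delta> e2 \<le> E" by auto
  show ?case unfolding hcomp.simps htime.simps
    apply (rule run_Seq)
    apply (rule run_mono[OF comp_run[OF \<delta>(1,3)]])
    subgoal using HIf.prems by simp
    subgoal using HIf.prems by simp
    subgoal using HIf.prems by simp
    apply (rule run_Seq)
    apply (rule run_mono[OF comp_run[OF \<delta>(2,4)]])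
    subgoal using HIf.prems by (auto intro: corr_keep)
    subgoal using HIf.prems by simp
    subgoal using HIf.prems by simp
    subgoal for s1 s2
      apply (rule run_If)
      subgoal
        apply (rule run_mono[OF HIf.IH(1)[of Q h]])
        subgoal using HIf.prems by (simp add: keep_def)
        subgoal using HIf.prems by (auto intro: corr_keep)
        subgoal using HIf.prems by simp
        subgoal using HIf.prems by simp
        subgoal by (auto simp: keep_def)
        done
      subgoal
        apply (rule run_mono[OF HIf.IH(2)[of Q h]])
        subgoal using HIf.prems by (simp add: keep_def)
        subgoal using HIf.prems by (auto intro: corr_keep)
        subgoal using HIf.prems by simp
        subgoal using HIf.prems by simp
        subgoal by (auto simp: keep_def)
        done
      done
    done
next
  case (HFor x n c)
  let ?m = "nev n h"
  from HFor.prems(1) obtain I where I: "I 0 h"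
      "\<And>k h'. k < ?m \<Longrightarrow> I k h' \<Longrightarrow> wp c (\<lambda>h''. I (Suc k) (setr h'' x (hreg h' x))) (setr h' x k)"
      "\<And>h'. I ?m h' \<Longrightarrow> Q h'"
    and x: "x < named" "nok n h" "ndg n \<le> E" "?m \<le> L" by auto
  define J where "J k s' \<longleftrightarrow> (\<exists>h'. corr h' s' \<and> okh h' \<and> I k h') \<and>
    (\<forall>y. named \<le> y \<and> y < t \<longrightarrow> reg s' y = reg s y) \<and>
    reg s' t = of_nat ?m \<and> reg s' (t + 1) = of_nat k" for k and s' :: state
  have body: "run (cls E) (Seq (Copy (t + 2) x) (Seq (Copy x (t + 1)) (Seq (hcomp c (t + 3))
        (Seq (Copy (x) (t + 2)) (Seq (Const (t + 3) 1) (Arith (t + 1) Add (t + 1) (t + 3)))))))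
      s' (1 + (1 + (htime L c + (1 + (1 + 1))))) (J (Suc k))"
    if k: "k < ?m" and j: "J k s'" for k s'
  proof -
    from j obtain h' where h': "corr h' s'" "okh h'" "I k h'"
      and r: "\<And>y. named \<le> y \<Longrightarrow> y < t \<Longrightarrow> reg s' y = reg s y"
        "reg s' t = of_nat ?m" "reg s' (t + 1) = of_nat k"
      unfolding J_def by auto
    have hx: "reg s' x = of_nat (hreg h' x)" "hreg h' x \<le> L"
      using h' x by (auto simp: corr_def okh_def)
    show ?thesis
      apply (rule run_Seq)
      apply (rule run_Copy)
      subgoal using hx by (simp add: of_nat_cls)
      apply (rule run_Seq)
      apply (rule run_Copy)
      subgoal using r k x by (simp add: of_nat_cls)
      apply (rule run_Seq)
      apply (rule run_mono[OF HFor.IH[OF I(2)[OF k h'(3)]]])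
      subgoal using h' r HFor.prems x by (auto simp: corr_def)
      subgoal using h' k x by (intro okh_setr) auto
      subgoal using HFor.prems by simp
      apply (elim exE conjE)
      subgoal for s1 h1
        apply (rule run_Seq)
        apply (rule run_Copy)
        subgoal using hx x HFor.prems by (simp add: of_nat_cls)
        apply (rule run_Seq)
        apply (rule run_Const[OF cls_1])
        apply (rule run_Arith)
        subgoal by simp
        subgoal using r k x HFor.prems of_nat_cls[of "Suc k"] by (simp add: add.commute)
        subgoal unfolding J_def using r x HFor.prems hx
          by (auto simp: add.commute corr_def intro!: exI[of _ "setr h1 x (hreg h' x)"] okh_setr)
        done
      done
  qed
  have "htime L (HFor x n c) \<ge> ntime n + (1 + (1 + ?m * (2 + (1 + (1 + (htime L c + (1 + (1 + 1))))))))"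
    using mult_le_mono1[OF x(4), of "htime L c + 7"] by (simp add: algebra_simps)
  then show ?case unfolding hcomp.simps
    apply (rule run_time[rotated])
    apply (rule run_Seq)
    apply (rule run_mono[OF ncomp_run[of n h]])
    subgoal using x by simp
    subgoal using x by simp
    subgoal using HFor.prems by simp
    subgoal using HFor.prems by simp
    subgoal using HFor.prems by simp
    apply (rule run_Seq)
    apply (rule run_Const[OF cls_0])
    apply (rule run_mono[OF run_counted[of ?m J, OF body]])
    subgoal by simp
    subgoal by simp
    subgoal by (simp add: J_def)
    subgoal using I(1) HFor.prems by (auto simp: J_def keep_def corr_def)
    subgoal using I(3) by (auto simp: J_def)
    done
qed

end

section \<open>Verification conditions\<close>

text \<open>The variable of \<open>HFor\<close> is not listed, as it is restored after every
  round.\<close>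

primrec wr :: "hcom \<Rightarrow> nat set" where
  "wr HSkip = {}"
| "wr (Asg x e) = {x}"
| "wr (Put a i e) = {}"
| "wr (HSeq c d) = wr c \<union> wr d"
| "wr (HIf b e1 e2 c d) = wr c \<union> wr d"
| "wr (HFor x n c) = wr c"

primrec wa :: "hcom \<Rightarrow> nat set" where
  "wa HSkip = {}"
| "wa (Asg x e) = {}"
| "wa (Put a i e) = {a}"
| "wa (HSeq c d) = wa c \<union> wa d"
| "wa (HIf b e1 e2 c d) = wa c \<union> wa d"
| "wa (HFor x n c) = wa c"

primrec arrs :: "exp \<Rightarrow> nat set" where
  "arrs (EC q) = {}"
| "arrs (EN e) = {}"
| "arrs (Get a i) = {a}"
| "arrs (Bin op a b) = arrs a \<union> arrs b"
| "arrs (Sum x n e) = arrs e"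
| "arrs (Cond b e1 e2 e3 e4) = arrs e1 \<union> arrs e2 \<union> arrs e3 \<union> arrs e4"

definition unch :: "hcom \<Rightarrow> hstate \<Rightarrow> hstate \<Rightarrow> bool" where
  "unch c h h' \<longleftrightarrow> (\<forall>x. x \<notin> wr c \<longrightarrow> hreg h' x = hreg h x) \<and> (\<forall>a. a \<notin> wa c \<longrightarrow> hmem h' a = hmem h a)"

lemma hstate_upd[simp]:
  fixes h :: hstate
  shows "hreg_update f (hmem_update g h) = hmem_update g (hreg_update f h)"
    "hmem_update (\<lambda>_. hmem h) h = h" "hmem_update (\<lambda>_. hmem h) (hreg_update f h) = hreg_update f h"
    "hreg_update (\<lambda>_. hreg h) h = h"
  by simp_all

lemma nev_hmem[simp]: "nev e (h\<lparr>hmem := m\<rparr>) = nev e h"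
  by (induction e) auto

lemma ev_hmem: "(\<And>a. a \<in> arrs e \<Longrightarrow> m a = hmem h a) \<Longrightarrow> ev e (h\<lparr>hmem := m\<rparr>) = ev e h"
proof (induction e arbitrary: h)
  case (Sum x n e)
  have "ev e (setr (h\<lparr>hmem := m\<rparr>) x k) = ev e (setr h x k)" for k
    using Sum.IH[of "setr h x k"] Sum.prems by simp
  then show ?case by simp
qed auto

context sized
begin

lemma nok_hmem[simp]: "nok e (h\<lparr>hmem := m\<rparr>) = nok e h"
  by (induction e) auto

lemma chk_hmem: "(\<And>a. a \<in> arrs e \<Longrightarrow> m a = hmem h a) \<Longrightarrow> chk \<delta> e (h\<lparr>hmem := m\<rparr>) = chk \<delta> e h"
proof (induction e arbitrary: h)
  case (Sum x n e)
  have "chk \<delta> e (setr (h\<lparr>hmem := m\<rparr>) x k) = chk \<delta> e (setr h x k)" for k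
    using Sum.IH[of "setr h x k"] Sum.prems by simp
  then show ?case by simp
next
  case (Bin op a b)
  then show ?case using ev_hmem[of b m h] by simp
next
  case (Cond b e1 e2 e3 e4)
  then show ?case using ev_hmem[of e1 m h] ev_hmem[of e2 m h] by simp
qed auto

lemma wp_mono: "wp c Q h \<Longrightarrow> (\<And>h'. Q h' \<Longrightarrow> Q' h') \<Longrightarrow> wp c Q' h"
proof (induction c arbitrary: Q Q' h)
  case (HSeq c d)
  have "wp c (wp d Q) h" using HSeq.prems by simp
  then have "wp c (wp d Q') h" by (rule HSeq.IH(1)) (rule HSeq.IH(2)[OF _ HSeq.prems(2)])
  then show ?case by simp
next
  case (HFor x n c)
  then show ?case by auto
next
  case (HIf b e1 e2 c d)
  then show ?case
    using HIf.IH(1)[OF _ HIf.prems(2)] HIf.IH(2)[OF _ HIf.prems(2)] by (auto split: if_splits)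
qed auto

text \<open>Every loop invariant can be strengthened by \<open>unch\<close>. Later invariants
  therefore need not mention what the program does not write.\<close>

lemma wp_frame: "wp c Q h \<Longrightarrow> wp c (\<lambda>h'. Q h' \<and> unch c h h') h"
proof (induction c arbitrary: Q h)
  case (HSeq c d)
  have "wp c (wp d Q) h" using HSeq.prems by simp
  from HSeq.IH(1)[OF this] show ?case
    unfolding wp.simps
  proof (rule wp_mono)
    fix h1 assume h1: "wp d Q h1 \<and> unch c h h1"
    then have "wp d (\<lambda>h'. Q h' \<and> unch d h1 h') h1" using HSeq.IH(2) by blast
    then show "wp d (\<lambda>h'. Q h' \<and> unch (HSeq c d) h h') h1"
      by (rule wp_mono) (use h1 in \<open>simp add: unch_def\<close>)
  qed
next
  case (HFor x n c)
  then obtain I where I: "I 0 h"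
      "\<And>k h'. k < nev n h \<Longrightarrow> I k h' \<Longrightarrow> wp c (\<lambda>h''. I (Suc k) (setr h'' x (hreg h' x))) (setr h' x k)"
      "\<And>h'. I (nev n h) h' \<Longrightarrow> Q h'"
    and x: "x < named" "nok n h" "ndg n \<le> E" "nev n h \<le> L" by auto
  have "wp c (\<lambda>h''. I (Suc k) (setr h'' x (hreg h' x)) \<and> unch c h (setr h'' x (hreg h' x))) (setr h' x k)"
    if "k < nev n h" "I k h'" "unch c h h'" for k h'
    by (rule wp_mono[OF HFor.IH[OF I(2)[OF that(1,2)]]]) (use that in \<open>auto simp: unch_def\<close>)
  then show ?case unfolding wp.simps using I x
    by (intro conjI exI[of _ "\<lambda>k h'. I k h' \<and> unch c h h'"]) (auto simp: unch_def)
next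
  case (HIf b e1 e2 c d)
  show ?case
  proof (cases "cmp_val b (ev e1 h) (ev e2 h)")
    case True
    with HIf.prems have "wp c Q h" by auto
    from wp_mono[OF HIf.IH(1)[OF this], of "\<lambda>h'. Q h' \<and> unch (HIf b e1 e2 c d) h h'"]
    show ?thesis using HIf.prems True by (auto simp: unch_def)
  next
    case False
    with HIf.prems have "wp d Q h" by auto
    from wp_mono[OF HIf.IH(2)[OF this], of "\<lambda>h'. Q h' \<and> unch (HIf b e1 e2 c d) h h'"]
    show ?thesis using HIf.prems False by (auto simp: unch_def)
  qed
qed (auto simp: unch_def)

lemma wp_Seq:
  "wp c P h \<Longrightarrow> (\<And>h'. P h' \<Longrightarrow> unch c h h' \<Longrightarrow> wp d Q h') \<Longrightarrow> wp (HSeq c d) Q h"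
  unfolding wp.simps by (rule wp_mono[OF wp_frame]) auto

lemma wp_For:
  assumes "x < named" "nok n h" "ndg n \<le> E" "nev n h \<le> L" "I 0 h"
    and body: "\<And>k h'. k < nev n h \<Longrightarrow> I k h' \<Longrightarrow> unch c h h' \<Longrightarrow>
      wp c (\<lambda>h''. I (Suc k) (setr h'' x (hreg h' x))) (setr h' x k)"
    and "\<And>h'. I (nev n h) h' \<Longrightarrow> unch c h h' \<Longrightarrow> Q h'"
  shows "wp (HFor x n c) Q h"
proof -
  have "wp c (\<lambda>h''. I (Suc k) (setr h'' x (hreg h' x)) \<and> unch c h (setr h'' x (hreg h' x))) (setr h' x k)"
    if "k < nev n h" "I k h'" "unch c h h'" for k h'
    by (rule wp_mono[OF wp_frame[OF body[OF that]]]) (use that in \<open>auto simp: unch_def\<close>)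
  then show ?thesis unfolding wp.simps using assms
    by (intro conjI exI[of _ "\<lambda>k h'. I k h' \<and> unch c h h'"]) (auto simp: unch_def)
qed

end

text \<open>Arrays: 0 input, 1 the matrix \<open>- P(t)\<close>, 2 and 3 the iterates of the Faddeev--LeVerrier recursion
  (3 is a buffer), 4 its coefficients for \<open>- P(t)\<close>, 5 the coefficient \<open>f\<close> under test, 6 \<open>gpoly f S\<close>, 7 its
  leading coefficient, 8 its normalised reversal, 9 its power sums, 10 and 11 the moments for \<open>f\<close> and
  \<open>f\<^sup>2\<close>, 12 a Hankel matrix, 13 the recursion coefficients for it, 14 the entry of the last sign change.
  Registers 0 and 1 hold \<open>n\<close> and \<open>d\<close>.  A polynomial is stored modulo \<open>t ^ T\<close>, and the one at position
  \<open>(i, j)\<close> of an \<open>N \<times> N\<close> matrix starts at \<open>(i * N + j) * T\<close>.\<close>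

abbreviation rN :: nat where "rN \<equiv> 3"
abbreviation rT :: nat where "rT \<equiv> 4"
abbreviation ri :: nat where "ri \<equiv> 5"
abbreviation rj :: nat where "rj \<equiv> 6"
abbreviation rl :: nat where "rl \<equiv> 7"

definition fill1 :: "nat \<Rightarrow> nexp \<Rightarrow> nexp \<Rightarrow> exp \<Rightarrow> hcom" where
  "fill1 a n off e = HFor rl n (Put a (NAdd off (NV rl)) e)"

definition fill3 :: "nat \<Rightarrow> exp \<Rightarrow> hcom" where
  "fill3 a e = HFor ri (NV rN) (HFor rj (NV rN) (HFor rl (NV rT)
     (Put a (NAdd (NMul (NAdd (NMul (NV ri) (NV rN)) (NV rj)) (NV rT)) (NV rl)) e)))"

lemma wr_fill[simp]: "wr (fill1 a n off e) = {}" "wr (fill3 a e) = {}"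
  and wa_fill[simp]: "wa (fill1 a n off e) = {a}" "wa (fill3 a e) = {a}"
  by (auto simp: fill1_def fill3_def)

context sized
begin

text \<open>As \<open>e\<close> does not read \<open>a\<close>, all entries are computed from the
  initial memory and the loop acts as a simultaneous assignment.\<close>

lemma wp_fill1:
  assumes n: "nok n h" "ndg n \<le> E" "nev n h \<le> L"
    and off: "\<And>k. nok off (setr h rl k) \<and> nev off (setr h rl k) = o1" "ndg off + 1 \<le> E"
    and a: "a \<notin> arrs e"
    and chk: "\<And>k. k < nev n h \<Longrightarrow> chk \<delta> e (setr h rl k)" and dg: "dg \<delta> e \<le> E"
    and "okh h"
    and Q: "\<And>h'. hreg h' = hreg h \<Longrightarrow> (\<And>b. b \<noteq> a \<Longrightarrow> hmem h' b = hmem h b) \<Longrightarrow>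
      (\<And>k. k < nev n h \<Longrightarrow> hmem h' a (o1 + k) = ev e (setr h rl k)) \<Longrightarrow>
      (\<And>k. k < nev n h \<Longrightarrow> hmem h' a (o1 + k) \<in> cls (dg \<delta> e)) \<Longrightarrow>
      (\<And>i. i < o1 \<Longrightarrow> hmem h' a i = hmem h a i) \<Longrightarrow> Q h'"
  shows "wp (fill1 a n off e) Q h"
proof -
  define m where "m k = (hmem h)(a := (\<lambda>i. if o1 \<le> i \<and> i < o1 + k then ev e (setr h rl (i - o1)) else hmem h a i))" for k
  show ?thesis unfolding fill1_def
  proof (rule wp_For[where I = "\<lambda>k h'. h' = h\<lparr>hmem := m k\<rparr>"])
    show "h = h\<lparr>hmem := m 0\<rparr>" by (simp add: m_def cong: if_cong) (simp flip: not_le)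
  next
    fix k h' assume k: "k < nev n h" and h': "h' = h\<lparr>hmem := m k\<rparr>"
    have s: "setr h' rl k = (setr h rl k)\<lparr>hmem := m k\<rparr>" using h' by simp
    have "\<And>b. b \<in> arrs e \<Longrightarrow> m k b = hmem (setr h rl k) b" using a by (auto simp: m_def)
    from ev_hmem[OF this] chk_hmem[OF this]
    have v: "ev e (setr h' rl k) = ev e (setr h rl k)" "chk \<delta> e (setr h' rl k)"
      using chk[OF k] unfolding s by auto
    have idx: "nev (NAdd off (NV rl)) (setr h' rl k) = o1 + k" "nok (NAdd off (NV rl)) (setr h' rl k)"
      unfolding s using off by (auto simp: named_def)
    have "ndg off \<ge> 1" by (rule ndg_pos)
    then have nd: "ndg (NAdd off (NV rl)) \<le> E" using off by simp
    have "setr (setm (setr h' rl k) a (o1 + k) (ev e (setr h rl k))) rl (hreg h' rl) = h\<lparr>hmem := m (Suc k)\<rparr>"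
      by (auto simp: h' m_def fun_eq_iff)
    then show "wp (Put a (NAdd off (NV rl)) e) (\<lambda>h''. setr h'' rl (hreg h' rl) = h\<lparr>hmem := m (Suc k)\<rparr>) (setr h' rl k)"
      unfolding wp.simps(3) idx(1) v using idx(2) v(2) dg nd by blast
  next
    fix h' assume h': "h' = h\<lparr>hmem := m (nev n h)\<rparr>"
    show "Q h'"
      by (rule Q) (use ev_cls chk \<open>okh h\<close> okh_setr n h' in \<open>auto simp: m_def\<close>)
  qed (use n in \<open>auto simp: named_def\<close>)
qed

lemma flat_div_mod:
  fixes i j l N T :: nat
  assumes "j < N" "l < T"
  shows "((i * N + j) * T + l) mod T = l" "((i * N + j) * T + l) div T mod N = j"
    "((i * N + j) * T + l) div T div N = i"
proof -
  have "((i * N + j) * T + l) div T = i * N + j" using assms by simp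
  then show "((i * N + j) * T + l) mod T = l" "((i * N + j) * T + l) div T mod N = j"
    "((i * N + j) * T + l) div T div N = i" using assms by auto
qed

lemma flat_less:
  fixes i j l N T :: nat
  assumes "i < M" "j < N" "l < T"
  shows "(i * N + j) * T + l < M * N * T"
proof -
  have "Suc i * N \<le> M * N" using assms(1) by (intro mult_le_mono1) simp
  then have "Suc (i * N + j) \<le> M * N" using assms(2) by simp
  then have "Suc (i * N + j) * T \<le> M * N * T" by (intro mult_le_mono1)
  then show ?thesis using assms(3) by simp
qed

text \<open>The three loops visit the addresses in increasing order, so one description
  \<open>m k\<close> of the memory, with the first \<open>k\<close> cells filled, serves as
  invariant for all of them; \<open>div\<close> and \<open>mod\<close> recover the indices from the
  address. The 5 is the \<open>ndg\<close> of the address.\<close>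

lemma wp_fill3:
  assumes N: "hreg h rN = N" "N \<le> L" and T: "hreg h rT = T" "T \<le> L" and E5: "5 \<le> E"
    and a: "a \<notin> arrs e"
    and chk: "\<And>i j l. i < N \<Longrightarrow> j < N \<Longrightarrow> l < T \<Longrightarrow> chk \<delta> e (setr (setr (setr h ri i) rj j) rl l)"
    and dg: "dg \<delta> e \<le> E"
    and "okh h"
    and Q: "\<And>h'. hreg h' = hreg h \<Longrightarrow> (\<And>b. b \<noteq> a \<Longrightarrow> hmem h' b = hmem h b) \<Longrightarrow>
      (\<And>i j l. i < N \<Longrightarrow> j < N \<Longrightarrow> l < T \<Longrightarrow>
         hmem h' a ((i * N + j) * T + l) = ev e (setr (setr (setr h ri i) rj j) rl l)) \<Longrightarrow>
      (\<And>i j l. i < N \<Longrightarrow> j < N \<Longrightarrow> l < T \<Longrightarrow> hmem h' a ((i * N + j) * T + l) \<in> cls (dg \<delta> e)) \<Longrightarrow> Q h'"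
  shows "wp (fill3 a e) Q h"
proof -
  define v where "v x = ev e (setr (setr (setr h ri (x div T div N)) rj (x div T mod N)) rl (x mod T))" for x
  define m where "m k = (hmem h)(a := (\<lambda>i. if i < k then v i else hmem h a i))" for k
  let ?U = "\<lambda>k. h\<lparr>hmem := m k\<rparr>"
  have nm: "ri < named" "rj < named" "rl < named" "rN < named" "rT < named" by (auto simp: named_def)
  have E1'[simp]: "Suc 0 \<le> E" using E1 by simp
  show ?thesis unfolding fill3_def
  proof (rule wp_For[where I = "\<lambda>i h'. h' = ?U (i * N * T)"])
    fix i h1 assume i: "i < nev (NV rN) h" and h1: "h1 = ?U (i * N * T)"
    show "wp (HFor rj (NV rN) (HFor rl (NV rT)
     (Put a (NAdd (NMul (NAdd (NMul (NV ri) (NV rN)) (NV rj)) (NV rT)) (NV rl)) e)))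
      (\<lambda>h'. setr h' ri (hreg h1 ri) = ?U (Suc i * N * T)) (setr h1 ri i)"
    proof (rule wp_For[where I = "\<lambda>j h'. h' = setr (?U ((i * N + j) * T)) ri i"])
      fix j h2 assume j: "j < nev (NV rN) (setr h1 ri i)" and h2: "h2 = setr (?U ((i * N + j) * T)) ri i"
      have j': "j < N" using j h1 N by simp
      show "wp (HFor rl (NV rT)
        (Put a (NAdd (NMul (NAdd (NMul (NV ri) (NV rN)) (NV rj)) (NV rT)) (NV rl)) e))
         (\<lambda>h'. setr h' rj (hreg h2 rj) = setr (?U ((i * N + Suc j) * T)) ri i) (setr h2 rj j)"
      proof (rule wp_For[where I = "\<lambda>l h'. h' = setr (setr (?U ((i * N + j) * T + l)) ri i) rj j"])
        fix l h3 assume l: "l < nev (NV rT) (setr h2 rj j)"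
          and h3: "h3 = setr (setr (?U ((i * N + j) * T + l)) ri i) rj j"
        let ?x = "(i * N + j) * T + l"
        let ?h = "setr (setr (setr h ri i) rj j) rl l"
        have l': "l < T" using l h2 T by simp
        have i': "i < N" using i N by simp
        have s: "setr h3 rl l = ?h\<lparr>hmem := m ?x\<rparr>" using h3 by simp
        have "\<And>b. b \<in> arrs e \<Longrightarrow> m ?x b = hmem ?h b" using a by (auto simp: m_def)
        from ev_hmem[OF this] chk_hmem[OF this]
        have vv: "ev e (setr h3 rl l) = v ?x" "chk \<delta> e (setr h3 rl l)"
          using chk[OF i' j' l'] unfolding s v_def flat_div_mod[OF j' l'] by auto
        have idx: "nev (NAdd (NMul (NAdd (NMul (NV ri) (NV rN)) (NV rj)) (NV rT)) (NV rl)) (setr h3 rl l) = ?x"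
          using h3 N T by simp
        have "setr (setm (setr h3 rl l) a ?x (v ?x)) rl (hreg h3 rl) = setr (setr (?U (Suc ?x)) ri i) rj j"
          by (auto simp: h3 m_def fun_eq_iff less_Suc_eq)
        then show "wp (Put a (NAdd (NMul (NAdd (NMul (NV ri) (NV rN)) (NV rj)) (NV rT)) (NV rl)) e)
           (\<lambda>h'. setr h' rl (hreg h3 rl) = setr (setr (?U ((i * N + j) * T + Suc l)) ri i) rj j) (setr h3 rl l)"
          unfolding wp.simps(3) idx(1) vv using vv(2) dg E5 nm by auto
      next
        fix h' assume "h' = setr (setr (?U ((i * N + j) * T + nev (NV rT) (setr h2 rj j))) ri i) rj j"
        then show "setr h' rj (hreg h2 rj) = setr (?U ((i * N + Suc j) * T)) ri i"
          using h2 T by (simp add: algebra_simps fun_upd_idem)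
      qed (use nm T h2 in auto)
    next
      fix h' assume "h' = setr (?U ((i * N + nev (NV rN) (setr h1 ri i)) * T)) ri i"
      then show "setr h' ri (hreg h1 ri) = ?U (Suc i * N * T)"
        using h1 N by (simp add: algebra_simps)
    qed (use nm N h1 in auto)
  next
    fix h' assume "h' = ?U (nev (NV rN) h * N * T)"
    then have h': "h' = ?U (N * N * T)" using N by simp
    have *: "hmem h' a ((i * N + j) * T + l) = ev e (setr (setr (setr h ri i) rj j) rl l)"
      if "i < N" "j < N" "l < T" for i j l
     
    proof -
      have "hmem h' a ((i * N + j) * T + l) = v ((i * N + j) * T + l)"
        using flat_less[OF that] unfolding h' by (simp add: m_def)
      then show ?thesis unfolding v_def flat_div_mod[OF that(2,3)] .
    qed
    moreover have "hmem h' a ((i * N + j) * T + l) \<in> cls (dg \<delta> e)"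
      if "i < N" "j < N" "l < T" for i j l
    proof -
      have "okh (setr (setr (setr h ri i) rj j) rl l)"
        using that N T \<open>okh h\<close> by (intro okh_setr) auto
      then show ?thesis unfolding *[OF that] using ev_cls[OF chk[OF that]] by blast
    qed
    ultimately show "Q h'" by (intro Q) (auto simp: h' m_def)
  qed (use nm N in \<open>auto simp: m_def\<close>)
qed

end

section \<open>Sign changes\<close>

text \<open>The first component is the entry at which the sign last changed; zeros are passed over, as their
  product with it is not negative.\<close>

primrec sc :: "(nat \<Rightarrow> 'a::linordered_idom) \<Rightarrow> nat \<Rightarrow> 'a \<times> nat" where
  "sc c 0 = (c 0, 0)"
| "sc c (Suc k) = (if c (Suc k) * fst (sc c k) < 0 then (c (Suc k), Suc (snd (sc c k))) else sc c k)"

definition changes :: "(nat \<Rightarrow> 'a::linordered_idom) \<Rightarrow> nat \<Rightarrow> nat" where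
  "changes c n = snd (sc c n)"

text \<open>A chain of indices ending at \<open>i\<close> along which the sign changes
  \<open>v\<close> times: a certificate for a lower bound on \<open>changes\<close>, easier to
  transport through a product of polynomials than the count itself.\<close>

inductive alt :: "(nat \<Rightarrow> 'a::linordered_idom) \<Rightarrow> nat \<Rightarrow> nat \<Rightarrow> bool" for c where
  base: "c i \<noteq> 0 \<Longrightarrow> alt c 0 i"
| step: "alt c v i \<Longrightarrow> i < j \<Longrightarrow> c i * c j < 0 \<Longrightarrow> alt c (Suc v) j"

lemma sc_mono: "i \<le> k \<Longrightarrow> snd (sc c i) \<le> snd (sc c k) \<and> (snd (sc c i) = snd (sc c k) \<longrightarrow> fst (sc c i) = fst (sc c k))"
proof (induction k)
  case (Suc k)
  then show ?case by (cases "i = Suc k") (auto simp: le_Suc_eq)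
qed auto

lemma sc_nonzero: "c 0 \<noteq> 0 \<Longrightarrow> fst (sc c k) \<noteq> 0"
  by (induction k) auto

lemma mult_pos_trans: "x * y > 0 \<Longrightarrow> y * z > 0 \<Longrightarrow> x * z > (0::'a::linordered_idom)"
  by (auto simp: zero_less_mult_iff)

lemma sc_sign: "c 0 \<noteq> 0 \<Longrightarrow> c k \<noteq> 0 \<Longrightarrow> fst (sc c k) * c k > 0"
proof (cases k)
  case 0 then show "c 0 \<noteq> 0 \<Longrightarrow> c k \<noteq> 0 \<Longrightarrow> fst (sc c k) * c k > 0"
    by (auto simp: zero_less_mult_iff linorder_neq_iff)
next
  case (Suc j)
  assume "c 0 \<noteq> 0" "c k \<noteq> 0"
  then show ?thesis using sc_nonzero[of c j] Suc
    by (auto simp: zero_less_mult_iff mult_less_0_iff linorder_neq_iff)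
qed

lemma alt_nonzero: "alt c v i \<Longrightarrow> c i \<noteq> 0"
  by (induction rule: alt.induct) auto

text \<open>The greedy count is optimal: the reference entry of \<open>sc\<close> has the sign of
  every nonzero entry just passed, so it must have changed between two entries of opposite
  sign.\<close>

lemma alt_le_changes:
  assumes "alt c v i" "c 0 \<noteq> 0" "i \<le> k"
  shows "v \<le> changes c k"
proof -
  have "v \<le> snd (sc c i) \<and> (c 0 \<noteq> 0)" if "alt c v i" "c 0 \<noteq> 0" for v i
    using that
  proof (induction rule: alt.induct)
    case (step v i j)
    then have 1: "v \<le> snd (sc c i)" "c i \<noteq> 0" "c j \<noteq> 0" by auto
    have "snd (sc c i) \<noteq> snd (sc c j)"
    proof
      assume "snd (sc c i) = snd (sc c j)"
      then have "fst (sc c i) = fst (sc c j)" using sc_mono[of i j c] step.hyps by simp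
      then show False using sc_sign[OF step.prems 1(2)] sc_sign[OF step.prems 1(3)] step.hyps(3)
        by (auto simp: zero_less_mult_iff mult_less_0_iff)
    qed
    then show ?case using sc_mono[of i j c] step.hyps 1 step.prems by simp
  qed auto
  then show ?thesis using assms sc_mono[of i k c] unfolding changes_def by force
qed

text \<open>Between nonzero entries of index difference one, only one of the two sequences changes sign; for
  larger differences both may change once.\<close>

lemma changes_bound:
  fixes c :: "nat \<Rightarrow> 'a::linordered_idom"
  assumes "c 0 \<noteq> 0"
  defines "d \<equiv> \<lambda>k. (- 1) ^ k * c k"
  shows "\<exists>j\<le>k. c j \<noteq> 0 \<and> changes c k + changes d k \<le> j \<and>
    fst (sc c k) * c j > 0 \<and> fst (sc d k) * d j > 0"
proof (induction k)
  case 0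
  then show ?case using assms(1)
    by (auto simp: changes_def d_def zero_less_mult_iff linorder_neq_iff)
next
  case (Suc k)
  then obtain j where j: "j \<le> k" "c j \<noteq> 0" "changes c k + changes d k \<le> j"
     "fst (sc c k) * c j > 0" "fst (sc d k) * d j > 0" by blast
  have d0: "d 0 \<noteq> 0" using assms by (simp add: d_def)
  show ?case
  proof (cases "c (Suc k) = 0")
    case True
    with j show ?thesis by (intro exI[of _ j]) (auto simp: changes_def d_def)
  next
    case False
    then have d: "d (Suc k) \<noteq> 0" by (simp add: d_def)
    have ch: "changes e (Suc k) \<le> Suc (changes e k)"
      "e (Suc k) * fst (sc e k) > 0 \<Longrightarrow> changes e (Suc k) = changes e k" for e :: "nat \<Rightarrow> 'a"
      by (auto simp: changes_def)
    have "changes c (Suc k) + changes d (Suc k) \<le> Suc k"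
    proof (cases "j = k")
      case True
      have "c (Suc k) * c k > 0 \<or> d (Suc k) * d k > 0"
      proof -
        have "d (Suc k) * d k = - (c (Suc k) * c k)" by (cases "even k") (auto simp: d_def)
        then show ?thesis using False j(2) True by (auto simp: zero_less_mult_iff mult_less_0_iff linorder_neq_iff)
      qed
      then show ?thesis
      proof
        assume "c (Suc k) * c k > 0"
        then have "c (Suc k) * fst (sc c k) > 0" using j(4) True mult_pos_trans by (metis mult.commute)
        then show ?thesis using ch[of c] ch(1)[of d] j(3) True by linarith
      next
        assume "d (Suc k) * d k > 0"
        then have "d (Suc k) * fst (sc d k) > 0" using j(5) True mult_pos_trans by (metis mult.commute)
        then show ?thesis using ch[of d] ch(1)[of c] j(3) True by linarith
      qed
    next
      case False
      then show ?thesis using j(1,3) ch(1)[of c] ch(1)[of d] by linarith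
    qed
    then show ?thesis
      using False sc_sign[of c "Suc k"] sc_sign[of d "Suc k"] assms(1) d0 d by blast
  qed
qed

text \<open>The coefficient of \<open>x ^ k\<close> in the product of the factors
  \<open>1 - \<nu> i * x\<close> over \<open>i < n\<close>, that is, the elementary symmetric
  function of degree \<open>k\<close> with the sign \<open>(- 1) ^ k\<close>.\<close>

primrec es :: "(nat \<Rightarrow> 'a::comm_ring_1) \<Rightarrow> nat \<Rightarrow> nat \<Rightarrow> 'a" where
  "es \<nu> 0 k = (if k = 0 then 1 else 0)"
| "es \<nu> (Suc n) k = es \<nu> n k - (if k = 0 then 0 else \<nu> n * es \<nu> n (k - 1))"

lemma es_0[simp]: "es \<nu> n 0 = 1" by (induction n) auto

lemma es_gt[simp]: "n < k \<Longrightarrow> es \<nu> n k = 0"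
  by (induction n arbitrary: k) auto

text \<open>Holds for all \<open>k\<close>, also beyond \<open>n\<close> where the left side
  vanishes, so that the recursions need no case distinction. The induction adjoins one root at a
  time.\<close>

lemma newton_identity:
  "of_nat k * es \<nu> n k = - (\<Sum>j<k. es \<nu> n j * (\<Sum>i<n. \<nu> i ^ (k - j)))"
proof (induction n arbitrary: k)
  case 0
  then show ?case by simp
next
  case (Suc n)
  show ?case
  proof (cases k)
    case (Suc m)
    let ?e = "es \<nu> n" and ?e' = "es \<nu> (Suc n)" and ?l = "\<nu> n"
    let ?p = "\<lambda>k. \<Sum>i<n. \<nu> i ^ k"
    \<comment> \<open>The powers of the new root telescope, since \<open>?e' j\<close> is
      \<open>?e j - ?l * ?e (j - 1)\<close>.\<close>
    have tel: "(\<Sum>j<Suc r. ?e' j * ?l ^ (Suc r - j)) = ?l * ?e r" for r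
    proof (induction r)
      case (Suc r)
      have "(\<Sum>j<Suc (Suc r). ?e' j * ?l ^ (Suc (Suc r) - j))
        = ?l * (\<Sum>j<Suc r. ?e' j * ?l ^ (Suc r - j)) + ?e' (Suc r) * ?l"
        by (simp add: sum_distrib_left Suc_diff_le algebra_simps del: es.simps)
      also have "\<dots> = ?l * ?e (Suc r)" using Suc by (simp add: algebra_simps)
      finally show ?case .
    qed simp
    have "(\<Sum>j<Suc m. ?e' j * ?p (Suc m - j)) =
      (\<Sum>j<Suc m. ?e j * ?p (Suc m - j)) - ?l * (\<Sum>j<m. ?e j * ?p (m - j))"
    proof -
      have "(\<Sum>j<Suc m. ?e' j * ?p (Suc m - j)) = ?p (Suc m) + (\<Sum>j<m. ?e' (Suc j) * ?p (m - j))"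
        by (subst sum.lessThan_Suc_shift) simp
      moreover have "(\<Sum>j<Suc m. ?e j * ?p (Suc m - j)) = ?p (Suc m) + (\<Sum>j<m. ?e (Suc j) * ?p (m - j))"
        by (subst sum.lessThan_Suc_shift) simp
      ultimately show ?thesis
        by (simp add: sum_distrib_left sum_subtractf left_diff_distrib mult.assoc)
    qed
    also have "\<dots> = - (of_nat (Suc m) * ?e (Suc m)) + ?l * (of_nat m * ?e m)"
      using Suc.IH[of "Suc m"] Suc.IH[of m] by simp
    finally have A: "(\<Sum>j<Suc m. ?e' j * ?p (Suc m - j)) = \<dots>" .
    have "(\<Sum>j<Suc m. ?e' j * (\<Sum>i<Suc n. \<nu> i ^ (Suc m - j))) =
      (\<Sum>j<Suc m. ?e' j * ?p (Suc m - j)) + (\<Sum>j<Suc m. ?e' j * ?l ^ (Suc m - j))"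
      by (simp add: sum.distrib ring_distribs del: es.simps)
    also have "\<dots> = - (of_nat (Suc m) * ?e' (Suc m))"
      unfolding A tel by (simp add: algebra_simps)
    finally show ?thesis unfolding Suc by (simp del: es.simps)
  qed simp
qed

section \<open>Descartes' rule for products of real linear factors\<close>

lemma sum_sign:
  fixes f :: "nat \<Rightarrow> real"
  assumes "finite A" "s * sum f A > 0"
  obtains k where "k \<in> A" "s * f k > 0"
proof -
  have "\<exists>k\<in>A. s * f k > 0"
    using assms by (metis (no_types, lifting) linorder_not_less sum_distrib_left sum_nonpos)
  then show ?thesis using that by blast
qed

text \<open>After scaling by \<open>l ^ k\<close>, multiplication by \<open>1 - l * x\<close> takes
  differences, so sums of \<open>P\<close> over intervals are increments of \<open>Q\<close>.
  Between two entries of \<open>Q\<close> of opposite sign the increment, and hence some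
  \<open>P k\<close>, has the sign of the later one.\<close>

lemma alt_mult:
  fixes q :: "nat \<Rightarrow> real"
  assumes l: "l > 0"
  defines "p \<equiv> \<lambda>k. q k - (if k = 0 then 0 else l * q (k - 1))"
  assumes "alt q v i"
  shows "\<exists>i'\<le>i. alt p v i' \<and> p i' * q i > 0"
  using assms(3)
proof -
  define Q where "Q k = q k / l ^ k" for k
  define P where "P k = p k / l ^ k" for k
  have P: "P 0 = Q 0" "P (Suc k) = Q (Suc k) - Q k" for k
    using l by (auto simp: P_def Q_def p_def field_simps)
  have s0: "sum P {..i} = Q i" for i by (induction i) (auto simp: P)
  have s1: "sum P {i<..j} = Q j - Q i" if "i < j" for i j
    using that by (induction j) (auto simp: P less_Suc_eq simp flip: atLeastSucAtMost_greaterThanAtMost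
        intro!: )
  have sg: "s * P k > 0 \<longleftrightarrow> s * p k > 0" "s * Q k > 0 \<longleftrightarrow> s * q k > 0" for s k
    using l by (auto simp: P_def Q_def zero_less_mult_iff zero_less_divide_iff divide_less_0_iff)
  show ?thesis using assms(3)
  proof (induction rule: alt.induct)
    case (base i)
    then have "q i * sum P {..i} > 0" unfolding s0 sg
      by (auto simp add: zero_less_mult_iff linorder_neq_iff)
    then obtain k where "k \<le> i" "q i * P k > 0" by (rule sum_sign[rotated]) auto
    then show ?case unfolding sg by (intro exI[of _ k]) (auto intro!: alt.base simp: mult.commute)
  next
    case (step v i j)
    then obtain i' where i': "i' \<le> i" "alt p v i'" "p i' * q i > 0" by blast
    have "q j * Q j > 0" "q j * (- Q i) > 0" unfolding minus_mult_commute
      using sg(2)[of "q j" j] sg(2)[of "- q j" i] step.hyps(3)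
      by (auto simp: zero_less_mult_iff mult_less_0_iff)
    then have "q j * (Q j - Q i) > 0" by (simp add: right_diff_distrib)
    then have "q j * sum P {i<..j} > 0" unfolding s1[OF step.hyps(2)] .
    then obtain k where k: "i < k" "k \<le> j" "q j * P k > 0" by (rule sum_sign[rotated]) auto
    have "p i' * p k < 0" using i'(3) k(3)[unfolded sg] step.hyps(3)
      by (auto simp: zero_less_mult_iff mult_less_0_iff)
    then have "alt p (Suc v) k" using i' k by (intro alt.step[of p v i']) auto
    moreover have "p k * q j > 0" using k(3)[unfolded sg] by (simp add: mult.commute)
    ultimately show ?case using k(2) by blast
  qed
qed

text \<open>The gain of one: behind the last index of the chain \<open>Q\<close> must return to 0 at
  \<open>Suc n\<close>, and this increment yields a further entry of \<open>p\<close> of the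
  opposite sign.\<close>

lemma alt_mult_Suc:
  fixes q :: "nat \<Rightarrow> real"
  assumes l: "l > 0"
  defines "p \<equiv> \<lambda>k. q k - (if k = 0 then 0 else l * q (k - 1))"
  assumes "alt q v i" and deg: "\<And>k. k > n \<Longrightarrow> q k = 0"
  shows "\<exists>i'\<le>Suc n. alt p (Suc v) i'"
proof -
  define Q where "Q k = q k / l ^ k" for k
  define P where "P k = p k / l ^ k" for k
  have P: "P 0 = Q 0" "P (Suc k) = Q (Suc k) - Q k" for k
    using l by (auto simp: P_def Q_def p_def field_simps)
  have s1: "i < j \<Longrightarrow> sum P {i<..j} = Q j - Q i" for i j
    by (induction j) (auto simp: P less_Suc_eq simp flip: atLeastSucAtMost_greaterThanAtMost)
  have i: "q i \<noteq> 0" "i \<le> n" using alt_nonzero[OF assms(3)] deg not_less by blast+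
  obtain i' where i': "i' \<le> i" "alt p v i'" "p i' * q i > 0"
    using alt_mult[OF l assms(3)] unfolding p_def by blast
  have "sum P {i<..Suc n} = - Q i" using s1[of i "Suc n"] i deg[of "Suc n"] by (simp add: Q_def)
  moreover have "q i * Q i > 0" using i l by (auto simp: Q_def zero_less_mult_iff zero_less_divide_iff linorder_neq_iff divide_less_0_iff)
  ultimately have "(- q i) * sum P {i<..Suc n} > 0" by simp
  then obtain k where k: "i < k" "k \<le> Suc n" "(- q i) * P k > 0" by (rule sum_sign[rotated]) auto
  have "p i' * p k < 0" using k(3) l i'(3)
    by (auto simp: P_def zero_less_mult_iff mult_less_0_iff zero_less_divide_iff divide_less_0_iff)
  then show ?thesis using i' k alt.step[of p v i' k] by auto
qed

lemma es_coeff: "es \<nu> n k = coeff (\<Prod>i<n. [:1, - \<nu> i:]) k"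
proof (induction n arbitrary: k)
  case (Suc n)
  have "(\<Prod>i<Suc n. [:1, - \<nu> i:]) = (\<Prod>i<n. [:1, - \<nu> i:]) + Polynomial.smult (- \<nu> n) (pCons 0 (\<Prod>i<n. [:1, - \<nu> i:]))"
    by (simp add: mult.commute[of _ "[:1, - \<nu> n:]"])
  then show ?case by (simp only: es.simps Suc.IH) (auto simp: coeff_pCons split: nat.splits)
qed auto

lemma alt_prod:
  fixes \<nu> :: "'b \<Rightarrow> real"
  assumes "finite P" "\<And>i. i \<in> P \<Longrightarrow> \<nu> i > 0" "coeff q 0 \<noteq> 0"
  shows "\<exists>i. alt (coeff (q * (\<Prod>i\<in>P. [:1, - \<nu> i:]))) (card P) i"
  using assms
proof (induction P rule: finite_induct)
  case empty
  then show ?case using alt.base[of "coeff q" 0] by auto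
next
  case (insert x P)
  let ?r = "q * (\<Prod>i\<in>P. [:1, - \<nu> i:])"
  from insert obtain i where i: "alt (coeff ?r) (card P) i" by auto
  have *: "coeff ([:1, - \<nu> x:] * ?r) = (\<lambda>k. coeff ?r k - (if k = 0 then 0 else \<nu> x * coeff ?r (k - 1)))"
    by (rule ext) (auto simp: coeff_pCons split: nat.splits)
  have **: "q * (\<Prod>i\<in>insert x P. [:1, - \<nu> i:]) = [:1, - \<nu> x:] * ?r"
    unfolding prod.insert[OF insert.hyps] by (simp only: mult.left_commute)
  have "\<exists>i. alt (coeff ([:1, - \<nu> x:] * ?r)) (Suc (card P)) i"
    unfolding * using alt_mult_Suc[OF _ i, of "\<nu> x" "degree ?r"] insert.prems coeff_eq_0 by blast
  then show ?case unfolding ** card_insert_disjoint[OF insert.hyps] .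
qed

text \<open>Equality by counting. The sequence changes sign at least as often as there are positive
  \<open>\<nu> i\<close>, its twist by \<open>(- 1) ^ k\<close> at least as often as there are
  negative ones. By \<open>changes_bound\<close> both counts together do not exceed the degree,
  which is at most the sum of the two numbers. A vanishing \<open>\<nu> i\<close> contributes the
  factor 1.\<close>

theorem changes_es:
  fixes \<nu> :: "nat \<Rightarrow> real"
  shows "changes (es \<nu> n) n = card {i. i < n \<and> \<nu> i > 0}"
proof -
  define P where "P = {i. i < n \<and> \<nu> i > 0}"
  define N where "N = {i. i < n \<and> \<nu> i < 0}"
  have fin: "finite P" "finite N" "P \<inter> N = {}" by (auto simp: P_def N_def)
  have split: "(\<Prod>i<n. [:1, - \<nu> i:]) = (\<Prod>i\<in>N. [:1, - \<nu> i:]) * (\<Prod>i\<in>P. [:1, - \<nu> i:])"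
    "(\<Prod>i<n. [:1, \<nu> i:]) = (\<Prod>i\<in>P. [:1, \<nu> i:]) * (\<Prod>i\<in>N. [:1, \<nu> i:])"
  proof -
    have z: "(\<Prod>i<n. f i) = (\<Prod>i\<in>N. f i) * (\<Prod>i\<in>P. f i)"
      if "\<And>i. \<nu> i = 0 \<Longrightarrow> f i = 1" for f :: "nat \<Rightarrow> real poly"
    proof -
      have "(\<Prod>i<n. f i) = (\<Prod>i\<in>N \<union> P. f i)"
        by (rule prod.mono_neutral_right) (use that in \<open>force simp: P_def N_def\<close>)+
      also have "\<dots> = (\<Prod>i\<in>N. f i) * (\<Prod>i\<in>P. f i)"
        using fin by (intro prod.union_disjoint) auto
      finally show ?thesis .
    qed
    show "(\<Prod>i<n. [:1, - \<nu> i:]) = (\<Prod>i\<in>N. [:1, - \<nu> i:]) * (\<Prod>i\<in>P. [:1, - \<nu> i:])"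
      by (rule z) (simp add: one_pCons)
    have "(\<Prod>i<n. [:1, \<nu> i:]) = (\<Prod>i\<in>N. [:1, \<nu> i:]) * (\<Prod>i\<in>P. [:1, \<nu> i:])"
      by (rule z) (simp add: one_pCons)
    then show "(\<Prod>i<n. [:1, \<nu> i:]) = (\<Prod>i\<in>P. [:1, \<nu> i:]) * (\<Prod>i\<in>N. [:1, \<nu> i:])"
      by (simp only: mult.commute)
  qed
  let ?c = "es \<nu> n" and ?d = "\<lambda>k. (- 1) ^ k * es \<nu> n k"
  have c: "?c = coeff (\<Prod>i<n. [:1, - \<nu> i:])" by (rule ext) (rule es_coeff)
  have d: "?d = coeff (\<Prod>i<n. [:1, \<nu> i:])"
  proof
    fix k
    have "es (\<lambda>i. - \<nu> i) n k = (- 1) ^ k * es \<nu> n k" for k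
    proof (induction n arbitrary: k)
      case (Suc n)
      then show ?case by (cases k) (auto simp: algebra_simps)
    qed auto
    then show "?d k = coeff (\<Prod>i<n. [:1, \<nu> i:]) k" using es_coeff[of "\<lambda>i. - \<nu> i" n k] by simp
  qed
  have c0: "coeff (\<Prod>i\<in>A. [:1, f i:]) 0 \<noteq> (0::real)" for A :: "nat set" and f
  proof -
    have "coeff (\<Prod>i\<in>A. [:1, f i:]) 0 = 1"
      by (simp add: poly_prod flip: poly_0_coeff_0)
    then show ?thesis by simp
  qed
  have "\<exists>i. alt (coeff ((\<Prod>i\<in>N. [:1, - \<nu> i:]) * (\<Prod>i\<in>P. [:1, - \<nu> i:]))) (card P) i"
    by (rule alt_prod[OF fin(1) _ c0]) (simp add: P_def)
  then obtain i where i: "alt ?c (card P) i" unfolding c split(1) by blast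
  have "\<exists>i. alt (coeff ((\<Prod>i\<in>P. [:1, \<nu> i:]) * (\<Prod>i\<in>N. [:1, - (- \<nu> i):]))) (card N) i"
    by (rule alt_prod[OF fin(2) _ c0]) (simp add: N_def)
  then obtain j where j: "alt ?d (card N) j" unfolding d split(2) minus_minus by blast
  have dn: "k \<le> n" if "?c k \<noteq> 0" for k using that es_gt not_less by blast
  have "i \<le> n" "j \<le> n" using dn alt_nonzero[OF i] alt_nonzero[OF j] by auto
  then have lo: "card P \<le> changes ?c n" "card N \<le> changes ?d n"
    using alt_le_changes[OF i] alt_le_changes[OF j] by auto
  obtain k where k: "?c k \<noteq> 0" "changes ?c n + changes ?d n \<le> k"
    using changes_bound[of ?c n] by auto
  have "degree (\<Prod>i\<in>A. [:1, - \<nu> i:]) \<le> card A" if "finite A" for A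
    using that
  proof (induction A rule: finite_induct)
    case (insert x A)
    have "degree (\<Prod>i\<in>insert x A. [:1, - \<nu> i:]) \<le> degree [:1, - \<nu> x:] + degree (\<Prod>i\<in>A. [:1, - \<nu> i:])"
      unfolding prod.insert[OF insert.hyps] by (rule degree_mult_le)
    also have "\<dots> \<le> 1 + card A" using insert by (intro add_mono) auto
    finally show ?case using insert by simp
  qed simp
  then have "degree (\<Prod>i<n. [:1, - \<nu> i:]) \<le> card N + card P"
    unfolding split using fin by (meson add_mono degree_mult_le order_trans)
  moreover have "k \<le> degree (\<Prod>i<n. [:1, - \<nu> i:])" using k(1) unfolding c by (rule le_degree)
  ultimately show ?thesis using lo k(2) unfolding P_def by linarith
qed

section \<open>Spectral decomposition\<close>

text \<open>The dimension argument behind all comparisons of cardinalities below. One equation with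
  a pivot \<open>j0\<close> eliminates one unknown.\<close>

lemma homogeneous_system:
  fixes a :: "'k \<Rightarrow> 'j \<Rightarrow> 'f::field"
  assumes "finite K" "finite J" "card K < card J"
  shows "\<exists>c. (\<exists>j\<in>J. c j \<noteq> 0) \<and> (\<forall>k\<in>K. (\<Sum>j\<in>J. a k j * c j) = 0)"
  using assms
proof (induction K arbitrary: J a rule: finite_induct)
  case empty
  then have "J \<noteq> {}" by auto
  then show ?case by (intro exI[of _ "\<lambda>_. 1"]) auto
next
  case (insert k K)
  show ?case
  proof (cases "\<forall>j\<in>J. a k j = 0")
    case True
    have "card K < card J" using insert by simp
    from insert.IH[OF insert.prems(1) this, of a] show ?thesis using True by auto
  next
    case False
    then obtain j0 where j0: "j0 \<in> J" "a k j0 \<noteq> 0" by auto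
    let ?J = "J - {j0}"
    let ?a = "\<lambda>k' j. a k' j - a k' j0 * a k j / a k j0"
    have "finite ?J" "card K < card ?J" using insert j0 by auto
    from insert.IH[OF this, of ?a] obtain c where
      c: "\<exists>j\<in>?J. c j \<noteq> 0" "\<And>k'. k' \<in> K \<Longrightarrow> (\<Sum>j\<in>?J. ?a k' j * c j) = 0" by blast
    define s where "s = (\<Sum>j\<in>?J. a k j * c j)"
    \<comment> \<open>The value of the eliminated unknown that equation \<open>k\<close>
      forces.\<close>
    define d where "d = c(j0 := - s / a k j0)"
    have split: "(\<Sum>j\<in>J. a k' j * d j) = a k' j0 * (- s / a k j0) + (\<Sum>j\<in>?J. a k' j * c j)" for k'
      using insert.prems(1) j0 by (subst sum.remove[of _ j0]) (auto simp: d_def intro!: sum.cong)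
    have "(\<Sum>j\<in>J. a k' j * d j) = 0" if "k' \<in> insert k K" for k'
    proof (cases "k' = k")
      case True
      then show ?thesis unfolding split using j0 by (simp add: s_def)
    next
      case False
      then have "(\<Sum>j\<in>?J. ?a k' j * c j) = 0" using that c by auto
      moreover have "(\<Sum>j\<in>?J. ?a k' j * c j) = (\<Sum>j\<in>?J. a k' j * c j) - a k' j0 / a k j0 * s"
        by (simp add: s_def sum_distrib_left left_diff_distrib sum_subtractf mult.assoc)
      ultimately show ?thesis unfolding split by simp
    qed
    then show ?thesis using c(1) by (intro exI[of _ d]) (auto simp: d_def)
  qed
qed

section \<open>Eigenvectors of real symmetric matrices\<close>

lemma trace_mult_commute:
  fixes A B :: "'a::comm_semiring_0 mat"
  assumes "A \<in> carrier_mat n n" "B \<in> carrier_mat n n"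
  shows "(\<Sum>i<n. (A * B) $$ (i, i)) = (\<Sum>i<n. (B * A) $$ (i, i))"
proof -
  have "(\<Sum>i<n. (A * B) $$ (i, i)) = (\<Sum>i<n. \<Sum>k<n. A $$ (i, k) * B $$ (k, i))"
    using assms by (simp add: scalar_prod_def lessThan_atLeast0)
  also have "\<dots> = (\<Sum>k<n. \<Sum>i<n. B $$ (k, i) * A $$ (i, k))"
    by (subst sum.swap) (simp add: mult.commute)
  also have "\<dots> = (\<Sum>i<n. (B * A) $$ (i, i))"
    using assms by (simp add: scalar_prod_def lessThan_atLeast0)
  finally show ?thesis .
qed

text \<open>If all eigenvalues vanished, then so would the trace of the square, which is the sum of the
  squares of the entries.\<close>

lemma symmetric_eigenvector:
  fixes A :: "nat \<Rightarrow> nat \<Rightarrow> real"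
  assumes sym: "\<And>i j. i < n \<Longrightarrow> j < n \<Longrightarrow> A i j = A j i"
    and nz: "i0 < n" "j0 < n" "A i0 j0 \<noteq> 0"
  obtains \<mu> v where "\<mu> \<noteq> 0" "\<And>i. i < n \<Longrightarrow> (\<Sum>j<n. A i j * v j) = \<mu> * v i" "\<exists>i<n. v i \<noteq> (0::real)"
proof -
  define M where "M = mat n n (\<lambda>(i, j). complex_of_real (A i j))"
  have M: "M \<in> carrier_mat n n" by (simp add: M_def)
  obtain es where es: "char_poly M = (\<Prod>a\<leftarrow>es. [:- a, 1:])" using char_poly_factorized[OF M] by auto
  obtain B P Q where sd: "schur_decomposition M es = (B, P, Q)" by (metis prod_cases3)
  from schur_decomposition[OF M es sd]
  have B: "similar_mat_wit M B P Q" "upper_triangular B" "diag_mat B = es" by auto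
  note W = similar_mat_witD2[OF M B(1)]
  have "\<exists>e\<in>set es. e \<noteq> 0"
  proof (rule ccontr)
    assume "\<not> ?thesis"
    then have d0: "B $$ (i, i) = 0" if "i < n" for i
      using B(3) W(5) that by (auto simp: diag_mat_def)
    have "M * M = P * (B * B * Q)"
    proof -
      have "M * M = P * B * Q * (P * B * Q)" using W(3) by simp
      also have "\<dots> = P * (B * (Q * P) * B * Q)"
        using W(4-7) by (simp add: assoc_mult_mat[of _ n n _ n _ n])
      also have "\<dots> = P * (B * B * Q)" unfolding W(2) using W(5) by simp
      finally show ?thesis .
    qed
    then have "(\<Sum>i<n. (M * M) $$ (i, i)) = (\<Sum>i<n. (B * B * Q * P) $$ (i, i))"
      using trace_mult_commute[of P n "B * B * Q"] W(4-7) by simp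
    also have "B * B * Q * P = B * B"
      using W by (simp add: assoc_mult_mat[of _ n n _ n _ n])
    also have "(\<Sum>i<n. (B * B) $$ (i, i)) = 0"
    proof (rule sum.neutral, intro ballI)
      fix i assume "i \<in> {..<n}"
      then have i: "i < n" by simp
      \<comment> \<open>\<open>B\<close> is upper triangular with zero diagonal, and one of the two
        factors lies on or below the diagonal.\<close>
      have "B $$ (i, k) * B $$ (k, i) = 0" if "k < n" for k
        using upper_triangularD[OF B(2), of k i] upper_triangularD[OF B(2), of i k] W(5) i that d0
        by (cases i k rule: linorder_cases) auto
      then show "(B * B) $$ (i, i) = 0" using i W(5) by (simp add: scalar_prod_def sum.neutral)
    qed
    finally have tr: "(\<Sum>i<n. (M * M) $$ (i, i)) = 0" .
    have "(\<Sum>i<n. (M * M) $$ (i, i)) = complex_of_real (\<Sum>i<n. \<Sum>k<n. A i k * A k i)"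
      by (simp add: M_def scalar_prod_def lessThan_atLeast0)
    with tr have "(\<Sum>i<n. \<Sum>k<n. A i k * A k i) = 0" by (simp only: of_real_eq_0_iff)
    moreover have "(\<Sum>i<n. \<Sum>k<n. A i k * A k i) = (\<Sum>i<n. \<Sum>k<n. A i k * A i k)"
      by (intro sum.cong refl arg_cong2[where f = "(*)"] sym) auto
    ultimately have "(\<Sum>i<n. \<Sum>k<n. A i k * A i k) = 0" by simp
    then have "\<forall>i\<in>{..<n}. (\<Sum>k<n. A i k * A i k) = 0"
      by (subst sum_nonneg_eq_0_iff[symmetric]) (auto intro: sum_nonneg)
    then have "(\<Sum>k<n. A i0 k * A i0 k) = 0" using nz by simp
    then have "\<forall>k\<in>{..<n}. A i0 k * A i0 k = 0"
      by (subst sum_nonneg_eq_0_iff[symmetric]) auto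
    then show False using nz by simp
  qed
  then obtain e where e: "e \<in> set es" "e \<noteq> 0" by blast
  then have "poly (char_poly M) e = 0" unfolding es poly_prod_list by (auto simp: prod_list_zero_iff)
  then have "eigenvalue M e" using eigenvalue_root_char_poly[OF M] by simp
  then obtain w where w: "w \<in> carrier_vec n" "w \<noteq> 0\<^sub>v n" "M *\<^sub>v w = e \<cdot>\<^sub>v w"
    using M unfolding eigenvalue_def eigenvector_def by auto
  define z where "z i = w $ i" for i
  have eq: "(\<Sum>j<n. complex_of_real (A i j) * z j) = e * z i" if "i < n" for i
  proof -
    have "(M *\<^sub>v w) $ i = (\<Sum>j<n. complex_of_real (A i j) * z j)"
      using w(1) that by (simp add: M_def scalar_prod_def z_def lessThan_atLeast0)
    then show ?thesis using w(1,3) that by (simp add: z_def)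
  qed
  obtain i1 where i1: "i1 < n" "z i1 \<noteq> 0"
  proof -
    have "\<exists>i<n. w $ i \<noteq> 0" using w by (auto simp: vec_eq_iff)
    then show ?thesis using that by (auto simp: z_def)
  qed
  define N where "N = (\<Sum>i<n. (cmod (z i))\<^sup>2)"
  have "N > 0" unfolding N_def using i1 by (intro sum_pos2[of _ i1]) auto
  \<comment> \<open>The Hermitian form of \<open>A\<close> at \<open>z\<close>. It equals
    \<open>e * N\<close> and its own conjugate, which makes \<open>e\<close> real.\<close>
  define F where "F = (\<Sum>i<n. \<Sum>j<n. complex_of_real (A i j) * (cnj (z i) * z j))"
  have "F = (\<Sum>i<n. cnj (z i) * (\<Sum>j<n. complex_of_real (A i j) * z j))"
    unfolding F_def by (simp add: sum_distrib_left mult_ac)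
  also have "\<dots> = (\<Sum>i<n. e * (cnj (z i) * z i))"
    by (rule sum.cong) (auto simp: eq)
  also have "\<dots> = e * complex_of_real N"
    unfolding N_def sum_distrib_left[symmetric] of_real_sum complex_norm_square
    by (simp only: mult.commute)
  finally have FN: "F = e * complex_of_real N" .
  have "cnj F = (\<Sum>i<n. \<Sum>j<n. complex_of_real (A i j) * (z i * cnj (z j)))"
    unfolding F_def by simp
  also have "\<dots> = (\<Sum>j<n. \<Sum>i<n. complex_of_real (A i j) * (z i * cnj (z j)))"
    by (rule sum.swap)
  also have "\<dots> = F" unfolding F_def using sym by (intro sum.cong refl) (auto simp: mult_ac)
  finally have "Im F = 0" by (metis cnj.simps(2) equal_neg_zero)
  then have Im: "Im e = 0" using FN \<open>N > 0\<close> by simp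
  \<comment> \<open>With \<open>A\<close> and \<open>e\<close> real, the real and the imaginary
    parts of \<open>z\<close> both solve the equation, and one of them is nonzero at
    \<open>i1\<close>.\<close>
  have r: "(\<Sum>j<n. A i j * Re (z j)) = Re e * Re (z i)" "(\<Sum>j<n. A i j * Im (z j)) = Re e * Im (z i)"
    if "i < n" for i
    using arg_cong[OF eq[OF that], of Re] arg_cong[OF eq[OF that], of Im] Im by auto
  have "Re e \<noteq> 0" using e Im complex_eqI[of e 0] by auto
  show ?thesis
  proof (cases "Re (z i1) = 0")
    case True
    then have "Im (z i1) \<noteq> 0" using i1 complex_eqI[of "z i1" 0] by auto
    then show ?thesis using that[OF \<open>Re e \<noteq> 0\<close> r(2)] i1 by blast
  next
    case False
    then show ?thesis using that[OF \<open>Re e \<noteq> 0\<close> r(1)] i1 by blast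
  qed
qed

definition orthonormal :: "nat \<Rightarrow> nat \<Rightarrow> (nat \<Rightarrow> nat \<Rightarrow> real) \<Rightarrow> bool" where
  "orthonormal n r u \<longleftrightarrow> (\<forall>i<r. \<forall>j<r. (\<Sum>a<n. u i a * u j a) = (if i = j then 1 else 0))"

lemma orthonormal_le: assumes "orthonormal n r u" shows "r \<le> n"
proof (rule ccontr)
  assume "\<not> ?thesis"
  then have "card {..<n} < card {..<r}" by simp
  from homogeneous_system[OF _ _ this, of "\<lambda>a i. u i a"] obtain c where
    c: "\<exists>j<r. c j \<noteq> 0" "\<And>a. a < n \<Longrightarrow> (\<Sum>i<r. u i a * c i) = 0" by auto
  then obtain j where j: "j < r" "c j \<noteq> 0" by blast
  have "0 = (\<Sum>a<n. (\<Sum>i<r. u i a * c i) * u j a)" using c by simp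
  also have "\<dots> = (\<Sum>i<r. c i * (\<Sum>a<n. u i a * u j a))"
    unfolding sum_distrib_right sum_distrib_left by (subst sum.swap) (simp add: mult_ac)
  also have "\<dots> = (\<Sum>i<r. c i * (if i = j then 1 else 0))"
    using assms j by (intro sum.cong) (auto simp: orthonormal_def)
  also have "\<dots> = c j" using j by (simp add: if_distrib cong: if_cong)
  finally show False using j by simp
qed

text \<open>The eigenvectors are split off one after the other; the remainder \<open>R\<close> annihilates those found
  so far.\<close>

theorem spectral:
  fixes A :: "nat \<Rightarrow> nat \<Rightarrow> real"
  assumes sym: "\<And>i j. i < n \<Longrightarrow> j < n \<Longrightarrow> A i j = A j i"
  obtains r u \<mu> where "orthonormal n r u"
    "\<And>a b. a < n \<Longrightarrow> b < n \<Longrightarrow> A a b = (\<Sum>i<r. \<mu> i * (u i a * u i b))"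
proof -
  define R where "R r u \<mu> a b = A a b - (\<Sum>i<r. \<mu> i * (u i a * u i b))"
    for r :: nat and u :: "nat \<Rightarrow> nat \<Rightarrow> real" and \<mu> a b
  define P where "P r \<longleftrightarrow> (\<exists>u \<mu>. orthonormal n r u \<and> (\<forall>i<r. \<forall>a<n. (\<Sum>b<n. R r u \<mu> a b * u i b) = 0))" for r
  have "P 0" by (simp add: P_def orthonormal_def)
  moreover have "r \<le> n" if "P r" for r using that orthonormal_le by (auto simp: P_def)
  \<comment> \<open>A number of eigenvectors at which the construction cannot be continued. A
    nonzero remainder would continue it.\<close>
  ultimately obtain r where r: "P r" "\<not> P (Suc r)"
    by (metis (full_types) Suc_n_not_le_n nat_induct)
  from r(1) obtain u \<mu> where u0: "orthonormal n r u" "\<forall>i<r. \<forall>a<n. (\<Sum>b<n. R r u \<mu> a b * u i b) = 0"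
    unfolding P_def by blast
  then have u: "orthonormal n r u" "\<And>i a. i < r \<Longrightarrow> a < n \<Longrightarrow> (\<Sum>b<n. R r u \<mu> a b * u i b) = 0" for i a
    by blast+
  have symR: "R r u \<mu> a b = R r u \<mu> b a" if "a < n" "b < n" for a b
    using sym[OF that] by (simp add: R_def mult.commute)
  have "R r u \<mu> a b = 0" if ab: "a < n" "b < n" for a b
  proof (rule ccontr)
    assume nz: "R r u \<mu> a b \<noteq> 0"
    obtain m v where v: "m \<noteq> 0" "\<And>i. i < n \<Longrightarrow> (\<Sum>j<n. R r u \<mu> i j * v j) = m * v i"
        and "\<exists>i<n. v i \<noteq> (0::real)"
      using symmetric_eigenvector[of n "R r u \<mu>", OF symR ab nz] by blast
    then obtain i1 where i1: "i1 < n" "v i1 \<noteq> 0" by blast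
    define s where "s = (\<Sum>a<n. v a * v a)"
    have s: "s > 0" unfolding s_def using i1
      by (intro sum_pos2[of _ i1]) (auto simp: zero_less_mult_iff linorder_neq_iff)
    define w where "w a = v a / sqrt s" for a
    have w1: "(\<Sum>a<n. w a * w a) = 1"
      using s by (simp add: w_def s_def flip: sum_divide_distrib)
    have wR: "(\<Sum>j<n. R r u \<mu> i j * w j) = m * w i" if "i < n" for i
      using v(2)[OF that] by (simp add: w_def flip: sum_divide_distrib)
    \<comment> \<open>Symmetry moves \<open>R\<close> from \<open>w\<close> to \<open>u i\<close>,
      which it annihilates; cancelling \<open>m\<close> uses that the eigenvalue is nonzero.\<close>
    have orth: "(\<Sum>a<n. u i a * w a) = 0" if "i < r" for i
    proof -
      have "m * (\<Sum>a<n. u i a * w a) = (\<Sum>a<n. u i a * (\<Sum>j<n. R r u \<mu> a j * w j))"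
        unfolding sum_distrib_left by (intro sum.cong refl) (simp add: wR flip: sum_distrib_left)
      also have "\<dots> = (\<Sum>j<n. (\<Sum>a<n. R r u \<mu> a j * u i a) * w j)"
        unfolding sum_distrib_left sum_distrib_right by (subst sum.swap) (simp add: mult_ac)
      also have "\<dots> = (\<Sum>j<n. (\<Sum>a<n. R r u \<mu> j a * u i a) * w j)"
        by (intro sum.cong refl arg_cong2[where f = "(*)"]) (simp add: symR)
      also have "\<dots> = 0" using u(2)[OF that] by simp
      finally show ?thesis using v(1) by simp
    qed
    define u' where "u' = u(r := w)"
    define \<mu>' where "\<mu>' = \<mu>(r := m)"
    have R': "R (Suc r) u' \<mu>' a b = R r u \<mu> a b - m * (w a * w b)" for a b
      by (simp add: R_def u'_def \<mu>'_def)
    have "orthonormal n (Suc r) u'"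
      using u(1) orth w1 by (auto simp: orthonormal_def u'_def less_Suc_eq mult.commute)
    moreover have "(\<Sum>b<n. R (Suc r) u' \<mu>' a b * u' i b) = 0" if "i < Suc r" "a < n" for i a
    proof -
      have "(\<Sum>b<n. R (Suc r) u' \<mu>' a b * u' i b) =
         (\<Sum>b<n. R r u \<mu> a b * u' i b) - m * w a * (\<Sum>b<n. u' i b * w b)"
        unfolding R' by (simp add: algebra_simps sum_subtractf sum_distrib_left)
      also have "\<dots> = 0"
      proof (cases "i = r")
        case True
        then show ?thesis using wR[OF that(2)] w1 by (simp add: u'_def)
      next
        case False
        then show ?thesis using u(2)[of i a] orth[of i] that by (simp add: u'_def)
      qed
      finally show ?thesis .
    qed
    ultimately have "P (Suc r)" unfolding P_def by blast
    then show False using r by simp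
  qed
  then show ?thesis using that[OF u(1), of \<mu>] by (simp add: R_def)
qed

section \<open>The Faddeev--LeVerrier recursion\<close>

text \<open>The matrices are \<open>A\<close> times the customary auxiliary ones, so the trace is
  read off directly. The coefficients come in the order of \<open>det (1 - x A)\<close>, beginning
  with the constant term 1, and the only divisors are the step numbers.\<close>

primrec fl :: "(nat \<Rightarrow> nat \<Rightarrow> rat poly) \<Rightarrow> nat \<Rightarrow> nat \<Rightarrow> (nat \<Rightarrow> nat \<Rightarrow> rat poly) \<times> rat poly" where
  "fl A N 0 = (\<lambda>_ _. 0, 1)"
| "fl A N (Suc q) = (let (M, c) = fl A N q; M' = (\<lambda>i j. (\<Sum>k<N. A i k * M k j) + A i j * c)
     in (M', Polynomial.smult (- 1 / of_nat (Suc q)) (\<Sum>i<N. M' i i)))"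

definition flM :: "(nat \<Rightarrow> nat \<Rightarrow> rat poly) \<Rightarrow> nat \<Rightarrow> nat \<Rightarrow> nat \<Rightarrow> nat \<Rightarrow> rat poly" where
  "flM A N q = fst (fl A N q)"

definition flC :: "(nat \<Rightarrow> nat \<Rightarrow> rat poly) \<Rightarrow> nat \<Rightarrow> nat \<Rightarrow> rat poly" where
  "flC A N q = snd (fl A N q)"

lemma fl_0[simp]: "flM A N 0 i j = 0" "flC A N 0 = 1"
  by (simp_all add: flM_def flC_def)

lemma flM_Suc: "flM A N (Suc q) i j = (\<Sum>k<N. A i k * flM A N q k j) + A i j * flC A N q"
  by (simp add: flM_def flC_def Let_def split: prod.splits)

lemma flC_Suc: "flC A N (Suc q) = Polynomial.smult (- 1 / of_nat (Suc q)) (\<Sum>i<N. flM A N (Suc q) i i)"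
  by (simp add: flM_def flC_def Let_def split: prod.splits)

text \<open>The target field is left open, since evaluation takes place at real and at complex
  points.\<close>

definition reval :: "rat poly \<Rightarrow> 'a::field_char_0 \<Rightarrow> 'a" where
  "reval p t = poly (map_poly of_rat p) t"

lemma reval_simps[simp]:
  "reval 0 t = 0" "reval 1 t = 1"
  "reval (p + q) t = reval p t + reval q t"
  "reval (- p) t = - reval p t"
  "reval (p - q) t = reval p t - reval q t"
  "reval (p * q) t = reval p t * reval q t"
  "reval (Polynomial.smult c p) t = of_rat c * reval p t"
proof -
  show "reval 0 t = 0" "reval 1 t = 1" by (simp_all add: reval_def map_poly_1)
  have "map_poly of_rat (p + q) = (map_poly of_rat p + map_poly of_rat q :: 'a poly)"
    by (rule poly_eqI) (simp add: coeff_map_poly of_rat_add)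
  then show "reval (p + q) t = reval p t + reval q t" by (simp add: reval_def)
  have "map_poly of_rat (p - q) = (map_poly of_rat p - map_poly of_rat q :: 'a poly)"
    by (rule poly_eqI) (simp add: coeff_map_poly of_rat_diff)
  then show "reval (p - q) t = reval p t - reval q t" by (simp add: reval_def)
  have "map_poly of_rat (- p) = (- map_poly of_rat p :: 'a poly)"
    by (rule poly_eqI) (simp add: coeff_map_poly of_rat_minus)
  then show "reval (- p) t = - reval p t" by (simp add: reval_def)
  have "map_poly of_rat (p * q) = (map_poly of_rat p * map_poly of_rat q :: 'a poly)"
    by (rule poly_eqI) (simp add: coeff_map_poly coeff_mult of_rat_sum of_rat_mult)
  then show "reval (p * q) t = reval p t * reval q t" by (simp add: reval_def)
  have "map_poly of_rat (Polynomial.smult c p) = (Polynomial.smult (of_rat c) (map_poly of_rat p) :: 'a poly)"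
    by (rule poly_eqI) (simp add: coeff_map_poly of_rat_mult)
  then show "reval (Polynomial.smult c p) t = of_rat c * reval p t" by (simp add: reval_def)
qed

lemma reval_sum[simp]: "reval (\<Sum>i\<in>I. f i) t = (\<Sum>i\<in>I. reval (f i) t)"
  by (induction I rule: infinite_finite_induct) auto

lemma reval_const[simp]: "reval [:c:] t = of_rat c"
proof -
  have "reval (Polynomial.smult c 1) t = of_rat c" by (simp only: reval_simps mult_1_right)
  then show ?thesis by simp
qed

text \<open>In an orthonormal eigensystem the recursion becomes scalar: the matrix of step
  \<open>q\<close> has the eigenvalue \<open>b q (\<mu> e)\<close> at \<open>u e\<close>, so its
  trace is the sum in Newton's identity. The directions missing from the system belong to the
  eigenvalue 0 and contribute the factor 1.\<close>

lemma fl_spectral: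
  fixes t :: real
  assumes on: "orthonormal N r u"
    and A: "\<And>a b. a < N \<Longrightarrow> b < N \<Longrightarrow> reval (A a b) t = (\<Sum>e<r. \<mu> e * (u e a * u e b))"
  defines "b \<equiv> \<lambda>q x. \<Sum>j<q. es \<mu> r j * x ^ (q - j)"
  shows "reval (flC A N q) t = es \<mu> r q \<and>
    (\<forall>i<N. \<forall>j<N. reval (flM A N q i j) t = (\<Sum>e<r. b q (\<mu> e) * (u e i * u e j)))"
proof (induction q)
  case 0
  then show ?case by (simp add: b_def)
next
  case (Suc q)
  have bS: "b (Suc q) x = x * (b q x + es \<mu> r q)" for x
    by (simp add: b_def sum_distrib_left ring_distribs Suc_diff_le mult_ac)
  have M: "reval (flM A N (Suc q) i j) t = (\<Sum>e<r. b (Suc q) (\<mu> e) * (u e i * u e j))"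
    if "i < N" "j < N" for i j
  proof -
    have "(\<Sum>k<N. reval (A i k) t * reval (flM A N q k j) t)
      = (\<Sum>k<N. \<Sum>e<r. \<Sum>e'<r. \<mu> e * b q (\<mu> e') * u e i * u e' j * (u e k * u e' k))"
      using that Suc by (simp add: A sum_product mult_ac)
    also have "\<dots> = (\<Sum>e<r. \<Sum>e'<r. \<mu> e * b q (\<mu> e') * u e i * u e' j * (\<Sum>k<N. u e k * u e' k))"
      unfolding sum_distrib_left by (rule trans[OF sum.swap]) (rule sum.cong[OF refl sum.swap])
    also have "\<dots> = (\<Sum>e<r. \<Sum>e'<r. if e' = e then \<mu> e * b q (\<mu> e) * u e i * u e j else 0)"
      using on by (intro sum.cong refl) (auto simp: orthonormal_def)
    also have "\<dots> = (\<Sum>e<r. \<mu> e * b q (\<mu> e) * u e i * u e j)"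
      by (intro sum.cong refl) simp
    finally have "reval (flM A N (Suc q) i j) t =
      (\<Sum>e<r. \<mu> e * b q (\<mu> e) * u e i * u e j) + (\<Sum>e<r. \<mu> e * (u e i * u e j)) * es \<mu> r q"
      using that Suc A by (simp add: flM_Suc)
    then show ?thesis
      by (simp only: bS sum_distrib_right sum.distrib[symmetric]) (simp add: algebra_simps)
  qed
  have "(\<Sum>i<N. reval (flM A N (Suc q) i i) t) = (\<Sum>i<N. \<Sum>e<r. b (Suc q) (\<mu> e) * (u e i * u e i))"
    using M by simp
  also have "\<dots> = (\<Sum>e<r. b (Suc q) (\<mu> e) * (\<Sum>i<N. u e i * u e i))"
    unfolding sum_distrib_left by (rule sum.swap)
  also have "\<dots> = (\<Sum>e<r. b (Suc q) (\<mu> e))"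
    using on by (intro sum.cong refl) (simp add: orthonormal_def)
  also have "\<dots> = (\<Sum>j<Suc q. es \<mu> r j * (\<Sum>e<r. \<mu> e ^ (Suc q - j)))"
    unfolding b_def sum_distrib_left by (rule sum.swap)
  also have "\<dots> = - (of_nat (Suc q) * es \<mu> r (Suc q))" by (simp only: newton_identity minus_minus)
  finally have T: "(\<Sum>i<N. reval (flM A N (Suc q) i i) t) = - (of_nat (Suc q) * es \<mu> r (Suc q))" .
  have "reval (flC A N (Suc q)) t = es \<mu> r (Suc q)"
    unfolding flC_Suc reval_simps reval_sum T
    by (simp add: of_rat_divide of_rat_minus of_rat_add field_simps del: es.simps)
  then show ?case using M by blast
qed

lemma changes_extend:
  "r \<le> N \<Longrightarrow> (\<And>k. k > r \<Longrightarrow> c k = 0) \<Longrightarrow> changes c N = changes c r"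
proof (induction N)
  case (Suc N)
  then show ?case by (cases "r = Suc N") (auto simp: changes_def)
qed simp

lemma changes_of_rat: "changes (\<lambda>k. of_rat (c k) :: real) n = changes c n"
proof -
  have "sc (\<lambda>k. of_rat (c k) :: real) n = (of_rat (fst (sc c n)), snd (sc c n))"
    by (induction n) (auto simp flip: of_rat_mult)
  then show ?thesis by (simp add: changes_def)
qed

lemma changes_eq_0_iff:
  fixes c :: "nat \<Rightarrow> real"
  assumes "c 0 > 0"
  shows "changes c n = 0 \<longleftrightarrow> (\<forall>k\<le>n. c k \<ge> 0)"
proof -
  have "(snd (sc c n) = 0 \<longleftrightarrow> (\<forall>k\<le>n. c k \<ge> 0)) \<and> (snd (sc c n) = 0 \<longrightarrow> fst (sc c n) = c 0)"
    using assms by (induction n) (auto simp: le_Suc_eq mult_less_0_iff)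
  then show ?thesis by (simp add: changes_def)
qed

lemma changes_fl:
  fixes t :: real
  assumes on: "orthonormal N r u"
    and A: "\<And>a b. a < N \<Longrightarrow> b < N \<Longrightarrow> reval (A a b) t = (\<Sum>e<r. \<mu> e * (u e a * u e b))"
  shows "changes (\<lambda>k. reval (flC A N k) t) N = card {e. e < r \<and> \<mu> e > 0}"
proof -
  have "reval (flC A N k) t = es \<mu> r k" for k using fl_spectral[of N r u A t \<mu> k] assms by blast
  then have "changes (\<lambda>k. reval (flC A N k) t) N = changes (es \<mu> r) N" by presburger
  also have "\<dots> = changes (es \<mu> r) r"
    using orthonormal_le[OF on] by (rule changes_extend) simp
  finally show ?thesis by (simp add: changes_es)
qed

lemma form_spectral:
  fixes u :: "nat \<Rightarrow> nat \<Rightarrow> real"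
  assumes A: "\<And>a b. a < N \<Longrightarrow> b < N \<Longrightarrow> A a b = (\<Sum>e<r. \<mu> e * (u e a * u e b))"
  shows "(\<Sum>a<N. \<Sum>b<N. A a b * (v a * v b)) = (\<Sum>e<r. \<mu> e * (\<Sum>a<N. u e a * v a)\<^sup>2)"
proof -
  have "(\<Sum>a<N. \<Sum>b<N. A a b * (v a * v b)) = (\<Sum>a<N. \<Sum>b<N. \<Sum>e<r. \<mu> e * ((u e a * v a) * (u e b * v b)))"
    by (intro sum.cong refl) (simp add: A sum_distrib_right sum_distrib_left mult_ac)
  also have "\<dots> = (\<Sum>e<r. \<Sum>a<N. \<Sum>b<N. \<mu> e * ((u e a * v a) * (u e b * v b)))"
    by (rule trans[OF sum.cong[OF refl sum.swap] sum.swap])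
  also have "\<dots> = (\<Sum>e<r. \<mu> e * (\<Sum>a<N. u e a * v a)\<^sup>2)"
    unfolding power2_eq_square sum_product by (simp only: sum_distrib_left)
  finally show ?thesis .
qed

text \<open>The constant coefficient is 1, so all coefficients are nonnegative iff the sign never
  changes, that is, by \<open>changes_fl\<close>, iff no eigenvalue is positive.\<close>

lemma fl_nonpos_iff:
  fixes t :: real
  assumes sym: "\<And>a b. a < N \<Longrightarrow> b < N \<Longrightarrow> A a b = A b a"
  shows "(\<forall>v. (\<Sum>a<N. \<Sum>b<N. reval (A a b) t * (v a * v b)) \<le> 0) \<longleftrightarrow> (\<forall>k\<le>N. reval (flC A N k) t \<ge> 0)"
proof -
  have "reval (A a b) t = reval (A b a) t" if "a < N" "b < N" for a b using sym that by simp
  then obtain r u \<mu> where on: "orthonormal N r u"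
    and A: "\<And>a b. a < N \<Longrightarrow> b < N \<Longrightarrow> reval (A a b) t = (\<Sum>e<r. \<mu> e * (u e a * u e b))"
    using spectral[of N "\<lambda>a b. reval (A a b) t"] by blast
  have "(\<forall>k\<le>N. reval (flC A N k) t \<ge> 0) \<longleftrightarrow> (\<forall>e<r. \<mu> e \<le> 0)"
  proof -
    have "card {e. e < r \<and> \<mu> e > 0} = 0 \<longleftrightarrow> (\<forall>e<r. \<mu> e \<le> 0)"
      by simp (meson not_less)
    then show ?thesis
      using changes_eq_0_iff[of "\<lambda>k. reval (flC A N k) t" N] changes_fl[of N r u A t \<mu>] on A by simp
  qed
  also have "\<dots> \<longleftrightarrow> (\<forall>v. (\<Sum>e<r. \<mu> e * (\<Sum>a<N. u e a * v a)\<^sup>2) \<le> 0)"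
  proof
    assume "\<forall>e<r. \<mu> e \<le> 0"
    then show "\<forall>v. (\<Sum>e<r. \<mu> e * (\<Sum>a<N. u e a * v a)\<^sup>2) \<le> 0"
      by (auto intro!: sum_nonpos mult_nonpos_nonneg)
  next
    assume *: "\<forall>v. (\<Sum>e<r. \<mu> e * (\<Sum>a<N. u e a * v a)\<^sup>2) \<le> 0"
    show "\<forall>e<r. \<mu> e \<le> 0"
    proof (intro allI impI)
      fix e assume e: "e < r"
      have "(\<Sum>e'<r. \<mu> e' * (\<Sum>a<N. u e' a * u e a)\<^sup>2) = (\<Sum>e'<r. if e' = e then \<mu> e else 0)"
        using on e by (intro sum.cong refl) (auto simp: orthonormal_def)
      then show "\<mu> e \<le> 0" using *[rule_format, of "u e"] e by simp
    qed
  qed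
  finally show ?thesis by (subst form_spectral[OF A]) auto
qed

section \<open>The inertia of Hermite forms\<close>

abbreviation veval :: "nat \<Rightarrow> (nat \<Rightarrow> real) \<Rightarrow> complex \<Rightarrow> complex" where
  "veval S v a \<equiv> \<Sum>i<S. of_real (v i) * a ^ i"

lemma lagrange:
  assumes "finite R" "a \<in> R" "card R \<le> S"
  obtains p :: "complex poly" where "poly p a = 1" "\<And>b. b \<in> R \<Longrightarrow> b \<noteq> a \<Longrightarrow> poly p b = 0"
    "\<And>i. i \<ge> S \<Longrightarrow> coeff p i = 0"
proof -
  let ?q = "\<Prod>b\<in>R - {a}. [:- b, 1:]"
  have "degree ?q \<le> card (R - {a})"
    using assms(1) degree_prod_sum_le[of "R - {a}" "\<lambda>b. [:- b, 1:]"] by simp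
  moreover have "card (R - {a}) < card R" using assms by (intro psubset_card_mono) auto
  ultimately have d: "degree ?q < S" using assms(3) by linarith
  have nz: "poly ?q a \<noteq> 0" using assms by (auto simp: poly_prod)
  show ?thesis
  proof (rule that[of "Polynomial.smult (1 / poly ?q a) ?q"])
    show "poly (Polynomial.smult (1 / poly ?q a) ?q) a = 1" using nz by simp
    show "poly (Polynomial.smult (1 / poly ?q a) ?q) b = 0" if "b \<in> R" "b \<noteq> a" for b
    proof -
      have "poly ?q b = 0" using that assms(1) by (auto simp: poly_prod)
      then show ?thesis by simp
    qed
    show "coeff (Polynomial.smult (1 / poly ?q a) ?q) i = 0" if "i \<ge> S" for i
      using that d by (simp add: coeff_eq_0)
  qed
qed

lemma poly_as_sum:
  fixes p :: "'a::comm_semiring_1 poly"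
  assumes *: "\<And>i. i \<ge> S \<Longrightarrow> coeff p i = 0"
  shows "poly p x = (\<Sum>i<S. coeff p i * x ^ i)"
proof -
  have "poly p x = (\<Sum>i\<le>degree p. coeff p i * x ^ i)" by (rule poly_altdef)
  also have "\<dots> = (\<Sum>i<max S (Suc (degree p)). coeff p i * x ^ i)"
    by (rule sum.mono_neutral_left) (auto simp: coeff_eq_0)
  also have "\<dots> = (\<Sum>i<S. coeff p i * x ^ i)"
    by (rule sum.mono_neutral_right) (auto simp: *)
  finally show ?thesis .
qed

text \<open>A complex Lagrange polynomial becomes real by adding its conjugate, whose values away
  from \<open>cnj a\<close> vanish as well.\<close>

lemma real_interpolation:
  assumes R: "finite R" "card R \<le> S" "\<And>b. b \<in> R \<Longrightarrow> cnj b \<in> R"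
    and a: "a \<in> R" and z: "Im a = 0 \<Longrightarrow> Im z = 0"
  obtains v where "veval S v a = z" "\<And>b. b \<in> R \<Longrightarrow> b \<noteq> a \<Longrightarrow> b \<noteq> cnj a \<Longrightarrow> veval S v b = 0"
proof -
  obtain p where p: "poly p a = 1" "\<And>b. b \<in> R \<Longrightarrow> b \<noteq> a \<Longrightarrow> poly p b = 0"
    "\<And>i. i \<ge> S \<Longrightarrow> coeff p i = 0" using lagrange[OF R(1) a R(2)] by blast
  \<comment> \<open>For real \<open>a\<close> the polynomial and its conjugate both contribute at
    \<open>a\<close>, hence the half.\<close>
  define q where "q = Polynomial.smult (if Im a = 0 then z / 2 else z) p"
  have qS: "coeff q i = 0" "coeff (map_poly cnj q) i = 0" if "i \<ge> S" for i
    using p(3)[OF that] by (auto simp: q_def coeff_map_poly)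
  define v where "v i = 2 * Re (coeff q i)" for i
  have "veval S v b = poly q b + cnj (poly q (cnj b))" for b
  proof -
    have "veval S v b = (\<Sum>i<S. coeff (q + map_poly cnj q) i * b ^ i)"
      by (intro sum.cong refl) (simp add: v_def coeff_map_poly complex_add_cnj)
    also have "\<dots> = poly (q + map_poly cnj q) b" by (rule poly_as_sum[symmetric]) (simp add: qS)
    finally show ?thesis by simp
  qed
  note V = this
  show ?thesis
  proof (rule that[of v])
    show "veval S v a = z"
    proof (cases "Im a = 0")
      case True
      then have "cnj a = a" "cnj z = z" using z by (auto simp: complex_eq_iff)
      then show ?thesis unfolding V using p True by (simp add: q_def)
    next
      case False
      then have "cnj a \<noteq> a" by (auto simp: complex_eq_iff)
      then show ?thesis unfolding V using p False R(3)[OF a] by (simp add: q_def)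
    qed
    show "veval S v b = 0" if "b \<in> R" "b \<noteq> a" "b \<noteq> cnj a" for b
    proof -
      have "cnj b \<noteq> a" using that by auto
      then show ?thesis unfolding V using p that R(3)[OF that(1)] by (simp add: q_def)
    qed
  qed
qed

text \<open>Over a pair of conjugate roots the form contributes \<open>2 m Re (\<ell>\<^sup>2) = 2 m (Re \<ell>)\<^sup>2 - 2 m (Im \<ell>)\<^sup>2\<close>
  with \<open>\<ell> = csqrt (W a) * v a\<close>, that is one positive and one negative square.\<close>

lemma hermite_inertia:
  fixes H :: "nat \<Rightarrow> nat \<Rightarrow> real" and m :: "complex \<Rightarrow> real" and W :: "complex \<Rightarrow> complex"
  assumes R: "finite R" "card R \<le> S" "\<And>a. a \<in> R \<Longrightarrow> cnj a \<in> R"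
    and m: "\<And>a. a \<in> R \<Longrightarrow> m a > 0" "\<And>a. m (cnj a) = m a"
    and W: "\<And>a. W (cnj a) = cnj (W a)"
    and HH: "\<And>i j. i < S \<Longrightarrow> j < S \<Longrightarrow> of_real (H i j) = (\<Sum>a\<in>R. of_real (m a) * W a * a ^ (i + j))"
    and spec: "orthonormal S r u"
      "\<And>a b. a < S \<Longrightarrow> b < S \<Longrightarrow> H a b = (\<Sum>e<r. \<mu> e * (u e a * u e b))"
  shows "card {e. e < r \<and> \<mu> e > 0} = card {a \<in> R. if Im a = 0 then Re (W a) > 0 else Im a > 0 \<and> W a \<noteq> 0}"
proof -
  define P where "P = {e. e < r \<and> \<mu> e > 0}"
  define J where "J = {a \<in> R. if Im a = 0 then Re (W a) > 0 else Im a > 0 \<and> W a \<noteq> 0}"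
  \<comment> \<open>One representative of each conjugate pair of roots; \<open>\<kappa>\<close>
    doubles the weight of the nonreal ones.\<close>
  define R' where "R' = {a \<in> R. Im a \<ge> 0}"
  define \<kappa> where "\<kappa> a = (if Im a = 0 then m a else 2 * m a)" for a
  have fin: "finite P" "finite J" "finite R'" "J \<subseteq> R'" "R' \<subseteq> R"
    using R by (auto simp: P_def J_def R'_def split: if_splits)
  have \<kappa>: "\<kappa> a > 0" if "a \<in> R'" for a using that m by (auto simp: \<kappa>_def R'_def)
  let ?Q = "\<lambda>v. \<Sum>i<S. \<Sum>j<S. H i j * (v i * v j)"
  have Q1: "?Q v = (\<Sum>e<r. \<mu> e * (\<Sum>a<S. u e a * v a)\<^sup>2)" for v
    by (rule form_spectral) (rule spec(2))
  have vc: "veval S v (cnj a) = cnj (veval S v a)" for v a by simp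
  have Wr: "Im (W a) = 0" if "Im a = 0" for a
  proof -
    have "cnj a = a" using that by (simp add: complex_eq_iff)
    then show ?thesis using W[of a] by (metis cnj.simps(2) equal_neg_zero)
  qed
  have vr: "Im (veval S v a) = 0" if "Im a = 0" for v a
  proof -
    have "cnj a = a" using that by (simp add: complex_eq_iff)
    then show ?thesis using vc[of v a] by (metis cnj.simps(2) equal_neg_zero)
  qed
  have Q2: "?Q v = (\<Sum>a\<in>R'. \<kappa> a * Re (W a * (veval S v a)\<^sup>2))" for v
  proof -
    let ?f = "\<lambda>a. of_real (m a) * (W a * (veval S v a)\<^sup>2)"
    have "of_real (?Q v) = (\<Sum>i<S. \<Sum>j<S. of_real (H i j) * (of_real (v i) * of_real (v j)))"
      by (simp only: of_real_sum of_real_mult)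
    also have "\<dots> = (\<Sum>i<S. \<Sum>j<S. \<Sum>a\<in>R. of_real (m a) * (W a * ((of_real (v i) * a ^ i) * (of_real (v j) * a ^ j))))"
      by (intro sum.cong refl) (simp add: HH sum_distrib_right sum_distrib_left power_add mult_ac)
    also have "\<dots> = (\<Sum>a\<in>R. \<Sum>i<S. \<Sum>j<S. of_real (m a) * (W a * ((of_real (v i) * a ^ i) * (of_real (v j) * a ^ j))))"
      by (rule trans[OF sum.cong[OF refl sum.swap] sum.swap])
    also have "\<dots> = (\<Sum>a\<in>R. ?f a)"
      unfolding power2_eq_square sum_product by (simp only: sum_distrib_left)
    finally have "complex_of_real (?Q v) = (\<Sum>a\<in>R. ?f a)" .
    then have "Re (complex_of_real (?Q v)) = Re (\<Sum>a\<in>R. ?f a)" by (rule arg_cong)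
    then have "?Q v = (\<Sum>a\<in>R. Re (?f a))" by (simp only: Re_complex_of_real Re_sum)
    also have "\<dots> = (\<Sum>a\<in>R. m a * Re (W a * (veval S v a)\<^sup>2))" by simp
    also have "\<dots> = (\<Sum>a\<in>R'. m a * Re (W a * (veval S v a)\<^sup>2)) + (\<Sum>a\<in>R - R'. m a * Re (W a * (veval S v a)\<^sup>2))"
      using fin R by (subst sum.subset_diff[of R' R]) (auto simp: add.commute)
    also have "(\<Sum>a\<in>R - R'. m a * Re (W a * (veval S v a)\<^sup>2)) =
        (\<Sum>a\<in>{a \<in> R'. Im a \<noteq> 0}. m a * Re (W a * (veval S v a)\<^sup>2))"
    proof (rule sum.reindex_bij_witness[of _ cnj cnj])
      fix a
      show "m (cnj a) * Re (W (cnj a) * (veval S v (cnj a))\<^sup>2) = m a * Re (W a * (veval S v a)\<^sup>2)"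
      proof -
        have "W (cnj a) * (veval S v (cnj a))\<^sup>2 = cnj (W a * (veval S v a)\<^sup>2)" by (simp add: W)
        then show ?thesis by (simp only: m(2) cnj.sel)
      qed
    qed (use R(3) in \<open>auto simp: R'_def\<close>)
    also have "\<dots> = (\<Sum>a\<in>R'. if Im a \<noteq> 0 then m a * Re (W a * (veval S v a)\<^sup>2) else 0)"
      using fin by (intro sum.inter_filter) auto
    finally show ?thesis
      unfolding sum.distrib[symmetric] by (simp add: \<kappa>_def algebra_simps cong: if_cong) (auto intro!: sum.cong)
  qed
  let ?l = "\<lambda>v a. csqrt (W a) * veval S v a"
  have sq: "Re (W a * (veval S v a)\<^sup>2) = (Re (?l v a))\<^sup>2 - (Im (?l v a))\<^sup>2" for v a
  proof -
    have "W a * (veval S v a)\<^sup>2 = (?l v a)\<^sup>2" by (simp only: power_mult_distrib power2_csqrt)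
    then show ?thesis by (simp only: Re_power2)
  qed
  have re0: "Re (W a * (veval S v a)\<^sup>2) \<le> 0" if "a \<in> R'" "a \<notin> J" for v a
  proof (cases "Im a = 0")
    case True
    then have "Re (W a) \<le> 0" using that by (auto simp: J_def R'_def)
    then show ?thesis using Wr[OF True] vr[OF True] by (simp add: Re_power2 mult_nonpos_nonneg)
  next
    case False
    then have "W a = 0" using that by (auto simp: J_def R'_def)
    then show ?thesis by simp
  qed
  have "card P \<le> card J"
  proof (rule ccontr)
    assume "\<not> ?thesis"
    then have "card J < card P" by simp
    \<comment> \<open>With more positive eigenvalues than elements of \<open>J\<close>, a nontrivial
      combination of their eigenvectors annihilates all real linear forms \<open>Re (?l v a)\<close>
      with \<open>a\<close> in \<open>J\<close>. On it the form is positive by \<open>Q1\<close> but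
      at most 0 by \<open>Q2\<close>.\<close>
    from homogeneous_system[OF fin(2,1) this, of "\<lambda>a e. Re (?l (u e) a)"] obtain y where
      y: "\<exists>e\<in>P. y e \<noteq> 0" "\<And>a. a \<in> J \<Longrightarrow> (\<Sum>e\<in>P. Re (?l (u e) a) * y e) = 0" by blast
    define v where "v i = (\<Sum>e\<in>P. y e * u e i)" for i
    have lv: "?l v a = (\<Sum>e\<in>P. of_real (y e) * ?l (u e) a)" for a
    proof -
      have "veval S v a = (\<Sum>e\<in>P. of_real (y e) * veval S (u e) a)"
        unfolding v_def by (simp add: sum_distrib_left sum_distrib_right mult_ac) (rule sum.swap)
      then show ?thesis by (simp add: sum_distrib_left mult_ac)
    qed
    have l0: "Re (?l v a) = 0" if "a \<in> J" for a
    proof -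
      have "Re (?l v a) = (\<Sum>e\<in>P. y e * Re (?l (u e) a))" unfolding lv Re_sum
        by (intro sum.cong refl) simp
      then show ?thesis using y(2)[OF that] by (simp add: mult.commute)
    qed
    have "?Q v \<le> 0" unfolding Q2
    proof (rule sum_nonpos)
      fix a assume a: "a \<in> R'"
      have "Re (W a * (veval S v a)\<^sup>2) \<le> 0"
      proof (cases "a \<in> J")
        case True
        show ?thesis unfolding sq l0[OF True] by simp
      qed (use re0 a in blast)
      then show "\<kappa> a * Re (W a * (veval S v a)\<^sup>2) \<le> 0" using \<kappa>[OF a]
        by (intro mult_nonneg_nonpos) auto
    qed
    moreover have "?Q v > 0"
    proof -
      have uv: "(\<Sum>a<S. u e a * v a) = (if e \<in> P then y e else 0)" if "e < r" for e
      proof -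
        have "(\<Sum>a<S. u e a * v a) = (\<Sum>e'\<in>P. y e' * (\<Sum>a<S. u e a * u e' a))"
          unfolding v_def sum_distrib_left by (subst sum.swap) (simp add: mult_ac)
        also have "\<dots> = (\<Sum>e'\<in>P. if e' = e then y e else 0)"
          using spec(1) that by (intro sum.cong refl) (auto simp: orthonormal_def P_def)
        finally show ?thesis using fin by simp
      qed
      obtain e0 where e0: "e0 \<in> P" "y e0 \<noteq> 0" using y(1) by blast
      show ?thesis unfolding Q1
      proof (rule sum_pos2[of _ e0])
        show "0 < \<mu> e0 * (\<Sum>a<S. u e0 a * v a)\<^sup>2" using e0 uv[of e0] by (auto simp: P_def)
        show "0 \<le> \<mu> e * (\<Sum>a<S. u e a * v a)\<^sup>2" if "e \<in> {..<r}" for e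
          using uv[of e] that by (auto simp: P_def)
      qed (use e0 in \<open>auto simp: P_def\<close>)
    qed
    ultimately show False by simp
  qed
  moreover have "card J \<le> card P"
  proof (rule ccontr)
    assume "\<not> ?thesis"
    then have lt: "card P < card J" by simp
    have WJ: "csqrt (W a) \<noteq> 0" if "a \<in> J" for a using that by (auto simp: J_def split: if_splits)
    \<comment> \<open>Conversely, these polynomials, each adapted to one root in \<open>J\<close>,
      span a space on which the form is positive definite. If its dimension exceeded
      \<open>card P\<close>, it would contain a nonzero vector orthogonal to all eigenvectors with
      positive eigenvalue.\<close>
    have "\<exists>p. veval S p b = 1 / csqrt (W b) \<and> (\<forall>a\<in>R'. a \<noteq> b \<longrightarrow> veval S p a = 0)" if b: "b \<in> J" for b
    proof -
      have "Im (1 / csqrt (W b)) = 0" if "Im b = 0"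
      proof -
        have "Re (W b) > 0" "Im (W b) = 0" using b that Wr by (auto simp: J_def)
        then have "csqrt (W b) = of_real (sqrt (Re (W b)))"
          by (simp add: complex_eq_iff csqrt_of_real_nonneg)
        then have "1 / csqrt (W b) = of_real (1 / sqrt (Re (W b)))" by simp
        then show ?thesis by (simp only: Im_complex_of_real)
      qed
      moreover have "b \<in> R" using b fin by auto
      ultimately obtain p where p: "veval S p b = 1 / csqrt (W b)"
        "\<And>a. a \<in> R \<Longrightarrow> a \<noteq> b \<Longrightarrow> a \<noteq> cnj b \<Longrightarrow> veval S p a = 0"
        using real_interpolation[OF R, of b "1 / csqrt (W b)"] by blast
      have "a = b" if "a \<in> R'" "a = cnj b" for a
        using that b fin by (auto simp: R'_def J_def complex_eq_iff split: if_splits)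
      then show ?thesis using p fin by (intro exI[of _ p]) blast
    qed
    then obtain p where p: "\<And>b. b \<in> J \<Longrightarrow> veval S (p b) b = 1 / csqrt (W b)"
      "\<And>a b. b \<in> J \<Longrightarrow> a \<in> R' \<Longrightarrow> a \<noteq> b \<Longrightarrow> veval S (p b) a = 0" by metis
    from homogeneous_system[OF fin(1,2) lt, of "\<lambda>e b. \<Sum>i<S. u e i * p b i"] obtain y where
      y: "\<exists>b\<in>J. y b \<noteq> 0" "\<And>e. e \<in> P \<Longrightarrow> (\<Sum>b\<in>J. (\<Sum>i<S. u e i * p b i) * y b) = 0" by blast
    define v where "v i = (\<Sum>b\<in>J. y b * p b i)" for i
    have uv: "(\<Sum>i<S. u e i * v i) = 0" if "e \<in> P" for e
    proof -
      have "(\<Sum>i<S. u e i * v i) = (\<Sum>b\<in>J. (\<Sum>i<S. u e i * p b i) * y b)"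
        unfolding v_def sum_distrib_left sum_distrib_right by (subst sum.swap) (simp add: mult_ac)
      then show ?thesis using y(2)[OF that] by simp
    qed
    have "?Q v \<le> 0" unfolding Q1
    proof (rule sum_nonpos)
      fix e assume "e \<in> {..<r}"
      then show "\<mu> e * (\<Sum>a<S. u e a * v a)\<^sup>2 \<le> 0"
        using uv[of e] by (cases "e \<in> P") (auto simp: P_def not_less mult_nonpos_nonneg)
    qed
    moreover have "?Q v > 0"
    proof -
      have va: "veval S v a = (if a \<in> J then of_real (y a) / csqrt (W a) else 0)" if a: "a \<in> R'" for a
      proof -
        have "veval S v a = (\<Sum>b\<in>J. of_real (y b) * veval S (p b) a)"
          unfolding v_def by (simp add: sum_distrib_left sum_distrib_right mult_ac) (rule sum.swap)
        also have "\<dots> = (\<Sum>b\<in>J. if b = a then of_real (y a) / csqrt (W a) else 0)"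
          using p a by (intro sum.cong refl) auto
        finally show ?thesis using fin by simp
      qed
      have tm: "Re (W a * (veval S v a)\<^sup>2) = (if a \<in> J then (y a)\<^sup>2 else 0)" if a: "a \<in> R'" for a
      proof (cases "a \<in> J")
        case True
        then have "?l v a = of_real (y a)" unfolding va[OF a] using WJ[OF True] by simp
        then show ?thesis unfolding sq using True by simp
      next
        case False
        then show ?thesis unfolding va[OF a] by simp
      qed
      obtain b0 where b0: "b0 \<in> J" "y b0 \<noteq> 0" using y(1) by blast
      show ?thesis unfolding Q2
      proof (rule sum_pos2[of _ b0])
        show "0 < \<kappa> b0 * Re (W b0 * (veval S v b0)\<^sup>2)"
          using tm[of b0] \<kappa>[of b0] b0 fin by auto
        show "0 \<le> \<kappa> a * Re (W a * (veval S v a)\<^sup>2)" if "a \<in> R'" for a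
          using tm[OF that] \<kappa>[OF that] by auto
      qed (use b0 fin in auto)
    qed
    ultimately show False by simp
  qed
  ultimately show ?thesis unfolding P_def J_def by simp
qed

section \<open>Nonnegative univariate polynomials\<close>

text \<open>The numerator of the derivative of \<open>f / (1 + t\<^sup>2) ^ S\<close> after a common
  power of \<open>1 + t\<^sup>2\<close> is cancelled.\<close>

definition gpoly :: "'a::field_char_0 poly \<Rightarrow> nat \<Rightarrow> 'a poly" where
  "gpoly f S = pderiv f * [:1, 0, 1:] - Polynomial.smult (of_nat (2 * S)) (pCons 0 f)"

text \<open>A crude bound suffices: applied with the exponent \<open>S - 1\<close>, it leaves the
  factor \<open>1 / (1 + t\<^sup>2)\<close> for the decay at infinity.\<close>

lemma poly_bound:
  fixes f :: "real poly"
  assumes "\<And>i. i \<ge> Suc S \<Longrightarrow> coeff f i = 0"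
  obtains C where "C > 0" "\<And>t. \<bar>poly f t\<bar> \<le> C * (1 + t\<^sup>2) ^ S"
proof (rule that[of "1 + (\<Sum>i<Suc S. \<bar>coeff f i\<bar>)"])
  show "1 + (\<Sum>i<Suc S. \<bar>coeff f i\<bar>) > 0" by (intro add_pos_nonneg sum_nonneg) auto
  fix t :: real
  have t1: "\<bar>t\<bar> \<le> 1 + t\<^sup>2"
  proof -
    have "0 \<le> (\<bar>t\<bar> - 1)\<^sup>2" by simp
    then have "2 * \<bar>t\<bar> \<le> 1 + t\<^sup>2" by (simp add: power2_diff)
    then show ?thesis by linarith
  qed
  have b: "\<bar>t\<bar> ^ i \<le> (1 + t\<^sup>2) ^ S" if "i < Suc S" for i
  proof -
    have "\<bar>t\<bar> ^ i \<le> (1 + t\<^sup>2) ^ i" using t1 by (intro power_mono) auto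
    also have "\<dots> \<le> (1 + t\<^sup>2) ^ S" using that by (intro power_increasing) auto
    finally show ?thesis .
  qed
  have "poly f t = (\<Sum>i<Suc S. coeff f i * t ^ i)" using assms by (rule poly_as_sum)
  then have "\<bar>poly f t\<bar> \<le> (\<Sum>i<Suc S. \<bar>coeff f i * t ^ i\<bar>)" by (simp only: sum_abs)
  also have "\<dots> \<le> (\<Sum>i<Suc S. \<bar>coeff f i\<bar> * (1 + t\<^sup>2) ^ S)"
    by (intro sum_mono) (auto simp: abs_mult power_abs intro!: mult_left_mono b)
  also have "\<dots> = (\<Sum>i<Suc S. \<bar>coeff f i\<bar>) * (1 + t\<^sup>2) ^ S" by (simp only: sum_distrib_right)
  also have "\<dots> \<le> (1 + (\<Sum>i<Suc S. \<bar>coeff f i\<bar>)) * (1 + t\<^sup>2) ^ S"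
    by (intro mult_right_mono) auto
  finally show "\<bar>poly f t\<bar> \<le> (1 + (\<Sum>i<Suc S. \<bar>coeff f i\<bar>)) * (1 + t\<^sup>2) ^ S" .
qed

text \<open>The roots of \<open>gpoly f S\<close> are the critical points of \<open>f / (1 + t\<^sup>2) ^ S\<close>, a function which
  vanishes at infinity and hence attains its infimum if it is negative somewhere.\<close>

lemma nonneg_iff_critical:
  fixes f :: "real poly"
  assumes f: "\<And>i. i \<ge> S \<Longrightarrow> coeff f i = 0" and S: "S > 0"
  shows "(\<forall>t. poly f t \<ge> 0) \<longleftrightarrow> (\<forall>t. poly (gpoly f S) t = 0 \<longrightarrow> poly f t \<ge> 0)"
proof (rule iffI; (intro allI)?)
  assume crit: "\<forall>t. poly (gpoly f S) t = 0 \<longrightarrow> poly f t \<ge> 0"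
  fix t0
  obtain s where s: "S = Suc s" using S by (cases S) auto
  obtain C where C: "C > 0" "\<And>t. \<bar>poly f t\<bar> \<le> C * (1 + t\<^sup>2) ^ s"
    using poly_bound[of s f] f s by blast
  define \<phi> where "\<phi> t = poly f t / (1 + t\<^sup>2) ^ S" for t
  have pos: "(1 + t\<^sup>2) ^ k > 0" for t :: real and k by (intro zero_less_power) (simp add: add_pos_nonneg)
  have b\<phi>: "\<bar>\<phi> t\<bar> \<le> C / (1 + t\<^sup>2)" for t
  proof -
    have "\<bar>\<phi> t\<bar> = \<bar>poly f t\<bar> / (1 + t\<^sup>2) ^ S" using pos[of t S] by (simp add: \<phi>_def)
    also have "\<dots> \<le> (C * (1 + t\<^sup>2) ^ s) / (1 + t\<^sup>2) ^ S"
      using pos[of t S] by (intro divide_right_mono C) auto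
    also have "\<dots> = C / (1 + t\<^sup>2)" using pos[of t s] by (simp add: s)
    finally show ?thesis .
  qed
  show "poly f t0 \<ge> 0"
  proof (rule ccontr)
    assume "\<not> ?thesis"
    then have neg: "\<phi> t0 < 0" using pos[of t0 S] by (simp add: \<phi>_def divide_neg_pos)
    \<comment> \<open>Outside the interval \<open>t\<^sup>2\<close> exceeds \<open>T\<close>,
      because \<open>T\<close> is at least 1, and \<open>T\<close> exceeds
      \<open>C / - \<phi> t0\<close>. So the minimum over the interval is global.\<close>
    define T where "T = max \<bar>t0\<bar> (C / - \<phi> t0) + 1"
    have T: "T \<ge> 1" "\<bar>t0\<bar> \<le> T" by (auto simp: T_def)
    have far: "\<phi> t > \<phi> t0" if "\<bar>t\<bar> > T" for t
    proof -
      have "C / - \<phi> t0 < T" by (simp add: T_def)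
      also have "T \<le> 1 + t\<^sup>2"
      proof -
        have "T * 1 \<le> \<bar>t\<bar> * \<bar>t\<bar>" using that T by (intro mult_mono) auto
        then show ?thesis by (simp add: power2_eq_square)
      qed
      finally have "C / (1 + t\<^sup>2) < - \<phi> t0"
        using neg pos[of t 1] by (simp add: field_simps)
      then show ?thesis using b\<phi>[of t] by linarith
    qed
    have nz: "(1 + x\<^sup>2) ^ S \<noteq> 0" for x :: real using pos[of x S] by linarith
    have "continuous_on {- T..T} \<phi>"
      unfolding \<phi>_def using nz by (intro continuous_intros) auto
    then obtain x where x: "x \<in> {- T..T}" "\<forall>y\<in>{- T..T}. \<phi> x \<le> \<phi> y"
      using continuous_attains_inf[of "{- T..T}" \<phi>] T by auto
    have "\<phi> x \<le> \<phi> t0" using x(2)[rule_format, of t0] T by (auto simp: abs_le_iff)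
    then have glob: "\<phi> x \<le> \<phi> y" for y
      using x far[of y] by (cases "\<bar>y\<bar> \<le> T") (auto simp: abs_le_iff)
    have "(\<phi> has_real_derivative
       (poly (pderiv f) x * (1 + x\<^sup>2) ^ S - poly f x * (of_nat S * (2 * x) * (1 + x\<^sup>2) ^ s)) / ((1 + x\<^sup>2) ^ S * (1 + x\<^sup>2) ^ S)) (at x)"
      unfolding \<phi>_def by (rule derivative_eq_intros refl nz | simp add: s)+
    then have "(poly (pderiv f) x * (1 + x\<^sup>2) ^ S - poly f x * (of_nat S * (2 * x) * (1 + x\<^sup>2) ^ s)) / ((1 + x\<^sup>2) ^ S * (1 + x\<^sup>2) ^ S) = 0"
      (is "?a / _ = 0")
      by (rule DERIV_local_min[of _ _ _ 1]) (auto simp: glob)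
    then have "(poly (pderiv f) x * (1 + x\<^sup>2) - poly f x * (of_nat S * (2 * x))) * (1 + x\<^sup>2) ^ s = 0"
    proof -
      assume "?a / ((1 + x\<^sup>2) ^ S * (1 + x\<^sup>2) ^ S) = 0"
      then have "?a = 0" using nz[of x] by (simp only: divide_eq_0_iff mult_eq_0_iff simp_thms)
      then show ?thesis by (simp add: s algebra_simps)
    qed
    then have "poly (pderiv f) x * (1 + x\<^sup>2) - poly f x * (of_nat S * (2 * x)) = 0"
      using pos[of x s] by (simp only: mult_eq_0_iff) linarith
    moreover have "poly (gpoly f S) x = poly (pderiv f) x * (1 + x\<^sup>2) - poly f x * (of_nat S * (2 * x))"
      by (simp add: gpoly_def power2_eq_square algebra_simps)
    ultimately have "poly f x \<ge> 0" using crit by simp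
    then have "\<phi> x \<ge> 0" using pos[of x S] by (simp add: \<phi>_def)
    then show False using \<open>\<phi> x \<le> \<phi> t0\<close> neg by simp
  qed
qed auto

lemma coeff_gpoly:
  "coeff (gpoly f S) j = of_nat (j + 1) * coeff f (j + 1) +
     (if j = 0 then 0 else (of_nat j - of_nat (1 + 2 * S)) * coeff f (j - 1))"
proof -
  have "pderiv f * [:1, 0, 1:] = pderiv f + pCons 0 (pCons 0 (pderiv f))"
    by (simp add: mult.commute[of "pderiv f"])
  then show ?thesis
    by (cases j; cases "j - 1") (auto simp: gpoly_def coeff_pderiv coeff_pCons algebra_simps split: nat.splits)
qed

lemma degree_gpoly: "degree f < S \<Longrightarrow> degree (gpoly f S) \<le> S"
  by (rule degree_le) (auto simp: coeff_gpoly coeff_eq_0)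

text \<open>The coefficient of index \<open>degree f + 1\<close> is \<open>degree f - 2 * S\<close>
  times the leading coefficient of \<open>f\<close>, and \<open>degree f < S\<close>.\<close>

lemma gpoly_nonzero: assumes "f \<noteq> 0" "degree f < S" shows "gpoly f S \<noteq> 0"
proof
  assume "gpoly f S = 0"
  then have "coeff (gpoly f S) (Suc (degree f)) = 0" by simp
  then have "(of_nat (Suc (degree f)) - of_nat (1 + 2 * S)) * lead_coeff f = 0"
    by (simp add: coeff_gpoly coeff_eq_0)
  then have "(of_nat (Suc (degree f)) :: 'a) = of_nat (1 + 2 * S)" using assms(1) by simp
  then have "Suc (degree f) = 1 + 2 * S" by (simp only: of_nat_eq_iff)
  then show False using assms(2) by simp
qed

text \<open>The value 1 for \<open>g = 0\<close> keeps the division legal when the tested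
  coefficient \<open>f\<close>, and with it \<open>g\<close>, vanishes.\<close>

definition lcg :: "rat poly \<Rightarrow> rat" where
  "lcg g = (if lead_coeff g = 0 then 1 else lead_coeff g)"

definition gh :: "rat poly \<Rightarrow> nat \<Rightarrow> rat" where
  "gh g k = (if k \<le> degree g then coeff g (degree g - k) / lcg g else 0)"

text \<open>Newton's identities solved for the power sums. In this direction the step number is no
  divisor; only the leading coefficient inside \<open>gh\<close> is.\<close>

fun psum :: "rat poly \<Rightarrow> nat \<Rightarrow> rat" where
  "psum g 0 = of_nat (degree g)"
| "psum g (Suc q) = - (of_nat (Suc q) * gh g (Suc q) + (\<Sum>k<q. gh g (q - k) * psum g (Suc k)))"

lemma es_roots:
  fixes \<alpha> :: "nat \<Rightarrow> complex"
  assumes "k \<le> n"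
  shows "coeff (\<Prod>i<n. [:- \<alpha> i, 1:]) (n - k) = es \<alpha> n k"
  using assms
proof (induction n arbitrary: k)
  case (Suc n)
  let ?p = "\<Prod>i<n. [:- \<alpha> i, 1:]"
  have *: "(\<Prod>i<Suc n. [:- \<alpha> i, 1:]) = pCons 0 ?p + Polynomial.smult (- \<alpha> n) ?p"
    by (simp add: mult.commute[of _ "[:- \<alpha> n, 1:]"])
  have d: "coeff ?p j = 0" if "j > n" for j
  proof -
    have "degree ?p \<le> n" using degree_prod_sum_le[of "{..<n}" "\<lambda>i. [:- \<alpha> i, 1:]"] by simp
    then show ?thesis using that by (simp add: coeff_eq_0)
  qed
  show ?case
  proof (cases k)
    case 0
    then show ?thesis unfolding * using Suc.IH[of 0] d[of "Suc n"] by simp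
  next
    case (Suc k')
    show ?thesis
    proof (cases "k = Suc n")
      case True
      then show ?thesis unfolding * using Suc.IH[of n] Suc by simp
    next
      case False
      then have "Suc n - k = Suc (n - k)" "n - k' = Suc (n - k)" using Suc \<open>k \<le> Suc n\<close> by auto
      then show ?thesis unfolding * using Suc.IH[of k] Suc.IH[of k'] Suc False \<open>k \<le> Suc n\<close> by simp
    qed
  qed
qed simp

lemma psum_roots:
  fixes \<alpha> :: "nat \<Rightarrow> complex"
  assumes g: "g \<noteq> 0" and fac: "map_poly of_rat g = Polynomial.smult (of_rat (lead_coeff g)) (\<Prod>i<degree g. [:- \<alpha> i, 1:])"
  shows "of_rat (psum g k) = (\<Sum>i<degree g. \<alpha> i ^ k)"
proof -
  let ?n = "degree g"
  have gh: "of_rat (gh g k) = es \<alpha> ?n k" for k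
  proof (cases "k \<le> ?n")
    case True
    have "of_rat (coeff g (?n - k)) = coeff (map_poly of_rat g :: complex poly) (?n - k)"
      by (simp add: coeff_map_poly)
    also have "\<dots> = of_rat (lead_coeff g) * es \<alpha> ?n k"
      unfolding fac using es_roots[OF True] by simp
    finally show ?thesis using True g by (simp add: gh_def lcg_def of_rat_divide)
  qed (simp add: gh_def)
  show ?thesis
  proof (induction k rule: less_induct)
    case (less k)
    show ?case
    proof (cases k)
      case (Suc q)
      let ?p = "\<lambda>k. \<Sum>i<?n. \<alpha> i ^ k"
      have IH: "of_rat (psum g (Suc k)) = ?p (Suc k)" if "k < q" for k
        using less[of "Suc k"] Suc that by blast
      have "of_rat (psum g (Suc q)) = - (of_nat (Suc q) * es \<alpha> ?n (Suc q) + (\<Sum>k<q. es \<alpha> ?n (q - k) * of_rat (psum g (Suc k))))"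
        by (simp only: psum.simps(2)[of g q] of_rat_minus of_rat_add of_rat_mult of_rat_sum gh of_rat_of_nat_eq)
      also have "(\<Sum>k<q. es \<alpha> ?n (q - k) * of_rat (psum g (Suc k))) = (\<Sum>k<q. es \<alpha> ?n (q - k) * ?p (Suc k))"
        by (intro sum.cong refl) (simp only: IH lessThan_iff)
      also have "(\<Sum>k<q. es \<alpha> ?n (q - k) * ?p (Suc k)) = (\<Sum>j<q. es \<alpha> ?n (Suc j) * ?p (Suc q - Suc j))"
        by (rule sum.reindex_bij_witness[of _ "\<lambda>j. q - Suc j" "\<lambda>k. q - Suc k"]) (auto simp: Suc_diff_Suc)
      also have "of_nat (Suc q) * es \<alpha> ?n (Suc q) =
          - (?p (Suc q) + (\<Sum>j<q. es \<alpha> ?n (Suc j) * ?p (Suc q - Suc j)))"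
        unfolding newton_identity by (subst sum.lessThan_Suc_shift) (simp only: es_0 mult_1_left diff_zero)
      finally show ?thesis unfolding Suc by (simp only: minus_add_distrib minus_minus add_diff_cancel_right' group_cancel.rule0 minus_add_cancel add.assoc add.right_inverse add.left_inverse add_0_right)
    qed simp
  qed
qed

text \<open>The sum of \<open>f(\<alpha>) * \<alpha> ^ j\<close> over the roots of
  \<open>gpoly f S\<close> with multiplicities; expanding \<open>f(\<alpha>)\<close> reduces it to
  power sums. Likewise \<open>mom2\<close> with \<open>f\<^sup>2\<close>.\<close>

definition mom1 :: "rat poly \<Rightarrow> nat \<Rightarrow> nat \<Rightarrow> rat" where
  "mom1 f S j = (\<Sum>l<S. coeff f l * psum (gpoly f S) (j + l))"

definition mom2 :: "rat poly \<Rightarrow> nat \<Rightarrow> nat \<Rightarrow> rat" where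
  "mom2 f S j = (\<Sum>l<S. coeff f l * mom1 f S (j + l))"

text \<open>Constant polynomials as entries, so that the same recursion serves polynomial matrices
  and Hankel matrices.\<close>

definition hankel :: "(nat \<Rightarrow> rat) \<Rightarrow> nat \<Rightarrow> nat \<Rightarrow> rat poly" where
  "hankel h i j = [:h (i + j):]"

definition npos :: "(nat \<Rightarrow> rat) \<Rightarrow> nat \<Rightarrow> nat" where
  "npos h S = changes (\<lambda>k. coeff (flC (hankel h) S k) 0) S"

lemma card_eq_iff: "finite B \<Longrightarrow> A \<subseteq> B \<Longrightarrow> card A = card B \<longleftrightarrow> A = B"
  using card_subset_eq by blast

lemma of_real_of_rat: "complex_of_real (of_rat x) = of_rat x"
  by (cases x) (simp add: of_rat_rat)

lemma npos_eq:
  fixes m :: "complex \<Rightarrow> real" and W :: "complex \<Rightarrow> complex"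
  assumes "finite R" "card R \<le> S" "\<And>a. a \<in> R \<Longrightarrow> cnj a \<in> R"
    and "\<And>a. a \<in> R \<Longrightarrow> m a > 0" "\<And>a. m (cnj a) = m a" "\<And>a. W (cnj a) = cnj (W a)"
    and h: "\<And>j. of_rat (h j) = (\<Sum>a\<in>R. of_real (m a) * W a * a ^ j)"
  shows "npos h S = card {a \<in> R. if Im a = 0 then Re (W a) > 0 else Im a > 0 \<and> W a \<noteq> 0}"
proof -
  define H where "H i j = (of_rat (h (i + j)) :: real)" for i j
  have "H i j = H j i" for i j by (simp add: H_def add.commute)
  then obtain r u \<mu> where on: "orthonormal S r u"
    and A: "\<And>a b. a < S \<Longrightarrow> b < S \<Longrightarrow> H a b = (\<Sum>e<r. \<mu> e * (u e a * u e b))"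
    using spectral[of S H] by blast
  have "reval (hankel h i j) (0::real) = H i j" for i j by (simp add: hankel_def H_def)
  then have "changes (\<lambda>k. reval (flC (hankel h) S k) (0::real)) S = card {e. e < r \<and> \<mu> e > 0}"
    using changes_fl[OF on, of "hankel h" 0 \<mu>] A by simp
  moreover have "reval p 0 = (of_rat (coeff p 0) :: real)" for p
    by (simp add: reval_def poly_0_coeff_0 coeff_map_poly)
  ultimately have "npos h S = card {e. e < r \<and> \<mu> e > 0}"
    unfolding npos_def by (simp add: changes_of_rat)
  moreover
  have "complex_of_real (H i j) = (\<Sum>a\<in>R. of_real (m a) * W a * a ^ (i + j))" for i j
    unfolding h[symmetric] H_def by (rule of_real_of_rat)
  then have "card {e. e < r \<and> 0 < \<mu> e} = card {a \<in> R. if Im a = 0 then Re (W a) > 0 else Im a > 0 \<and> W a \<noteq> 0}"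
    by (intro hermite_inertia[of R S m W H r u \<mu>, OF assms(1-6) _ on A]) blast+
  ultimately show ?thesis by (simp only:)
qed

text \<open>Conjugation permutes the linear factors of a real polynomial, hence preserves root
  orders. The inertia theorem needs this as symmetry of the weights \<open>m\<close>.\<close>

lemma count_list_cnj:
  fixes p :: "complex poly"
  assumes p: "p = Polynomial.smult c (\<Prod>a\<leftarrow>as. [:- a, 1:])" "c \<noteq> 0" and real: "map_poly cnj p = p"
  shows "count_list as (cnj a) = count_list as a"
proof -
  have ord: "Polynomial.order x (\<Prod>a\<leftarrow>as. [:- a, 1:]) = count_list as x" for x :: complex and as
  proof (induction as)
    case (Cons b as)
    have nz: "(\<Prod>a\<leftarrow>as. [:- a, 1:]) \<noteq> (0::complex poly)" by (auto simp: prod_list_zero_iff)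
    have "Polynomial.order x [:- b, 1:] = (if b = x then 1 else 0)"
      using order_linear[of x] by (auto intro: order_0I)
    then show ?case using Cons nz by (simp add: order_mult del: mult_pCons_left)
  qed (simp add: order_0I)
  have "map_poly cnj (\<Prod>a\<leftarrow>as. [:- a, 1:]) = (\<Prod>a\<leftarrow>map cnj as. [:- a, 1:])" for as
  proof (induction as)
    case (Cons b as)
    have m: "map_poly cnj (p * q) = map_poly cnj p * map_poly cnj q" for p q
      by (rule poly_eqI) (simp add: coeff_map_poly coeff_mult)
    show ?case using Cons by (simp add: m map_poly_pCons del: mult_pCons_left)
  qed simp
  then have "map_poly cnj p = Polynomial.smult (cnj c) (\<Prod>a\<leftarrow>map cnj as. [:- a, 1:])"
    unfolding p(1) by (simp add: poly_eq_iff coeff_map_poly)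
  then have "Polynomial.order (cnj a) p = count_list (map cnj as) (cnj a)"
    using p(2) real by (simp add: order_smult ord del: map_map)
  also have "\<dots> = count_list as a" by (induction as) auto
  finally show ?thesis using p by (simp add: order_smult ord)
qed

text \<open>Both numbers are cardinalities of sets of roots. The set for \<open>f\<close> is
  contained in that for \<open>f\<^sup>2\<close>, and they differ by the real roots at which
  \<open>f\<close> is negative; so equal numbers mean equal sets. For \<open>f = 0\<close> both
  forms vanish.\<close>

theorem npos_mom_iff:
  assumes deg: "degree f < S"
  shows "npos (mom1 f S) S = npos (mom2 f S) S \<longleftrightarrow> (\<forall>t::real. reval f t \<ge> 0)"
proof (cases "f = 0")
  case True
  then have "mom1 f S = (\<lambda>_. 0)" "mom2 f S = (\<lambda>_. 0)" by (auto simp: mom1_def mom2_def)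
  then show ?thesis using True by simp
next
  case False
  let ?g = "gpoly f S"
  have g: "?g \<noteq> 0" using gpoly_nonzero[OF False deg] .
  let ?G = "map_poly of_rat ?g :: complex poly"
  have dG: "degree ?G = degree ?g" by (simp add: degree_map_poly)
  obtain as where as: "Polynomial.smult (lead_coeff ?G) (\<Prod>a\<leftarrow>as. [:- a, 1:]) = ?G" "length as = degree ?G"
    using fundamental_theorem_algebra_factorized[of ?G] by blast
  have lc: "lead_coeff ?G = of_rat (lead_coeff ?g)" by (simp add: dG coeff_map_poly)
  have lc0: "lead_coeff ?G \<noteq> 0" using g unfolding lc by simp
  let ?\<alpha> = "\<lambda>i. as ! i"
  have len: "length as = degree ?g" using as dG by simp
  have "(\<Prod>a\<leftarrow>as. [:- a, 1:]) = (\<Prod>i<degree ?g. [:- ?\<alpha> i, 1:])"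
    unfolding len[symmetric] by (simp add: prod.list_conv_set_nth lessThan_atLeast0)
  then have fac: "?G = Polynomial.smult (of_rat (lead_coeff ?g)) (\<Prod>i<degree ?g. [:- ?\<alpha> i, 1:])"
    using as(1) lc by simp
  define R where "R = ?\<alpha> ` {..<degree ?g}"
  define m where "m a = real (card {i \<in> {..<degree ?g}. ?\<alpha> i = a})" for a
  define F where "F a = (reval f a :: complex)" for a
  have setR: "R = set as" unfolding R_def len[symmetric] by (auto simp: set_conv_nth)
  have m: "m a = count_list as a" for a
    unfolding m_def count_list_eq_length_filter length_filter_conv_card len[symmetric]
    by (intro arg_cong[of _ _ "\<lambda>A. real (card A)"]) auto
  have sums: "(\<Sum>i<degree ?g. \<psi> (?\<alpha> i)) = (\<Sum>a\<in>R. of_real (m a) * \<psi> a)" for \<psi> :: "complex \<Rightarrow> complex"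
    unfolding R_def by (subst sum.image_gen[of "{..<degree ?g}" _ ?\<alpha>]) (auto simp: m_def intro!: sum.cong)
  have rootR: "a \<in> R \<longleftrightarrow> reval ?g a = 0" for a
  proof -
    have "reval ?g a = 0 \<longleftrightarrow> poly (\<Prod>a\<leftarrow>as. [:- a, 1:]) a = 0"
      unfolding reval_def by (subst as(1)[symmetric]) (use lc0 in simp)
    also have "\<dots> \<longleftrightarrow> a \<in> set as" by (induction as) auto
    finally show ?thesis using setR by simp
  qed
  have realcnj: "map_poly cnj (map_poly of_rat p) = (map_poly of_rat p :: complex poly)" for p
  proof -
    have "cnj (of_rat x) = of_rat x" for x
      by (cases x) (simp add: of_rat_rat)
    then show ?thesis by (simp add: poly_eq_iff coeff_map_poly)
  qed
  have cnjF: "F (cnj a) = cnj (F a)" for a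
    using poly_cnj[of "map_poly of_rat f" a] unfolding realcnj by (simp add: F_def reval_def)
  have mc: "m (cnj a) = m a" for a
    unfolding m using count_list_cnj[OF as(1)[symmetric] lc0 realcnj] by simp
  have mpos: "m a > 0" if "a \<in> R" for a using that unfolding m setR
    using count_list_0_iff[of as a] by simp
  have Rc: "cnj a \<in> R" if "a \<in> R" for a
    using mpos[OF that] mc[of a] count_list_0_iff[of as "cnj a"] unfolding m setR by fastforce
  have finR: "finite R" "card R \<le> S"
    using degree_gpoly[OF deg] card_length[of as] len unfolding setR by auto
  have Fsum: "F a = (\<Sum>l<S. of_rat (coeff f l) * a ^ l)" for a
    unfolding F_def reval_def using deg
    by (subst poly_as_sum[of S]) (auto simp: coeff_map_poly coeff_eq_0)
  \<comment> \<open>Multiplying the weight by \<open>f\<close> amounts to combining shifted moments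
    with the coefficients of \<open>f\<close>. It is used once for \<open>mom1\<close> and once more
    for \<open>mom2\<close>.\<close>
  have shift: "of_rat (\<Sum>l<S. coeff f l * h (j + l)) = (\<Sum>i<degree ?g. F (?\<alpha> i) * \<Psi> (?\<alpha> i) * ?\<alpha> i ^ j)"
    if "\<And>j. of_rat (h j) = (\<Sum>i<degree ?g. \<Psi> (?\<alpha> i) * ?\<alpha> i ^ j)" for h \<Psi> j
  proof -
    have "of_rat (\<Sum>l<S. coeff f l * h (j + l)) =
       (\<Sum>l<S. \<Sum>i<degree ?g. of_rat (coeff f l) * ?\<alpha> i ^ l * (\<Psi> (?\<alpha> i) * ?\<alpha> i ^ j))"
      by (simp add: of_rat_sum of_rat_mult that sum_distrib_left power_add mult_ac)
    also have "\<dots> = (\<Sum>i<degree ?g. \<Sum>l<S. of_rat (coeff f l) * ?\<alpha> i ^ l * (\<Psi> (?\<alpha> i) * ?\<alpha> i ^ j))"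
      by (rule sum.swap)
    finally show ?thesis unfolding Fsum by (simp only: sum_distrib_right mult.assoc)
  qed
  have h0: "of_rat (psum ?g j) = (\<Sum>i<degree ?g. (\<lambda>_. 1) (?\<alpha> i) * ?\<alpha> i ^ j)" for j
    using psum_roots[OF g fac] by simp
  have h1: "of_rat (mom1 f S j) = (\<Sum>i<degree ?g. F (?\<alpha> i) * ?\<alpha> i ^ j)" for j
    using shift[of "psum ?g" "\<lambda>_. 1" j, OF h0] unfolding mom1_def by simp
  have h2: "of_rat (mom2 f S j) = (\<Sum>i<degree ?g. (F (?\<alpha> i) * F (?\<alpha> i)) * ?\<alpha> i ^ j)" for j
    using shift[of "mom1 f S" F j, OF h1] unfolding mom2_def by simp
  let ?J = "\<lambda>W. {a \<in> R. if Im a = 0 then Re (W a) > 0 else Im a > 0 \<and> W a \<noteq> 0}"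
  have n1: "npos (mom1 f S) S = card (?J F)"
    by (rule npos_eq[of R S m F]) (use finR Rc mpos mc cnjF h1 sums in \<open>auto simp: mult.assoc\<close>)
  have n2: "npos (mom2 f S) S = card (?J (\<lambda>a. F a * F a))"
    by (rule npos_eq[of R S m "\<lambda>a. F a * F a"]) (use finR Rc mpos mc cnjF h2 sums in \<open>auto simp: mult.assoc\<close>)
  have Freal: "Im (F a) = 0" if "Im a = 0" for a
  proof -
    have "cnj a = a" using that by (simp add: complex_eq_iff)
    then show ?thesis using cnjF[of a] by (metis cnj.simps(2) equal_neg_zero)
  qed
  have J2: "?J (\<lambda>a. F a * F a) = {a \<in> R. if Im a = 0 then Re (F a) \<noteq> 0 else Im a > 0 \<and> F a \<noteq> 0}"
    using Freal by (auto simp: zero_less_mult_iff linorder_neq_iff)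
  have sub: "?J F \<subseteq> ?J (\<lambda>a. F a * F a)" unfolding J2 by (auto split: if_splits)
  have "card (?J F) = card (?J (\<lambda>a. F a * F a)) \<longleftrightarrow> ?J F = ?J (\<lambda>a. F a * F a)"
    by (rule card_eq_iff[OF _ sub]) (rule finite_subset[OF _ finR(1)], blast)
  also have "\<dots> \<longleftrightarrow> (\<forall>a\<in>R. Im a = 0 \<longrightarrow> Re (F a) \<ge> 0)"
  proof
    assume eq: "?J F = ?J (\<lambda>a. F a * F a)"
    show "\<forall>a\<in>R. Im a = 0 \<longrightarrow> Re (F a) \<ge> 0"
    proof (intro ballI impI)
      fix a assume a: "a \<in> R" "Im a = 0"
      show "Re (F a) \<ge> 0"
      proof (cases "Re (F a) = 0")
        case False
        then have "a \<in> ?J (\<lambda>a. F a * F a)" unfolding J2 using a by simp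
        then have "a \<in> ?J F" unfolding eq .
        then show ?thesis using a by simp
      qed simp
    qed
  next
    assume "\<forall>a\<in>R. Im a = 0 \<longrightarrow> Re (F a) \<ge> 0"
    then show "?J F = ?J (\<lambda>a. F a * F a)"
      unfolding J2 by (intro Collect_cong) (auto simp: less_le)
  qed
  also have "\<dots> \<longleftrightarrow> (\<forall>t::real. reval ?g t = 0 \<longrightarrow> reval f t \<ge> 0)"
  proof -
    have ev: "reval p (complex_of_real t) = of_real (reval p t)" for p t
    proof -
      have "map_poly of_rat p = (map_poly of_real (map_poly of_rat p) :: complex poly)"
        by (rule poly_eqI) (simp add: coeff_map_poly of_real_of_rat)
      then show ?thesis unfolding reval_def by simp
    qed
    show ?thesis
    proof (intro iffI allI impI ballI)
      fix t assume *: "\<forall>a\<in>R. Im a = 0 \<longrightarrow> Re (F a) \<ge> 0" "reval ?g t = (0::real)"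
      then have "complex_of_real t \<in> R" using rootR ev by simp
      with *(1) have "Re (F (of_real t)) \<ge> 0" by simp
      then show "reval f t \<ge> 0" unfolding F_def ev by simp
    next
      fix a assume *: "\<forall>t::real. reval ?g t = 0 \<longrightarrow> reval f t \<ge> 0" "a \<in> R" "Im a = 0"
      define t where "t = Re a"
      have at: "a = of_real t" using *(3) by (simp add: complex_eq_iff t_def)
      have "complex_of_real (reval ?g t) = 0" using *(2) rootR[of a] unfolding at ev by simp
      then have "reval f t \<ge> 0" using *(1) by simp
      then show "Re (F a) \<ge> 0" unfolding F_def at ev by simp
    qed
  qed
  also have "\<dots> \<longleftrightarrow> (\<forall>t::real. reval f t \<ge> 0)"
  proof -
    let ?f = "map_poly of_rat f :: real poly"
    have "map_poly of_rat ?g = gpoly ?f S"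
      by (rule poly_eqI) (simp add: coeff_map_poly coeff_gpoly of_rat_add of_rat_mult of_rat_diff)
    then have "reval ?g t = poly (gpoly ?f S) t" for t :: real by (simp add: reval_def)
    moreover have "coeff ?f i = 0" if "i \<ge> S" for i using that deg by (simp add: coeff_map_poly coeff_eq_0)
    ultimately show ?thesis using nonneg_iff_critical[of S ?f] deg by (simp add: reval_def)
  qed
  finally show ?thesis unfolding n1 n2 .
qed

section \<open>The program\<close>

abbreviation rk :: nat where "rk \<equiv> 8"
abbreviation ra :: nat where "ra \<equiv> 9"
abbreviation rq :: nat where "rq \<equiv> 10"
abbreviation rcnt :: nat where "rcnt \<equiv> 13"

abbreviation midx :: "nexp \<Rightarrow> nexp \<Rightarrow> nexp \<Rightarrow> nexp" where
  "midx x y l \<equiv> NAdd (NMul (NAdd (NMul x (NV rN)) y) (NV rT)) l"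

text \<open>The products are convolutions in which only coefficients up to index \<open>rl\<close>
  enter, so truncation at \<open>t ^ T\<close> is exact for those that are kept.\<close>

definition fl_mat :: "nat \<Rightarrow> nat \<Rightarrow> exp" where
  "fl_mat a c = Bin Add
     (Sum rk (NV rN) (Sum ra (NAdd (NV rl) (NC 1)) (Bin Mul
        (Get a (midx (NV ri) (NV rk) (NV ra))) (Get 2 (midx (NV rk) (NV rj) (NSub (NV rl) (NV ra)))))))
     (Sum ra (NAdd (NV rl) (NC 1)) (Bin Mul
        (Get a (midx (NV ri) (NV rj) (NV ra))) (Get c (NAdd (NMul (NV rq) (NV rT)) (NSub (NV rl) (NV ra))))))"

definition fl_coeff :: exp where
  "fl_coeff = Bin Div (Bin Sub (EC 0) (Sum ri (NV rN) (Get 2 (midx (NV ri) (NV ri) (NV rl)))))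
     (EN (NAdd (NV rq) (NC 1)))"

definition fl_step :: "nat \<Rightarrow> nat \<Rightarrow> hcom" where
  "fl_step a c = HSeq (fill3 3 (fl_mat a c)) (HSeq (fill3 2 (Get 3 (midx (NV ri) (NV rj) (NV rl))))
     (fill1 c (NV rT) (NMul (NAdd (NV rq) (NC 1)) (NV rT)) fl_coeff))"

definition fl_prog :: "nat \<Rightarrow> nat \<Rightarrow> hcom" where
  "fl_prog a c = HSeq (fill3 2 (EC 0))
    (HSeq (fill1 c (NV rT) (NC 0) (Cond Equal (EN (NV rl)) (EC 0) (EC 1) (EC 0)))
      (HFor rq (NV rN) (fl_step a c)))"

lemma wr_fl[simp]: "wr (fl_step a c) = {}" "wr (fl_prog a c) = {}"
  and wa_fl[simp]: "wa (fl_step a c) = {2, 3, c}" "wa (fl_prog a c) = {2, 3, c}"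
  by (auto simp: fl_step_def fl_prog_def)

definition count_step :: hcom where
  "count_step = HIf Less (Bin Mul (Get 13 (NAdd (NV rq) (NC 1))) (Get 14 (NC 0))) (EC 0)
     (HSeq (Asg rcnt (NAdd (NV rcnt) (NC 1))) (Put 14 (NC 0) (Get 13 (NAdd (NV rq) (NC 1))))) HSkip"

text \<open>The reference entry starts as 1, which is the coefficient of index 0.\<close>

definition count_prog :: hcom where
  "count_prog = HSeq (Asg rcnt (NC 0)) (HSeq (Put 14 (NC 0) (EC 1)) (HFor rq (NV rN) count_step))"

lemma wrwa_count[simp]: "wr count_step = {rcnt}" "wa count_step = {14}" "wr count_prog = {rcnt}" "wa count_prog = {14}"
  by (auto simp: count_step_def count_prog_def)

text \<open>The exponent reached after \<open>q\<close> steps of \<open>fl\<close> from entries of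
  exponent \<open>\<kappa>\<close>. The 6 pays for two nested sums and an addition in
  \<open>fl_mat\<close>, and for the trace, the subtraction from 0 and the division in
  \<open>fl_coeff\<close>.\<close>

definition stp :: "nat \<Rightarrow> nat \<Rightarrow> nat" where "stp \<kappa> q = 1 + q * (\<kappa> + 6)"

lemma stp_Suc: "stp \<kappa> (Suc q) = stp \<kappa> q + \<kappa> + 6" by (simp add: stp_def)

lemma stp_mono: "q \<le> q' \<Longrightarrow> stp \<kappa> q \<le> stp \<kappa> q'"
  unfolding stp_def by (intro add_mono mult_le_mono1) auto

text \<open>Divisibility of \<open>B\<close> by all numbers up to \<open>L\<close> puts the inverses
  of the step numbers into \<open>cls 1\<close>. The 7 is the \<open>ndg\<close> of the input
  address \<open>x_idx\<close>.\<close>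

locale sized_dvd = sized +
  assumes dvdB: "\<And>k. 1 \<le> k \<Longrightarrow> k \<le> L \<Longrightarrow> k dvd B" and E7: "7 \<le> E"
begin

lemma inverse_nat_cls: assumes "1 \<le> k" "k \<le> L" shows "inverse (of_nat k) \<in> cls 1"
proof -
  obtain r where r: "B = k * r" using dvdB[OF assms] by (auto elim: dvdE)
  have "of_nat (B ^ 1) * inverse (of_nat k) = (of_nat r :: rat)" using assms by (simp add: r field_simps)
  moreover have "inverse (of_nat k) \<le> (1 :: rat)" using assms by (simp add: field_simps)
  then have "\<bar>inverse (of_nat k)\<bar> \<le> (of_nat (B ^ 1) :: rat)" using B2 by simp
  ultimately show ?thesis by (simp add: cls_def)
qed

text \<open>Growth is linear in \<open>q\<close>, because one factor of every product is an entry of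
  \<open>A\<close> itself.\<close>

lemma fl_cls:
  assumes N: "N \<le> L" "T \<le> L"
    and A: "\<And>i j l. i < N \<Longrightarrow> j < N \<Longrightarrow> l < T \<Longrightarrow> coeff (A i j) l \<in> cls \<kappa>"
  shows "q \<le> N \<Longrightarrow> l < T \<Longrightarrow> coeff (flC A N q) l \<in> cls (stp \<kappa> q)"
    "q \<le> N \<Longrightarrow> i < N \<Longrightarrow> j < N \<Longrightarrow> l < T \<Longrightarrow> coeff (flM A N q i j) l \<in> cls (stp \<kappa> q)"
proof -
  have "q \<le> N \<Longrightarrow> (\<forall>l<T. coeff (flC A N q) l \<in> cls (stp \<kappa> q)) \<and>
      (\<forall>i<N. \<forall>j<N. \<forall>l<T. coeff (flM A N q i j) l \<in> cls (stp \<kappa> q))"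
  proof (induction q)
    case 0
    then show ?case using cls_0 cls_1 by (auto simp: one_pCons coeff_pCons split: nat.splits)
  next
    case (Suc q)
    let ?s = "stp \<kappa> q"
    have mult: "coeff (p * r) l \<in> cls (\<kappa> + ?s + 1)"
      if "\<And>l. l < T \<Longrightarrow> coeff p l \<in> cls \<kappa>" "\<And>l. l < T \<Longrightarrow> coeff r l \<in> cls ?s" "l < T" for p r l
      unfolding coeff_mult
      by (rule cls_sum) (use that N LB in \<open>auto intro!: cls_mult\<close>)
    note mult' = mult[unfolded Suc_eq_plus1[symmetric]]
    have M: "coeff (flM A N (Suc q) i j) l \<in> cls (\<kappa> + ?s + 3)" if "i < N" "j < N" "l < T" for i j l
    proof -
      have "coeff (\<Sum>k<N. A i k * flM A N q k j) l \<in> cls (\<kappa> + ?s + 1 + 1)"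
        unfolding coeff_sum by (rule cls_sum) (use that N LB Suc A in \<open>auto intro!: mult'\<close>)
      moreover have "coeff (A i j * flC A N q) l \<in> cls (\<kappa> + ?s + 1)"
        using that Suc A by (intro mult) auto
      ultimately have "coeff (flM A N (Suc q) i j) l \<in> cls (max (\<kappa> + ?s + 1 + 1) (\<kappa> + ?s + 1) + 1)"
        unfolding flM_Suc coeff_add by (rule cls_add)
      then show ?thesis by (simp add: numeral_3_eq_3)
    qed
    have "coeff (flC A N (Suc q)) l \<in> cls (stp \<kappa> (Suc q))" if l: "l < T" for l
    proof -
      have "(\<Sum>i<N. coeff (flM A N (Suc q) i i) l) \<in> cls (\<kappa> + ?s + 3 + 1)"
        by (rule cls_sum) (use M l N LB in auto)
      then have "inverse (of_nat (Suc q)) * (- (\<Sum>i<N. coeff (flM A N (Suc q) i i) l)) \<in> cls (1 + (\<kappa> + ?s + 3 + 1))"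
        by (intro cls_mult cls_minus inverse_nat_cls) (use Suc.prems N in auto)
      then have "inverse (of_nat (Suc q)) * (- (\<Sum>i<N. coeff (flM A N (Suc q) i i) l)) \<in> cls (stp \<kappa> (Suc q))"
        by (rule cls_mono) (simp add: stp_Suc)
      moreover have "coeff (flC A N (Suc q)) l = inverse (of_nat (Suc q)) * (- (\<Sum>i<N. coeff (flM A N (Suc q) i i) l))"
        unfolding flC_Suc by (simp only: coeff_smult coeff_sum divide_inverse mult_minus_left mult_minus_right mult_1_left)
      ultimately show ?thesis by simp
    qed
    moreover have "coeff (flM A N (Suc q) i j) l \<in> cls (stp \<kappa> (Suc q))" if "i < N" "j < N" "l < T" for i j l
      using M[OF that] by (rule cls_mono) (simp add: stp_Suc)
    ultimately show ?case by blast
  qed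
  then show "q \<le> N \<Longrightarrow> l < T \<Longrightarrow> coeff (flC A N q) l \<in> cls (stp \<kappa> q)"
    "q \<le> N \<Longrightarrow> i < N \<Longrightarrow> j < N \<Longrightarrow> l < T \<Longrightarrow> coeff (flM A N q i j) l \<in> cls (stp \<kappa> q)" by blast+
qed

lemma wp_fl:
  assumes ok: "okh h" and N: "hreg h rN = N" "N \<le> L" and T: "hreg h rT = T" "T \<le> L"
    and arr: "a \<notin> {2, 3, c}" "c \<notin> {2, 3}"
    and A: "\<And>i j l. i < N \<Longrightarrow> j < N \<Longrightarrow> l < T \<Longrightarrow> hmem h a ((i * N + j) * T + l) = coeff (A i j) l"
    and Acls: "\<And>i j l. i < N \<Longrightarrow> j < N \<Longrightarrow> l < T \<Longrightarrow> coeff (A i j) l \<in> cls \<kappa>"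
    and E: "stp \<kappa> N \<le> E"
  shows "wp (fl_prog a c) (\<lambda>h'. \<forall>q\<le>N. \<forall>l<T. hmem h' c (q * T + l) = coeff (flC A N q) l) h"
proof -
  have nm: "rN < named" "rT < named" "ri < named" "rj < named" "rl < named" "rk < named" "ra < named" "rq < named"
    by (auto simp: named_def)
  have L1: "Suc 0 \<le> L" using L2 by simp
  have E1': "Suc 0 \<le> E" using E1 by simp
  note flcls = fl_cls[OF N(2) T(2) Acls]
  \<comment> \<open>Only exact values are recorded; their sizes are read off from
    \<open>fl_cls\<close> instead of being carried through the loop.\<close>
  define I where "I q h' \<longleftrightarrow>
    (\<forall>i<N. \<forall>j<N. \<forall>l<T. hmem h' 2 ((i * N + j) * T + l) = coeff (flM A N q i j) l) \<and>
    (\<forall>q'\<le>q. \<forall>l<T. hmem h' c (q' * T + l) = coeff (flC A N q') l)" for q and h' :: hstate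
  have loop: "wp (HFor rq (NV rN) (fl_step a c)) (\<lambda>h'. \<forall>q\<le>N. \<forall>l<T. hmem h' c (q * T + l) = coeff (flC A N q) l) h0"
    if reg0: "hreg h0 = hreg h" and mem0: "hmem h0 a = hmem h a" and I0: "I 0 h0" for h0
  proof (rule wp_For[where I = I])
    fix q h1
    assume q: "q < nev (NV rN) h0" and I1: "I q h1" and un: "unch (fl_step a c) h0 h1"
    have q: "q < N" using q N reg0 by simp
    have reg1: "hreg h1 = hreg h" using un reg0 by (auto simp: unch_def)
    have mem1: "hmem h1 a = hmem h a" using un mem0 arr by (auto simp: unch_def)
    define s where "s = stp \<kappa> q"
    have sE: "s + \<kappa> + 6 \<le> E"
      using stp_mono[of "Suc q" N \<kappa>] q E by (simp add: s_def stp_Suc)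
    let ?h2 = "setr h1 rq q"
    have ok2: "okh ?h2" using ok reg1 q N by (auto simp: okh_def)
    have r2: "hreg ?h2 rN = N" "hreg ?h2 rT = T" using reg1 N T by auto
    \<comment> \<open>The input matrix keeps its own exponent. A common exponent for both factors
      would double with each step.\<close>
    define \<delta> where "\<delta> x = (if x = a then \<kappa> else s)" for x
    have rdA: "hmem h1 a ((i * N + j) * T + l) = coeff (A i j) l" if "i < N" "j < N" "l < T" for i j l
      using A that mem1 by simp
    have rdB: "hmem h1 2 ((i * N + j) * T + l) = coeff (flM A N q i j) l" if "i < N" "j < N" "l < T" for i j l
      using I1 that by (simp add: I_def)
    have rdC: "hmem h1 c (q * T + l) = coeff (flC A N q) l" if "l < T" for l
      using I1 that by (simp add: I_def)
    have clB: "coeff (flM A N q i j) l \<in> cls s" if "i < N" "j < N" "l < T" for i j l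
      unfolding s_def using that q by (intro flcls) auto
    have clC: "coeff (flC A N q) l \<in> cls s" if "l < T" for l
      unfolding s_def using that q by (intro flcls) auto
    have v3: "ev (fl_mat a c) (setr (setr (setr ?h2 ri i) rj j) rl l) = coeff (flM A N (Suc q) i j) l"
      if "i < N" "j < N" "l < T" for i j l
      using that reg1 N T
      by (simp add: fl_mat_def flM_Suc coeff_sum coeff_mult rdA rdB rdC lessThan_Suc_atMost del: Nat.add_diff_assoc)
    have c3: "chk \<delta> (fl_mat a c) (setr (setr (setr ?h2 ri i) rj j) rl l)"
      if "i < N" "j < N" "l < T" for i j l
      using that reg1 N T nm L1 E7 arr q
      by (simp add: fl_mat_def rdA rdB rdC \<delta>_def clB clC Acls del: Nat.add_diff_assoc)
    show "wp (fl_step a c) (\<lambda>h''. I (Suc q) (setr h'' rq (hreg h1 rq))) ?h2"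
      unfolding fl_step_def wp.simps(4)
    proof (rule wp_fill3[OF r2(1) N(2) r2(2) T(2) _ _ c3 _ ok2])
      show "5 \<le> E" using E7 by simp
      show "3 \<notin> arrs (fl_mat a c)" using arr by (auto simp: fl_mat_def)
      show "dg \<delta> (fl_mat a c) \<le> E" using sE arr by (simp add: fl_mat_def \<delta>_def)
      fix h3 :: hstate assume reg3: "hreg h3 = hreg ?h2" and mem3: "\<And>b. b \<noteq> 3 \<Longrightarrow> hmem h3 b = hmem ?h2 b"
        and val3: "\<And>i j l. i < N \<Longrightarrow> j < N \<Longrightarrow> l < T \<Longrightarrow>
          hmem h3 3 ((i * N + j) * T + l) = ev (fl_mat a c) (setr (setr (setr ?h2 ri i) rj j) rl l)"
      have rd3: "hmem h3 3 ((i * N + j) * T + l) = coeff (flM A N (Suc q) i j) l"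
        if "i < N" "j < N" "l < T" for i j l using val3[OF that] v3[OF that] by simp
      have r3: "hreg h3 rN = N" "hreg h3 rT = T" "okh h3" using reg3 r2 ok2 by (auto simp: okh_def)
      define s' where "s' = stp \<kappa> (Suc q)"
      have s'E: "s' \<le> E" using stp_mono[of "Suc q" N \<kappa>] q E by (simp add: s'_def)
      have M': "coeff (flM A N (Suc q) i j) l \<in> cls s'" if "i < N" "j < N" "l < T" for i j l
        unfolding s'_def using that q by (intro flcls) auto
      show "wp (fill3 2 (Get 3 (midx (NV ri) (NV rj) (NV rl))))
         (wp (fill1 c (NV rT) (NMul (NAdd (NV rq) (NC 1)) (NV rT)) fl_coeff)
           (\<lambda>h''. I (Suc q) (setr h'' rq (hreg h1 rq)))) h3"
      proof (rule wp_fill3[where \<delta> = "\<lambda>_. s'", OF r3(1) N(2) r3(2) T(2) _ _ _ _ r3(3)])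
        show "5 \<le> E" using E7 by simp
        show "chk (\<lambda>_. s') (Get 3 (midx (NV ri) (NV rj) (NV rl))) (setr (setr (setr h3 ri i) rj j) rl l)"
          if "i < N" "j < N" "l < T" for i j l
          using that r3 nm E7 by (simp add: rd3 M')
        fix h4 :: hstate assume reg4: "hreg h4 = hreg h3" and mem4: "\<And>b. b \<noteq> 2 \<Longrightarrow> hmem h4 b = hmem h3 b"
          and val4: "\<And>i j l. i < N \<Longrightarrow> j < N \<Longrightarrow> l < T \<Longrightarrow> hmem h4 2 ((i * N + j) * T + l) =
             ev (Get 3 (midx (NV ri) (NV rj) (NV rl))) (setr (setr (setr h3 ri i) rj j) rl l)"
        have rd4: "hmem h4 2 ((i * N + j) * T + l) = coeff (flM A N (Suc q) i j) l"
          if "i < N" "j < N" "l < T" for i j l using val4[OF that] rd3[OF that] r3 by simp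
        have r4: "hreg h4 rN = N" "hreg h4 rT = T" "hreg h4 rq = q" "okh h4"
          using reg4 reg3 r3 by (auto simp: okh_def)
        let ?\<delta> = "\<lambda>_. s - 1 + \<kappa> + 4"
        \<comment> \<open>Sharper than the bound \<open>stp \<kappa> (Suc q)\<close> from
          \<open>fl_cls\<close>: the three further units that \<open>fl_coeff\<close> costs still
          have to fit below \<open>E\<close>.\<close>
        have M'': "coeff (flM A N (Suc q) i j) l \<in> cls (s + \<kappa> + 3)" if "i < N" "j < N" "l < T" for i j l
        proof -
          have "ev (fl_mat a c) (setr (setr (setr ?h2 ri i) rj j) rl l) \<in> cls (dg \<delta> (fl_mat a c))"
            using that N T by (intro ev_cls c3 that okh_setr[OF okh_setr[OF okh_setr[OF ok2]]]) auto
          then show ?thesis unfolding v3[OF that] by (rule cls_mono) (use arr in \<open>simp add: fl_mat_def \<delta>_def\<close>)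
        qed
        have v5: "ev fl_coeff (setr h4 rl l) = coeff (flC A N (Suc q)) l" if "l < T" for l
          using that r4 by (simp add: fl_coeff_def flC_Suc rd4 coeff_sum)
        have c5: "chk (\<lambda>_. s + \<kappa> + 3) fl_coeff (setr h4 rl l)" if "l < T" for l
        proof -
          have "inverse (1 + of_nat q) \<in> cls (Suc 0)" using inverse_nat_cls[of "Suc q"] q N by simp
          then show ?thesis using that r4 nm L1 E7 N cls_0 q
            by (simp add: fl_coeff_def rd4 M'')
        qed
        show "wp (fill1 c (NV rT) (NMul (NAdd (NV rq) (NC 1)) (NV rT)) fl_coeff)
           (\<lambda>h''. I (Suc q) (setr h'' rq (hreg h1 rq))) h4"
        proof (rule wp_fill1[where \<delta> = "\<lambda>_. s + \<kappa> + 3" and ?o1.0 = "Suc q * T"])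
          fix h5 :: hstate assume reg5: "hreg h5 = hreg h4" and mem5: "\<And>b. b \<noteq> c \<Longrightarrow> hmem h5 b = hmem h4 b"
            and val5: "\<And>k. k < nev (NV rT) h4 \<Longrightarrow> hmem h5 c (Suc q * T + k) = ev fl_coeff (setr h4 rl k)"
            and old5: "\<And>i. i < Suc q * T \<Longrightarrow> hmem h5 c i = hmem h4 c i"
          have "hmem h5 c (q' * T + l) = coeff (flC A N q') l" if "q' \<le> Suc q" "l < T" for q' l
          proof (cases "q' = Suc q")
            case True
            then show ?thesis using val5[of l] v5[of l] that r4 by simp
          next
            case False
            then have "Suc q' * T \<le> Suc q * T" using that by (intro mult_le_mono1) simp
            then have "q' * T + l < Suc q * T" using that(2) by (simp only: mult_Suc)
            then have "hmem h5 c (q' * T + l) = hmem h1 c (q' * T + l)"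
              using old5 mem4[of c] mem3[of c] arr by simp
            then show ?thesis using I1 False that by (simp add: I_def)
          qed
          moreover have "hmem h5 2 = hmem h4 2" using mem5 arr by auto
          ultimately show "I (Suc q) (setr h5 rq (hreg h1 rq))" using rd4 by (simp add: I_def)
        next
          show "nok (NMul (NAdd (NV rq) (NC 1)) (NV rT)) (setr h4 rl k) \<and>
            nev (NMul (NAdd (NV rq) (NC 1)) (NV rT)) (setr h4 rl k) = Suc q * T" for k
            using r4 nm L1 by simp
          show "c \<notin> arrs fl_coeff" using arr by (auto simp: fl_coeff_def)
          show "dg (\<lambda>_. s + \<kappa> + 3) fl_coeff \<le> E" using sE by (simp add: fl_coeff_def)
        qed (use r4 T nm E7 in \<open>auto intro!: c5\<close>)
      qed (use s'E in auto)
    qed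
  next
    show "I 0 h0" by fact
  next
    fix h' assume "I (nev (NV rN) h0) h'"
    then show "\<forall>q\<le>N. \<forall>l<T. hmem h' c (q * T + l) = coeff (flC A N q) l" using reg0 N by (simp add: I_def)
  qed (use nm E1' N reg0 in auto)
  show ?thesis unfolding fl_prog_def wp.simps(4)
  proof (rule wp_fill3[where \<delta> = "\<lambda>_. 1", OF N T _ _ _ _ ok])
    fix h1 :: hstate assume reg1: "hreg h1 = hreg h" and mem1: "\<And>b. b \<noteq> 2 \<Longrightarrow> hmem h1 b = hmem h b"
      and val1: "\<And>i j l. i < N \<Longrightarrow> j < N \<Longrightarrow> l < T \<Longrightarrow> hmem h1 2 ((i * N + j) * T + l) =
         ev (EC 0) (setr (setr (setr h ri i) rj j) rl l)"
    show "wp (fill1 c (NV rT) (NC 0) (Cond Equal (EN (NV rl)) (EC 0) (EC 1) (EC 0)))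
       (wp (HFor rq (NV rN) (fl_step a c)) (\<lambda>h'. \<forall>q\<le>N. \<forall>l<T. hmem h' c (q * T + l) = coeff (flC A N q) l)) h1"
    proof (rule wp_fill1[where \<delta> = "\<lambda>_. 1" and ?o1.0 = 0])
      fix h2 :: hstate assume reg2: "hreg h2 = hreg h1" and mem2: "\<And>b. b \<noteq> c \<Longrightarrow> hmem h2 b = hmem h1 b"
        and val2: "\<And>k. k < nev (NV rT) h1 \<Longrightarrow> hmem h2 c (0 + k) =
          ev (Cond Equal (EN (NV rl)) (EC 0) (EC 1) (EC 0)) (setr h1 rl k)"
      show "wp (HFor rq (NV rN) (fl_step a c)) (\<lambda>h'. \<forall>q\<le>N. \<forall>l<T. hmem h' c (q * T + l) = coeff (flC A N q) l) h2"
      proof (rule loop)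
        show "hreg h2 = hreg h" using reg2 reg1 by simp
        show "hmem h2 a = hmem h a" using mem2[of a] mem1[of a] arr by auto
        show "I 0 h2" using val1 val2 mem2[of 2] reg1 T arr
          by (auto simp: I_def one_pCons coeff_pCons split: nat.splits)
      qed
    qed (use reg1 T nm E1' E7 L1 ok cls_0 cls_1 in \<open>auto simp: okh_def\<close>)
  qed (use E7 cls_0 in auto)
qed

text \<open>The test multiplies two coefficients, hence \<open>2 * s \<le> E\<close>.\<close>

lemma wp_count:
  assumes N: "hreg h rN = N" "N \<le> L"
    and c: "\<And>k. k \<le> N \<Longrightarrow> hmem h 13 k = c k" "\<And>k. k \<le> N \<Longrightarrow> c k \<in> cls s" "c 0 = 1"
    and E: "2 * s \<le> E" "1 \<le> s"
  shows "wp count_prog (\<lambda>h'. hreg h' rcnt = changes c N) h"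
proof -
  have nm: "rN < named" "rq < named" "rcnt < named" by (auto simp: named_def)
  have L1: "Suc 0 \<le> L" using L2 by simp
  have E1': "Suc 0 \<le> E" using E1 by simp
  let ?h1 = "setm (setr h rcnt 0) 14 0 1"
  have snd: "snd (sc c q) \<le> q" for q by (induction q) auto
  have fst: "q \<le> N \<Longrightarrow> fst (sc c q) \<in> cls s" for q
    using c(2)[of 0] c by (induction q) auto
  have "wp (HFor rq (NV rN) count_step) (\<lambda>h'. hreg h' rcnt = changes c N) ?h1"
  proof (rule wp_For[where I = "\<lambda>q h'. hreg h' rcnt = snd (sc c q) \<and> hmem h' 14 0 = fst (sc c q)"])
    fix q h2
    assume q: "q < nev (NV rN) ?h1" and I: "hreg h2 rcnt = snd (sc c q) \<and> hmem h2 14 0 = fst (sc c q)"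
      and un: "unch count_step ?h1 h2"
    have q: "q < N" using q N by simp
    have rd: "hmem h2 13 (Suc q) = c (Suc q)" "c (Suc q) \<in> cls s"
      using un c q by (auto simp: unch_def)
    have fq: "fst (sc c q) \<in> cls s" using fst q by simp
    have sq: "Suc (snd (sc c q)) \<le> L" using snd[of q] q N by simp
    show "wp count_step (\<lambda>h''. hreg (setr h'' rq (hreg h2 rq)) rcnt = snd (sc c (Suc q)) \<and>
        hmem (setr h'' rq (hreg h2 rq)) 14 0 = fst (sc c (Suc q))) (setr h2 rq q)"
      unfolding count_step_def using I rd fq sq nm L1 E7 E cls_0[of 1]
      by (auto intro!: exI[of _ "\<lambda>_. s"])
  qed (use N nm E1' c in \<open>auto simp: changes_def\<close>)
  then show ?thesis
    unfolding count_prog_def wp.simps(4) using nm E1' cls_1 L2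
    by (simp add: exI[of _ "\<lambda>_. 1"])
qed

end

section \<open>Testing one univariate polynomial for nonnegativity\<close>

abbreviation rS :: nat where "rS \<equiv> 2"
abbreviation rK :: nat where "rK \<equiv> 11"
abbreviation rm :: nat where "rm \<equiv> 12"
abbreviation rcnt1 :: nat where "rcnt1 \<equiv> 14"
abbreviation rres :: nat where "rres \<equiv> 15"

text \<open>Padded with zeros to length \<open>S + 2\<close>, since \<open>e_G\<close> reads entry
  \<open>rl + 1\<close> up to \<open>rl = S\<close>.\<close>

definition p_F :: hcom where
  "p_F = fill1 5 (NAdd (NV rS) (NC 2)) (NC 0)
     (Cond Less (EN (NV rl)) (EN (NV rS)) (Get 4 (NAdd (NMul (NV rK) (NV rS)) (NV rl))) (EC 0))"

definition e_G :: exp where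
  "e_G = Bin Add (Bin Mul (EN (NAdd (NV rl) (NC 1))) (Get 5 (NAdd (NV rl) (NC 1))))
     (Cond Equal (EN (NV rl)) (EC 0) (EC 0)
       (Bin Mul (Bin Sub (EN (NV rl)) (EN (NAdd (NC 1) (NMul (NC 2) (NV rS))))) (Get 5 (NSub (NV rl) (NC 1)))))"

definition p_G :: hcom where "p_G = fill1 6 (NAdd (NV rS) (NC 1)) (NC 0) e_G"

definition p_m_step :: hcom where "p_m_step = HIf Equal (Get 6 (NV rl)) (EC 0) HSkip (Asg rm (NV rl))"

definition p_m :: hcom where
  "p_m = HSeq (Asg rm (NC 0)) (HFor rl (NAdd (NV rS) (NC 1)) p_m_step)"

definition p_LC :: hcom where
  "p_LC = Put 7 (NC 0) (Cond Equal (Get 6 (NV rm)) (EC 0) (EC 1) (Get 6 (NV rm)))"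

definition e_GH :: exp where
  "e_GH = Cond Leq (EN (NV rl)) (EN (NV rm)) (Bin Div (Get 6 (NSub (NV rm) (NV rl))) (Get 7 (NC 0))) (EC 0)"

definition p_GH :: hcom where "p_GH = fill1 8 (NAdd (NMul (NC 4) (NV rS)) (NC 1)) (NC 0) e_GH"

definition e_SM :: exp where
  "e_SM = Bin Sub (EC 0) (Bin Add
      (Bin Mul (EN (NAdd (NV rq) (NC 1))) (Get 8 (NAdd (NV rq) (NC 1))))
      (Sum rk (NV rq) (Bin Mul (Get 8 (NSub (NV rq) (NV rk))) (Get 9 (NAdd (NV rk) (NC 1))))))"

definition p_SM_step :: hcom where "p_SM_step = Put 9 (NAdd (NV rq) (NC 1)) e_SM"

definition p_SM :: hcom where
  "p_SM = HSeq (Put 9 (NC 0) (EN (NV rm))) (HFor rq (NMul (NC 4) (NV rS)) p_SM_step)"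

definition e_H :: "nat \<Rightarrow> exp" where
  "e_H b = Sum rk (NV rS) (Bin Mul (Get 5 (NV rk)) (Get b (NAdd (NV rl) (NV rk))))"

text \<open>Each use shortens the range by \<open>S\<close>: power sums below index
  \<open>4 * S\<close> give \<open>3 * S\<close> moments of \<open>f\<close>, these give
  \<open>2 * S\<close> moments of \<open>f\<^sup>2\<close>, and a Hankel matrix of size
  \<open>S\<close> reads \<open>2 * S - 1\<close> of them.\<close>

definition p_H :: "nat \<Rightarrow> nat \<Rightarrow> nat \<Rightarrow> hcom" where
  "p_H a b m = fill1 a (NMul (NC m) (NV rS)) (NC 0) (e_H b)"

definition p_npos :: "nat \<Rightarrow> hcom" where
  "p_npos b = HSeq (fill3 12 (Get b (NAdd (NV ri) (NV rj)))) (HSeq (fl_prog 12 13) count_prog)"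

text \<open>The answer in \<open>rres\<close> is only ever lowered to 0, so that successive tests
  form a conjunction.\<close>

definition p_test :: hcom where
  "p_test = HSeq p_F (HSeq p_G (HSeq p_m (HSeq p_LC (HSeq p_GH (HSeq p_SM (HSeq (p_H 10 9 3) (HSeq (p_H 11 10 2)
     (HSeq (Asg rN (NV rS)) (HSeq (Asg rT (NC 1)) (HSeq (p_npos 10) (HSeq (Asg rcnt1 (NV rcnt)) (HSeq (p_npos 11)
      (HIf Equal (EN (NV rcnt)) (EN (NV rcnt1)) HSkip (Asg rres (NC 0)))))))))))))))"

lemmas p_defs = p_F_def p_G_def p_m_def p_m_step_def p_LC_def p_GH_def p_SM_def p_SM_step_def p_H_def p_npos_def

lemma wrwa_p[simp]:
  "wr p_F = {}" "wa p_F = {5}" "wr p_G = {}" "wa p_G = {6}" "wr p_m = {rm}" "wa p_m = {}"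
  "wr p_m_step = {rm}" "wa p_m_step = {}"
  "wr p_LC = {}" "wa p_LC = {7}" "wr p_GH = {}" "wa p_GH = {8}" "wr p_SM = {}" "wa p_SM = {9}"
  "wr p_SM_step = {}" "wa p_SM_step = {9}"
  "wr (p_H a b k) = {}" "wa (p_H a b k) = {a}" "wr (p_npos b) = {rcnt}" "wa (p_npos b) = {2, 3, 12, 13, 14}"
  by (auto simp: p_defs)

text \<open>What the scan \<open>p_m\<close> computes. The default 0 agrees with the degree of the
  zero polynomial.\<close>

primrec top_index :: "(nat \<Rightarrow> 'a::zero) \<Rightarrow> nat \<Rightarrow> nat" where
  "top_index c 0 = 0"
| "top_index c (Suc l) = (if c l = 0 then top_index c l else l)"

lemma top_index_degree: assumes "degree p < l" shows "top_index (coeff p) l = degree p"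
  using assms
proof (induction l)
  case (Suc l)
  show ?case
  proof (cases "degree p = l")
    case True
    show ?thesis
    proof (cases "coeff p l = 0")
      case True
      then have "p = 0" "l = 0" using \<open>degree p = l\<close> by auto
      then show ?thesis by simp
    qed (use True in simp)
  next
    case False
    then show ?thesis using Suc by (simp add: coeff_eq_0)
  qed
qed simp

text \<open>A step of \<open>e_SM\<close> costs \<open>e + 9\<close>: the exponent
  \<open>e + 6\<close> of \<open>gh\<close>, and three units for the sum, the addition and the
  subtraction from 0. There are \<open>4 * S\<close> steps.\<close>

definition deg_psum :: "nat \<Rightarrow> nat \<Rightarrow> nat" where "deg_psum S e = 1 + 4 * S * (e + 9)"

definition deg_mom :: "nat \<Rightarrow> nat \<Rightarrow> nat" where "deg_mom S e = 2 * e + deg_psum S e + 2"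

context sized_dvd
begin

lemma okh_unch: "okh h \<Longrightarrow> unch c h h' \<Longrightarrow> (\<And>x. x \<in> wr c \<Longrightarrow> hreg h' x \<le> L) \<Longrightarrow> okh h'"
  unfolding okh_def unch_def by metis

lemma okh_reg: "okh h \<Longrightarrow> hreg h' = hreg h \<Longrightarrow> okh h'"
  by (simp add: okh_def)

text \<open>The hypothesis \<open>inv\<close> makes the division by the leading coefficient cost one
  exponent. The final choice of \<open>B\<close> provides it.\<close>

context
  fixes f :: "rat poly" and S e0 :: nat
  assumes deg: "degree f < S" and SL: "4 * S + 2 \<le> L" and fc: "\<And>l. coeff f l \<in> cls e0" and e0: "1 \<le> e0"
    and inv: "inverse (lcg (gpoly f S)) \<in> cls 1"
begin

abbreviation "eS \<equiv> deg_psum S e0"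
abbreviation "e2 \<equiv> deg_mom S e0"

text \<open>\<open>stp e2 S\<close> is the exponent of the coefficients computed for the Hankel
  matrices; its double covers the products in \<open>count_step\<close>.\<close>

context
  assumes bigE: "2 * stp e2 S \<le> E"
begin

lemma e2E: "e2 + 7 \<le> E" and eS_le: "e0 + 10 \<le> eS"
proof -
  have S: "1 \<le> S" using deg by simp
  have "1 * (e2 + 6) \<le> S * (e2 + 6)" using S by (intro mult_le_mono1)
  moreover have "2 * (1 + x) \<le> E \<Longrightarrow> 1 * (e2 + 6) \<le> x \<Longrightarrow> e2 + 7 \<le> E" for x by arith
  ultimately show "e2 + 7 \<le> E" using bigE unfolding stp_def by blast
  have "1 * (e0 + 9) \<le> (4 * S) * (e0 + 9)" using S by (intro mult_le_mono1) simp
  moreover have "1 * (e0 + 9) \<le> x \<Longrightarrow> e0 + 10 \<le> 1 + x" for x by arith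
  ultimately show "e0 + 10 \<le> eS" unfolding deg_psum_def by blast
qed

lemma E_facts: "e0 + 20 \<le> E" "eS + 6 \<le> E" "10 \<le> E" "e0 + eS + 8 \<le> E" "e2 \<le> E"
  using e2E eS_le e0 unfolding deg_mom_def by linarith+

lemma named_facts: "rl < named" "rS < named" "rK < named" "rm < named" "rq < named" "rk < named"
  "rcnt1 < named" "rres < named" "rcnt < named" "rN < named" "rT < named" "ri < named" "rj < named"
  by (auto simp: named_def)

lemma L_facts: "Suc 0 \<le> L" "2 \<le> L" "4 \<le> L" "3 \<le> L" "S \<le> L" "S + 2 \<le> L" "S + 1 \<le> L" "4 * S \<le> L" "4 * S + 1 \<le> L" "3 * S \<le> L" "2 * S \<le> L"
  using SL deg by linarith+

lemma wp_F:
  assumes "okh h" "hreg h rS = S" "hreg h rK = K" "\<And>l. l < S \<Longrightarrow> hmem h 4 (K * S + l) = coeff f l"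
  shows "wp p_F (\<lambda>h'. \<forall>l<S + 2. hmem h' 5 l = coeff f l) h"
  unfolding p_F_def
proof (rule wp_fill1[where \<delta> = "\<lambda>_. e0" and ?o1.0 = 0])
  show "chk (\<lambda>_. e0) (Cond Less (EN (NV rl)) (EN (NV rS)) (Get 4 (NAdd (NMul (NV rK) (NV rS)) (NV rl))) (EC 0)) (setr h rl k)" for k
    using assms named_facts E_facts cls_0 by (simp add: fc)
  fix h' :: hstate assume "\<And>k. k < nev (NAdd (NV rS) (NC 2)) h \<Longrightarrow> hmem h' 5 (0 + k) =
    ev (Cond Less (EN (NV rl)) (EN (NV rS)) (Get 4 (NAdd (NMul (NV rK) (NV rS)) (NV rl))) (EC 0)) (setr h rl k)"
  then show "\<forall>l<S + 2. hmem h' 5 l = coeff f l"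
    using assms deg by (auto simp: coeff_eq_0)
qed (use assms named_facts E_facts L_facts e0 in auto)

lemma wp_G:
  assumes "okh h" "hreg h rS = S" "\<And>l. l < S + 2 \<Longrightarrow> hmem h 5 l = coeff f l"
  shows "wp p_G (\<lambda>h'. \<forall>l<S + 1. hmem h' 6 l = coeff (gpoly f S) l \<and> hmem h' 6 l \<in> cls (e0 + 5)) h"
  unfolding p_G_def
proof (rule wp_fill1[where \<delta> = "\<lambda>_. e0" and ?o1.0 = 0])
  show "chk (\<lambda>_. e0) e_G (setr h rl k)" if "k < nev (NAdd (NV rS) (NC 1)) h" for k
    using assms named_facts E_facts L_facts cls_0 that by (simp add: fc e_G_def)
  fix h' :: hstate
  assume v: "\<And>k. k < nev (NAdd (NV rS) (NC 1)) h \<Longrightarrow> hmem h' 6 (0 + k) = ev e_G (setr h rl k)"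
    and c: "\<And>k. k < nev (NAdd (NV rS) (NC 1)) h \<Longrightarrow> hmem h' 6 (0 + k) \<in> cls (dg (\<lambda>_. e0) e_G)"
  have dg: "dg (\<lambda>_. e0) e_G = e0 + 5" by (simp add: e_G_def)
  have "hmem h' 6 l = coeff (gpoly f S) l" if "l < S + 1" for l
    using v[of l] assms that by (auto simp: e_G_def coeff_gpoly)
  moreover have "hmem h' 6 l \<in> cls (e0 + 5)" if "l < S + 1" for l
    using c[of l] assms(2) that unfolding dg by simp
  ultimately show "\<forall>l<S + 1. hmem h' 6 l = coeff (gpoly f S) l \<and> hmem h' 6 l \<in> cls (e0 + 5)"
    by blast
qed (use assms named_facts E_facts L_facts e0 in \<open>auto simp: e_G_def\<close>)

lemma degG: "degree (gpoly f S) \<le> S" using degree_gpoly[OF deg] .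

lemma wp_m:
  assumes "hreg h rS = S" "\<And>l. l < S + 1 \<Longrightarrow> hmem h 6 l = coeff (gpoly f S) l \<and> hmem h 6 l \<in> cls (e0 + 5)"
  shows "wp p_m (\<lambda>h'. hreg h' rm = degree (gpoly f S)) h"
proof -
  let ?g = "gpoly f S"
  let ?h = "setr h rm 0"
  have "wp (HFor rl (NAdd (NV rS) (NC 1)) p_m_step) (\<lambda>h'. hreg h' rm = degree ?g) ?h"
  proof (rule wp_For[where I = "\<lambda>l h'. hreg h' rm = top_index (coeff ?g) l"])
    fix l h' assume l: "l < nev (NAdd (NV rS) (NC 1)) ?h" and I: "hreg h' rm = top_index (coeff ?g) l"
      and un: "unch p_m_step ?h h'"
    have l: "l < S + 1" using l assms by simp
    have "hmem h' 6 l = coeff ?g l" "hmem h' 6 l \<in> cls (e0 + 5)" using un assms(2)[OF l] by (auto simp: unch_def)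
    then show "wp p_m_step (\<lambda>h''. hreg (setr h'' rl (hreg h' rl)) rm = top_index (coeff ?g) (Suc l)) (setr h' rl l)"
      unfolding p_m_step_def using I named_facts E_facts L_facts l cls_0
      by (auto intro!: exI[of _ "\<lambda>_. e0 + 5"])
  next
    show "hreg h' rm = degree ?g" if "hreg h' rm = top_index (coeff ?g) (nev (NAdd (NV rS) (NC 1)) ?h)" for h'
      using that assms top_index_degree[of ?g "S + 1"] degG by simp
  qed (use assms named_facts E_facts L_facts in auto)
  then show ?thesis unfolding p_m_def using named_facts E_facts by simp
qed

lemma wp_LC:
  assumes "hreg h rm = degree (gpoly f S)" "\<And>l. l < S + 1 \<Longrightarrow> hmem h 6 l = coeff (gpoly f S) l \<and> hmem h 6 l \<in> cls (e0 + 5)"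
  shows "wp p_LC (\<lambda>h'. hmem h' 7 0 = lcg (gpoly f S) \<and> hmem h' 7 0 \<in> cls (e0 + 5)) h"
  using assms(2)[of "degree (gpoly f S)"] degG assms(1) named_facts E_facts cls_0 cls_1 L_facts
  by (auto simp: p_LC_def lcg_def intro!: exI[of _ "\<lambda>_. e0 + 5"])

lemma wp_GH:
  assumes "okh h" "hreg h rS = S" "hreg h rm = degree (gpoly f S)"
    "\<And>l. l < S + 1 \<Longrightarrow> hmem h 6 l = coeff (gpoly f S) l \<and> hmem h 6 l \<in> cls (e0 + 5)"
    "hmem h 7 0 = lcg (gpoly f S)" "hmem h 7 0 \<in> cls (e0 + 5)"
  shows "wp p_GH (\<lambda>h'. \<forall>l<4 * S + 1. hmem h' 8 l = gh (gpoly f S) l \<and> hmem h' 8 l \<in> cls (e0 + 6)) h"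
  unfolding p_GH_def
proof (rule wp_fill1[where \<delta> = "\<lambda>_. e0 + 5" and ?o1.0 = 0])
  have nz: "lcg (gpoly f S) \<noteq> 0" by (simp add: lcg_def)
  have cl: "coeff (gpoly f S) l \<in> cls (e0 + 5)" if "l < S + 1" for l using assms(4)[OF that] by metis
  show "chk (\<lambda>_. e0 + 5) e_GH (setr h rl k)" if "k < nev (NAdd (NMul (NC 4) (NV rS)) (NC 1)) h" for k
    using assms(1-3,5,6) assms(4)[of "degree (gpoly f S) - k"] cl[of "degree (gpoly f S) - k"] degG named_facts E_facts L_facts cls_0 that nz inv
    by (simp add: e_GH_def)
  fix h' :: hstate
  assume v: "\<And>k. k < nev (NAdd (NMul (NC 4) (NV rS)) (NC 1)) h \<Longrightarrow> hmem h' 8 (0 + k) = ev e_GH (setr h rl k)"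
    and c: "\<And>k. k < nev (NAdd (NMul (NC 4) (NV rS)) (NC 1)) h \<Longrightarrow> hmem h' 8 (0 + k) \<in> cls (dg (\<lambda>_. e0 + 5) e_GH)"
  have dg: "dg (\<lambda>_. e0 + 5) e_GH = e0 + 6" by (simp add: e_GH_def)
  have "hmem h' 8 l = gh (gpoly f S) l" if "l < 4 * S + 1" for l
    using v[of l] assms(2,3,5) assms(4)[of "degree (gpoly f S) - l"] degG that by (auto simp: e_GH_def gh_def)
  moreover have "hmem h' 8 l \<in> cls (e0 + 6)" if "l < 4 * S + 1" for l
    using c[of l] assms(2) that unfolding dg by simp
  ultimately show "\<forall>l<4 * S + 1. hmem h' 8 l = gh (gpoly f S) l \<and> hmem h' 8 l \<in> cls (e0 + 6)"
    by blast
qed (use assms named_facts E_facts L_facts e0 in \<open>auto simp: e_GH_def\<close>)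

lemma wp_SM:
  assumes ok: "okh h" and S: "hreg h rS = S" and m: "hreg h rm = degree (gpoly f S)"
    and g: "\<And>l. l < 4 * S + 1 \<Longrightarrow> hmem h 8 l = gh (gpoly f S) l \<and> hmem h 8 l \<in> cls (e0 + 6)"
  shows "wp p_SM (\<lambda>h'. \<forall>l<4 * S + 1. hmem h' 9 l = psum (gpoly f S) l \<and> hmem h' 9 l \<in> cls eS) h"
proof -
  let ?g = "gpoly f S"
  let ?h = "setm h 9 0 (of_nat (degree ?g))"
  \<comment> \<open>The exponent of the power sums after \<open>q\<close> steps: earlier ones enter
    only multiplied by an entry of \<open>gh\<close>, so it grows linearly.\<close>
  define \<sigma> where "\<sigma> q = 1 + q * (e0 + 9)" for q
  have \<sigma>: "\<sigma> q \<le> \<sigma> q'" if "q \<le> q'" for q q' using that unfolding \<sigma>_def by (intro add_mono mult_le_mono1) auto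
  have "wp (HFor rq (NMul (NC 4) (NV rS)) p_SM_step)
     (\<lambda>h'. \<forall>l<4 * S + 1. hmem h' 9 l = psum ?g l \<and> hmem h' 9 l \<in> cls eS) ?h"
  proof (rule wp_For[where I = "\<lambda>q h'. \<forall>l\<le>q. hmem h' 9 l = psum ?g l \<and> hmem h' 9 l \<in> cls (\<sigma> q)"])
    fix q h' assume q: "q < nev (NMul (NC 4) (NV rS)) ?h"
      and I: "\<forall>l\<le>q. hmem h' 9 l = psum ?g l \<and> hmem h' 9 l \<in> cls (\<sigma> q)" and un: "unch p_SM_step ?h h'"
    have q: "q < 4 * S" using q S by simp
    have reg: "hreg h' = hreg h" using un by (auto simp: unch_def)
    have g': "hmem h' 8 l = gh ?g l" "hmem h' 8 l \<in> cls (e0 + 6)" if "l < 4 * S + 1" for l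
      using un g[OF that] by (auto simp: unch_def)
    define \<delta> where "\<delta> x = (if x = (8::nat) then e0 + 6 else \<sigma> q)" for x
    have s1: "\<sigma> (Suc q) = \<sigma> q + e0 + 9" by (simp add: \<sigma>_def)
    have sE: "\<sigma> (Suc q) \<le> eS" using \<sigma>[of "Suc q" "4 * S"] q by (simp add: \<sigma>_def deg_psum_def)
    have s0: "1 \<le> \<sigma> q" by (simp add: \<sigma>_def)
    have dg: "dg \<delta> e_SM \<le> \<sigma> (Suc q)" using s0 by (simp add: e_SM_def \<delta>_def s1)
    let ?k = "setr h' rq q"
    have pc: "psum ?g l \<in> cls (\<sigma> q)" if "l \<le> q" for l using I that by metis
    have gc: "gh ?g l \<in> cls (e0 + 6)" if "l < 4 * S + 1" for l using g[OF that] by metis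
    have chk: "chk \<delta> e_SM ?k"
      using I g' pc gc q reg named_facts E_facts L_facts cls_0
      by (simp add: e_SM_def \<delta>_def del: psum.simps)
    have "okh ?k" using ok reg q L_facts by (auto simp: okh_def)
    then have vc: "ev e_SM ?k \<in> cls (\<sigma> (Suc q))" using ev_cls[OF chk] dg cls_mono by blast
    have v: "ev e_SM ?k = psum ?g (Suc q)" using I g' q by (simp add: e_SM_def psum.simps(2)[of ?g q] del: psum.simps)
    have old: "hmem h' 9 l \<in> cls (\<sigma> (Suc q))" if "l \<le> q" for l
      using I that cls_mono[OF _ \<sigma>[of q "Suc q"]] by auto
    show "wp p_SM_step (\<lambda>h''. \<forall>l\<le>Suc q. hmem (setr h'' rq (hreg h' rq)) 9 l = psum ?g l \<and>
        hmem (setr h'' rq (hreg h' rq)) 9 l \<in> cls (\<sigma> (Suc q))) ?k"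
      unfolding p_SM_step_def wp.simps v
      using chk dg sE E_facts L_facts named_facts vc[unfolded v] I old
      by (auto intro!: exI[of _ \<delta>] simp del: psum.simps)
  next
    have n4: "nev (NMul (NC 4) (NV rS)) ?h = 4 * S" using S by simp
    fix h' :: hstate assume "\<forall>l\<le>nev (NMul (NC 4) (NV rS)) ?h. hmem h' 9 l = psum ?g l \<and> hmem h' 9 l \<in> cls (\<sigma> (nev (NMul (NC 4) (NV rS)) ?h))"
    moreover have "\<sigma> (4 * S) = eS" by (simp add: \<sigma>_def deg_psum_def)
    ultimately show "\<forall>l<4 * S + 1. hmem h' 9 l = psum ?g l \<and> hmem h' 9 l \<in> cls eS"
      unfolding n4 by (metis Suc_eq_plus1 less_Suc_eq_le)
  next
    have "of_nat (degree ?g) \<in> cls 1" using degG L_facts LB by (intro cls_of_nat) simp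
    then show "\<forall>l\<le>0. hmem ?h 9 l = psum ?g l \<and> hmem ?h 9 l \<in> cls (\<sigma> 0)" by (simp add: \<sigma>_def)
  qed (use S named_facts E_facts L_facts in auto)
  then show ?thesis unfolding p_SM_def using named_facts E_facts m by simp
qed

lemma wp_H:
  assumes "okh h" "hreg h rS = S" "\<And>l. l < S + 2 \<Longrightarrow> hmem h 5 l = coeff f l"
    and b: "\<And>l. l < (k + 1) * S \<Longrightarrow> hmem h b l = v l \<and> hmem h b l \<in> cls \<beta>"
    and ab: "a \<noteq> 5" "a \<noteq> b" "b \<noteq> 5" and k: "k * S \<le> L" "k \<le> L" and \<beta>: "e0 + \<beta> + 1 \<le> E"
  shows "wp (p_H a b k) (\<lambda>h'. \<forall>l<k * S. hmem h' a l = (\<Sum>i<S. coeff f i * v (l + i)) \<and> hmem h' a l \<in> cls (e0 + \<beta> + 1)) h"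
  unfolding p_H_def
proof (rule wp_fill1[where \<delta> = "\<lambda>x. if x = 5 then e0 else \<beta>" and ?o1.0 = 0])
  have *: "l + i < (k + 1) * S" if "l < k * S" "i < S" for l i using that by simp
  have vb: "v l \<in> cls \<beta>" if "l < (k + 1) * S" for l using b[OF that] by metis
  show "chk (\<lambda>x. if x = 5 then e0 else \<beta>) (e_H b) (setr h rl l)" if "l < nev (NMul (NC k) (NV rS)) h" for l
    using assms(1,2,3) *[of l] b vb that named_facts E_facts L_facts cls_0 ab by (simp add: fc e_H_def)
  fix h' :: hstate
  assume v: "\<And>l. l < nev (NMul (NC k) (NV rS)) h \<Longrightarrow> hmem h' a (0 + l) = ev (e_H b) (setr h rl l)"
    and c: "\<And>l. l < nev (NMul (NC k) (NV rS)) h \<Longrightarrow> hmem h' a (0 + l) \<in> cls (dg (\<lambda>x. if x = 5 then e0 else \<beta>) (e_H b))"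
  have dg: "dg (\<lambda>x. if x = 5 then e0 else \<beta>) (e_H b) = e0 + \<beta> + 1" using ab by (simp add: e_H_def)
  have "hmem h' a l = (\<Sum>i<S. coeff f i * v (l + i))" if "l < k * S" for l
    using v[of l] assms(2,3) b *[OF that] that by (auto simp: e_H_def intro!: sum.cong)
  moreover have "hmem h' a l \<in> cls (e0 + \<beta> + 1)" if "l < k * S" for l
    using c[of l] assms(2) that unfolding dg by simp
  ultimately show "\<forall>l<k * S. hmem h' a l = (\<Sum>i<S. coeff f i * v (l + i)) \<and> hmem h' a l \<in> cls (e0 + \<beta> + 1)"
    by blast
qed (use assms named_facts E_facts L_facts e0 in \<open>auto simp: e_H_def\<close>)

lemma wp_npos:
  assumes ok: "okh h" and N: "hreg h rN = S" "hreg h rT = 1"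
    and b: "\<And>l. l < 2 * S \<Longrightarrow> hmem h b l = v l \<and> hmem h b l \<in> cls e2" and b12: "b \<noteq> 12"
  shows "wp (p_npos b) (\<lambda>h'. hreg h' rcnt = npos v S) h"
proof -
  have SS: "S \<le> L" "1 \<le> L" using L_facts by auto
  have vc: "v l \<in> cls e2" if "l < 2 * S" for l using b[OF that] by metis
  have st: "stp e2 S \<le> E" "1 \<le> stp e2 S" using bigE by (auto simp: stp_def)
  show ?thesis unfolding p_npos_def wp.simps(4)
  proof (rule wp_fill3[where \<delta> = "\<lambda>_. e2", OF N(1) SS(1) N(2) SS(2) _ _ _ _ ok])
    show "chk (\<lambda>_. e2) (Get b (NAdd (NV ri) (NV rj))) (setr (setr (setr h ri i) rj j) rl l)"
      if "i < S" "j < S" for i j l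
      using b[of "i + j"] vc[of "i + j"] that named_facts E_facts by simp
    fix h1 :: hstate assume reg1: "hreg h1 = hreg h"
      and v1: "\<And>i j l. i < S \<Longrightarrow> j < S \<Longrightarrow> l < 1 \<Longrightarrow> hmem h1 12 ((i * S + j) * 1 + l) =
         ev (Get b (NAdd (NV ri) (NV rj))) (setr (setr (setr h ri i) rj j) rl l)"
    have "wp (fl_prog 12 13) (\<lambda>h'. \<forall>q\<le>S. \<forall>l<1. hmem h' 13 (q * 1 + l) = coeff (flC (hankel v) S q) l) h1"
    proof (rule wp_fl[where \<kappa> = e2])
      show "okh h1" using okh_reg[OF ok reg1] .
      show "hmem h1 12 ((i * S + j) * 1 + l) = coeff (hankel v i j) l" if "i < S" "j < S" "l < 1" for i j l
        using v1[OF that] b[of "i + j"] that by (simp add: hankel_def)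
      show "coeff (hankel v i j) l \<in> cls e2" if "i < S" "j < S" "l < 1" for i j l
        using vc[of "i + j"] that by (simp add: hankel_def)
    qed (use reg1 N SS st in auto)
    then have "wp (HSeq (fl_prog 12 13) count_prog) (\<lambda>h'. hreg h' rcnt = npos v S) h1"
    proof (rule wp_Seq)
      fix h2 assume c: "\<forall>q\<le>S. \<forall>l<1. hmem h2 13 (q * 1 + l) = coeff (flC (hankel v) S q) l"
        and un: "unch (fl_prog 12 13) h1 h2"
      have "hreg h2 rN = S" using un reg1 N by (simp add: unch_def)
      moreover have "hmem h2 13 k = coeff (flC (hankel v) S k) 0" if "k \<le> S" for k
        using c that by (auto dest!: spec[of _ k])
      moreover have "coeff (flC (hankel v) S k) 0 \<in> cls (stp e2 S)" if "k \<le> S" for k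
      proof -
        have "coeff (flC (hankel v) S k) 0 \<in> cls (stp e2 k)"
          by (rule fl_cls(1)[of S 1]) (use SS that vc in \<open>auto simp: hankel_def\<close>)
        then show ?thesis using cls_mono stp_mono[OF that] by blast
      qed
      ultimately show "wp count_prog (\<lambda>h'. hreg h' rcnt = npos v S) h2"
        unfolding npos_def using SS(1) bigE st
        by (intro wp_count[where s = "stp e2 S"]) auto
    qed
    then show "wp (fl_prog 12 13) (wp count_prog (\<lambda>h'. hreg h' rcnt = npos v S)) h1" by simp
  qed (use E_facts b12 in auto)
qed

lemma wp_test:
  assumes ok: "okh h" and r: "hreg h rS = S" "hreg h rK = K"
    and C: "\<And>l. l < S \<Longrightarrow> hmem h 4 (K * S + l) = coeff f l"
  shows "wp p_test (\<lambda>h'. hreg h' rres = (if npos (mom1 f S) S = npos (mom2 f S) S then hreg h rres else 0) \<and> okh h') h"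
  unfolding p_test_def
proof (rule wp_Seq[OF wp_F[OF ok r C]])
  let ?g = "gpoly f S"
  let ?Q = "\<lambda>h'. hreg h' rres = (if npos (mom1 f S) S = npos (mom2 f S) S then hreg h rres else 0) \<and> okh h'"
  fix h1 :: hstate
  assume F1: "\<forall>l<S + 2. hmem h1 5 l = coeff f l" and u1: "unch p_F h h1"
  have reg1: "hreg h1 = hreg h" using u1 by (auto simp: unch_def)
  have ok1: "okh h1" using okh_reg[OF ok reg1] .
  show "wp (HSeq p_G (HSeq p_m (HSeq p_LC (HSeq p_GH (HSeq p_SM (HSeq (p_H 10 9 3) (HSeq (p_H 11 10 2)
     (HSeq (Asg rN (NV rS)) (HSeq (Asg rT (NC 1)) (HSeq (p_npos 10) (HSeq (Asg rcnt1 (NV rcnt)) (HSeq (p_npos 11)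
      (HIf Equal (EN (NV rcnt)) (EN (NV rcnt1)) HSkip (Asg rres (NC 0))))))))))))))) ?Q h1"
  proof (rule wp_Seq[OF wp_G[OF ok1]])
    show "hreg h1 rS = S" using reg1 r by simp
    show "hmem h1 5 l = coeff f l" if "l < S + 2" for l using F1 that by blast
  next
    fix h2 :: hstate
    assume G2: "\<forall>l<S + 1. hmem h2 6 l = coeff ?g l \<and> hmem h2 6 l \<in> cls (e0 + 5)" and u2: "unch p_G h1 h2"
    have reg2: "hreg h2 = hreg h" using u2 reg1 by (auto simp: unch_def)
    have ok2: "okh h2" using okh_reg[OF ok reg2] .
    have F2: "hmem h2 5 = hmem h1 5" using u2 by (simp add: unch_def)
    show "wp (HSeq p_m (HSeq p_LC (HSeq p_GH (HSeq p_SM (HSeq (p_H 10 9 3) (HSeq (p_H 11 10 2)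
     (HSeq (Asg rN (NV rS)) (HSeq (Asg rT (NC 1)) (HSeq (p_npos 10) (HSeq (Asg rcnt1 (NV rcnt)) (HSeq (p_npos 11)
      (HIf Equal (EN (NV rcnt)) (EN (NV rcnt1)) HSkip (Asg rres (NC 0)))))))))))))) ?Q h2"
    proof (rule wp_Seq[OF wp_m])
      show "hreg h2 rS = S" using reg2 r by simp
      show "hmem h2 6 l = coeff ?g l \<and> hmem h2 6 l \<in> cls (e0 + 5)" if "l < S + 1" for l using G2 that by blast
    next
      fix h3 :: hstate
      assume m3: "hreg h3 rm = degree ?g" and u3: "unch p_m h2 h3"
      have reg3: "x \<noteq> rm \<Longrightarrow> hreg h3 x = hreg h x" for x using u3 reg2 by (simp add: unch_def)
      have ok3: "okh h3" using okh_unch[OF ok2 u3] m3 degG L_facts by simp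
      have mem3: "hmem h3 = hmem h2" using u3 by (auto simp: unch_def)
      show "wp (HSeq p_LC (HSeq p_GH (HSeq p_SM (HSeq (p_H 10 9 3) (HSeq (p_H 11 10 2)
       (HSeq (Asg rN (NV rS)) (HSeq (Asg rT (NC 1)) (HSeq (p_npos 10) (HSeq (Asg rcnt1 (NV rcnt)) (HSeq (p_npos 11)
        (HIf Equal (EN (NV rcnt)) (EN (NV rcnt1)) HSkip (Asg rres (NC 0))))))))))))) ?Q h3"
      proof (rule wp_Seq[OF wp_LC[OF m3]])
        show "hmem h3 6 l = coeff ?g l \<and> hmem h3 6 l \<in> cls (e0 + 5)" if "l < S + 1" for l
          using G2 that unfolding mem3 by blast
      next
        fix h4 :: hstate
        assume LC4: "hmem h4 7 0 = lcg ?g \<and> hmem h4 7 0 \<in> cls (e0 + 5)" and u4: "unch p_LC h3 h4"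
        have reg4: "hreg h4 = hreg h3" using u4 by (auto simp: unch_def)
        have ok4: "okh h4" using okh_reg[OF ok3 reg4] .
        have mem4: "hmem h4 5 = hmem h1 5" "hmem h4 6 = hmem h2 6" using u4 mem3 F2 by (simp_all add: unch_def)
        show "wp (HSeq p_GH (HSeq p_SM (HSeq (p_H 10 9 3) (HSeq (p_H 11 10 2)
         (HSeq (Asg rN (NV rS)) (HSeq (Asg rT (NC 1)) (HSeq (p_npos 10) (HSeq (Asg rcnt1 (NV rcnt)) (HSeq (p_npos 11)
          (HIf Equal (EN (NV rcnt)) (EN (NV rcnt1)) HSkip (Asg rres (NC 0)))))))))))) ?Q h4"
        proof (rule wp_Seq[OF wp_GH[OF ok4]])
          show "hreg h4 rS = S" "hreg h4 rm = degree ?g" using reg4 reg3 r m3 by simp_all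
          show "hmem h4 6 l = coeff ?g l \<and> hmem h4 6 l \<in> cls (e0 + 5)" if "l < S + 1" for l
            using G2 that unfolding mem4 by blast
          show "hmem h4 7 0 = lcg ?g" "hmem h4 7 0 \<in> cls (e0 + 5)" using LC4 by blast+
        next
          fix h5 :: hstate
          assume GH5: "\<forall>l<4 * S + 1. hmem h5 8 l = gh ?g l \<and> hmem h5 8 l \<in> cls (e0 + 6)" and u5: "unch p_GH h4 h5"
          have reg5: "hreg h5 = hreg h3" using u5 reg4 by (auto simp: unch_def)
          have ok5: "okh h5" using okh_reg[OF ok3 reg5] .
          have mem5: "hmem h5 5 = hmem h1 5" using u5 mem4 by (simp add: unch_def)
          show "wp (HSeq p_SM (HSeq (p_H 10 9 3) (HSeq (p_H 11 10 2)
           (HSeq (Asg rN (NV rS)) (HSeq (Asg rT (NC 1)) (HSeq (p_npos 10) (HSeq (Asg rcnt1 (NV rcnt)) (HSeq (p_npos 11)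
            (HIf Equal (EN (NV rcnt)) (EN (NV rcnt1)) HSkip (Asg rres (NC 0))))))))))) ?Q h5"
          proof (rule wp_Seq[OF wp_SM[OF ok5]])
            show "hreg h5 rS = S" "hreg h5 rm = degree ?g" using reg5 reg3 r m3 by simp_all
            show "hmem h5 8 l = gh ?g l \<and> hmem h5 8 l \<in> cls (e0 + 6)" if "l < 4 * S + 1" for l
              using GH5 that by blast
          next
            fix h6 :: hstate
            assume SM6: "\<forall>l<4 * S + 1. hmem h6 9 l = psum ?g l \<and> hmem h6 9 l \<in> cls eS" and u6: "unch p_SM h5 h6"
            have reg6: "hreg h6 = hreg h3" using u6 reg5 by (auto simp: unch_def)
            have ok6: "okh h6" using okh_reg[OF ok3 reg6] .
            have mem6: "hmem h6 5 = hmem h1 5" using u6 mem5 by (simp add: unch_def)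
            show "wp (HSeq (p_H 10 9 3) (HSeq (p_H 11 10 2)
             (HSeq (Asg rN (NV rS)) (HSeq (Asg rT (NC 1)) (HSeq (p_npos 10) (HSeq (Asg rcnt1 (NV rcnt)) (HSeq (p_npos 11)
              (HIf Equal (EN (NV rcnt)) (EN (NV rcnt1)) HSkip (Asg rres (NC 0)))))))))) ?Q h6"
            proof (rule wp_Seq[OF wp_H[where v = "psum ?g" and \<beta> = eS, OF ok6]])
              show "hreg h6 rS = S" using reg6 reg3 r by simp
              show "hmem h6 5 l = coeff f l" if "l < S + 2" for l using F1 that unfolding mem6 by blast
              show "hmem h6 9 l = psum ?g l \<and> hmem h6 9 l \<in> cls eS" if "l < (3 + 1) * S" for l
              proof -
                have "l < 4 * S + 1" using that by simp
                then show ?thesis using SM6 by blast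
              qed
            next
              fix h7 :: hstate
              assume H7: "\<forall>l<3 * S. hmem h7 10 l = (\<Sum>i<S. coeff f i * psum ?g (l + i)) \<and> hmem h7 10 l \<in> cls (e0 + eS + 1)"
                and u7: "unch (p_H 10 9 3) h6 h7"
              have reg7: "hreg h7 = hreg h3" using u7 reg6 by (auto simp: unch_def)
              have ok7: "okh h7" using okh_reg[OF ok3 reg7] .
              have mem7: "hmem h7 5 = hmem h1 5" using u7 mem6 by (simp add: unch_def)
              have H7': "hmem h7 10 l = mom1 f S l \<and> hmem h7 10 l \<in> cls (e0 + eS + 1)" if "l < 3 * S" for l
                unfolding mom1_def using H7 that by blast
              show "wp (HSeq (p_H 11 10 2)
               (HSeq (Asg rN (NV rS)) (HSeq (Asg rT (NC 1)) (HSeq (p_npos 10) (HSeq (Asg rcnt1 (NV rcnt)) (HSeq (p_npos 11)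
                (HIf Equal (EN (NV rcnt)) (EN (NV rcnt1)) HSkip (Asg rres (NC 0))))))))) ?Q h7"
              proof (rule wp_Seq[OF wp_H[where v = "mom1 f S" and \<beta> = "e0 + eS + 1", OF ok7]])
                show "hreg h7 rS = S" using reg7 reg3 r by simp
                show "hmem h7 5 l = coeff f l" if "l < S + 2" for l using F1 that unfolding mem7 by blast
                show "hmem h7 10 l = mom1 f S l \<and> hmem h7 10 l \<in> cls (e0 + eS + 1)" if "l < (2 + 1) * S" for l
                  by (rule H7') (use that in simp)
                show "e0 + (e0 + eS + 1) + 1 \<le> E" using E_facts by (simp add: deg_mom_def)
              next
                fix h8 :: hstate
                assume H8: "\<forall>l<2 * S. hmem h8 11 l = (\<Sum>i<S. coeff f i * mom1 f S (l + i)) \<and>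
                     hmem h8 11 l \<in> cls (e0 + (e0 + eS + 1) + 1)"
                  and u8: "unch (p_H 11 10 2) h7 h8"
                have reg8: "hreg h8 = hreg h3" using u8 reg7 by (auto simp: unch_def)
                have ok8: "okh h8" using okh_reg[OF ok3 reg8] .
                have e2_eq: "e2 = e0 + (e0 + eS + 1) + 1" by (simp add: deg_mom_def)
                have H8': "hmem h8 11 l = mom2 f S l \<and> hmem h8 11 l \<in> cls e2" if "l < 2 * S" for l
                  unfolding mom2_def e2_eq using H8 that by blast
                have H78: "hmem h8 10 l = mom1 f S l \<and> hmem h8 10 l \<in> cls e2" if "l < 2 * S" for l
                proof -
                  have "hmem h8 10 = hmem h7 10" using u8 by (simp add: unch_def)
                  moreover have "e0 + eS + 1 \<le> e2" by (simp add: deg_mom_def)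
                  moreover have "l < 3 * S" using that by simp
                  ultimately show ?thesis using H7' cls_mono by metis
                qed
                let ?h9 = "setr (setr h8 rN S) rT 1"
                have ok9: "okh ?h9" using L_facts by (intro okh_setr ok8) auto
                have r8: "hreg h8 rS = S" "hreg h8 rres = hreg h rres" using reg8 reg3 r by simp_all
                have "wp (HSeq (p_npos 10) (HSeq (Asg rcnt1 (NV rcnt)) (HSeq (p_npos 11)
                  (HIf Equal (EN (NV rcnt)) (EN (NV rcnt1)) HSkip (Asg rres (NC 0)))))) ?Q ?h9"
                proof (rule wp_Seq[OF wp_npos[where v = "mom1 f S", OF ok9]])
                  show "hmem ?h9 10 l = mom1 f S l \<and> hmem ?h9 10 l \<in> cls e2" if "l < 2 * S" for l
                    using H78[OF that] by auto
                next
                  fix h10 :: hstate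
                  assume n10: "hreg h10 rcnt = npos (mom1 f S) S" and u10: "unch (p_npos 10) ?h9 h10"
                  \<comment> \<open>Counts are kept in named registers, whose contents must not
                    exceed \<open>L\<close>.\<close>
                  have nL: "npos v S \<le> L" for v
                  proof -
                    have "snd (sc c q) \<le> q" for c :: "nat \<Rightarrow> rat" and q by (induction q) auto
                    then show ?thesis unfolding npos_def changes_def using L_facts(5) order_trans by blast
                  qed
                  have ok10: "okh h10" using okh_unch[OF ok9 u10] n10 nL by simp
                  let ?h11 = "setr h10 rcnt1 (npos (mom1 f S) S)"
                  have ok11: "okh ?h11" using nL by (intro okh_setr ok10)
                  have "wp (HSeq (p_npos 11) (HIf Equal (EN (NV rcnt)) (EN (NV rcnt1)) HSkip (Asg rres (NC 0)))) ?Q ?h11"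
                  proof (rule wp_Seq[OF wp_npos[where v = "mom2 f S", OF ok11]])
                    show "hreg ?h11 rN = S" "hreg ?h11 rT = 1" using u10 by (simp_all add: unch_def)
                    have "hmem h10 11 = hmem h8 11" using u10 by (simp add: unch_def)
                    then show "hmem ?h11 11 l = mom2 f S l \<and> hmem ?h11 11 l \<in> cls e2" if "l < 2 * S" for l
                      using H8'[OF that] by auto
                  next
                    fix h12 :: hstate
                    assume n12: "hreg h12 rcnt = npos (mom2 f S) S" and u12: "unch (p_npos 11) ?h11 h12"
                    have ok12: "okh h12" using okh_unch[OF ok11 u12] n12 nL by simp
                    have r12: "hreg h12 rcnt1 = npos (mom1 f S) S" "hreg h12 rres = hreg h rres"
                      using u12 u10 r8 by (simp_all add: unch_def)
                    show "wp (HIf Equal (EN (NV rcnt)) (EN (NV rcnt1)) HSkip (Asg rres (NC 0))) ?Q h12"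
                      using n12 r12 ok12 named_facts E_facts by (auto intro!: okh_setr)
                  qed simp
                  then show "wp (HSeq (Asg rcnt1 (NV rcnt)) (HSeq (p_npos 11)
                    (HIf Equal (EN (NV rcnt)) (EN (NV rcnt1)) HSkip (Asg rres (NC 0))))) ?Q h10"
                    using n10 nL named_facts E_facts by simp
                qed simp_all
                then show "wp (HSeq (Asg rN (NV rS)) (HSeq (Asg rT (NC 1)) (HSeq (p_npos 10) (HSeq (Asg rcnt1 (NV rcnt)) (HSeq (p_npos 11)
                  (HIf Equal (EN (NV rcnt)) (EN (NV rcnt1)) HSkip (Asg rres (NC 0)))))))) ?Q h8"
                  using r8 named_facts E_facts L_facts by simp
              qed (use L_facts in auto)
            qed (use L_facts E_facts in auto)
          qed
        qed
      qed
    qed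
  qed
qed

end

end

end

section \<open>Layout of the input and the complete program\<close>

lemma nth_concat_grid:
  assumes "j < m" "k < D"
  shows "concat (map (\<lambda>j. map (g j) [0..<D]) [0..<m]) ! (j * D + k) = g j k"
  using assms
proof (induction m)
  case (Suc m)
  have len: "length (concat (map (\<lambda>j. map (g j) [0..<D]) [0..<m])) = m * D"
    for m by (induction m) simp_all
  show ?case
  proof (cases "j < m")
    case True
    have "Suc j * D \<le> m * D" using True by (intro mult_le_mono1) simp
    then have "j * D + k < m * D" using Suc.prems(2) unfolding mult_Suc by linarith
    then show ?thesis using Suc True len by (simp add: nth_append)
  next
    case False
    then have "j = m" using Suc.prems by simp
    then show ?thesis using len Suc.prems by (simp add: nth_append)
  qed
qed simp

lemma tri_Suc: "Suc i * (Suc i + 1) div 2 = i * (i + 1) div 2 + Suc i"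
proof -
  have "Suc i * (Suc i + 1) = i * (i + 1) + Suc i * 2" by simp
  then show ?thesis by (simp only: div_mult_self1)
qed

lemma tri_mono: "i \<le> n \<Longrightarrow> i * (i + 1) div 2 \<le> n * (n + 1) div (2::nat)"
  by (intro div_le_mono mult_le_mono) auto

text \<open>The rows above row \<open>i\<close> of the lower triangle hold
  \<open>i * (i + 1) div 2\<close> entries with \<open>d + 1\<close> coefficients each;
  \<open>x_idx\<close> forms the same address.\<close>

lemma nth_polymat_coeffs:
  assumes "i < n" "j \<le> i" "k \<le> d"
  shows "polymat_coeffs n d P ! ((i * (i + 1) div 2 + j) * (d + 1) + k) = coeff (P $$ (i, j)) k"
  using assms
proof (induction n)
  case (Suc n)
  let ?row = "concat (map (\<lambda>j. map (\<lambda>k. coeff (P $$ (n, j)) k) [0..<Suc d]) [0..<Suc n])"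
  have split: "polymat_coeffs (Suc n) d P = polymat_coeffs n d P @ ?row"
    by (simp add: polymat_coeffs_def del: upt_Suc) (simp del: upt_Suc add: upt_Suc_append)
  have len: "length (polymat_coeffs n d P) = (n * (n + 1) div 2) * (d + 1)"
    unfolding length_polymat_coeffs by (simp add: choose_two mult.commute)
  show ?case
  proof (cases "i < n")
    case True
    have "i * (i + 1) div 2 + j < n * (n + 1) div 2"
      using tri_mono[of "Suc i" n] tri_Suc[of i] True Suc.prems(2) by linarith
    then have "Suc (i * (i + 1) div 2 + j) * (d + 1) \<le> (n * (n + 1) div 2) * (d + 1)"
      by (intro mult_le_mono1) simp
    then have "(i * (i + 1) div 2 + j) * (d + 1) + k < length (polymat_coeffs n d P)"
      unfolding len mult_Suc using Suc.prems(3) by linarith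
    then show ?thesis unfolding split using Suc True by (simp add: nth_append)
  next
    case False
    then have i: "i = n" using Suc.prems by simp
    have e: "(i * (i + 1) div 2 + j) * (d + 1) + k = length (polymat_coeffs n d P) + (j * Suc d + k)"
      unfolding len i add_mult_distrib by simp
    show ?thesis unfolding split e nth_append_length_plus
      using nth_concat_grid[of j "Suc n" k "Suc d" "\<lambda>j k. coeff (P $$ (n, j)) k"] Suc.prems i by simp
  qed
qed simp

text \<open>This fixes the truncation: \<open>S = n * d + 1\<close> exceeds the degrees of all
  coefficients up to index \<open>n\<close>.\<close>

lemma fl_degree:
  assumes A: "\<And>i j. i < N \<Longrightarrow> j < N \<Longrightarrow> degree (A i j) \<le> d"
  shows "degree (flC A N q) \<le> q * d \<and> (\<forall>i<N. \<forall>j<N. degree (flM A N q i j) \<le> q * d)"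
proof (induction q)
  case (Suc q)
  have m: "degree (p * r) \<le> Suc q * d" if "degree p \<le> d" "degree r \<le> q * d" for p r :: "rat poly"
    using degree_mult_le[of p r] that by simp
  have M: "degree (flM A N (Suc q) i j) \<le> Suc q * d" if "i < N" "j < N" for i j
    unfolding flM_Suc using that Suc A by (intro degree_add_le degree_sum_le m) auto
  moreover have "degree (flC A N (Suc q)) \<le> Suc q * d"
    unfolding flC_Suc using M by (intro order_trans[OF degree_smult_le] degree_sum_le) auto
  ultimately show ?case by blast
qed simp

definition x_idx :: "nat \<Rightarrow> nat \<Rightarrow> nexp" where
  "x_idx i j = NAdd (NMul (NAdd (NHalf (NMul (NV i) (NAdd (NV i) (NC 1)))) (NV j)) (NAdd (NV 1) (NC 1))) (NV rl)"

text \<open>Entries above the diagonal are read at the transposed position. Beyond degree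
  \<open>d\<close> the input has no cells, and 0 is supplied.\<close>

definition e_A :: exp where
  "e_A = Cond Leq (EN (NV rl)) (EN (NV 1))
     (Cond Leq (EN (NV rj)) (EN (NV ri)) (Bin Sub (EC 0) (Get 0 (x_idx ri rj))) (Bin Sub (EC 0) (Get 0 (x_idx rj ri))))
     (EC 0)"

text \<open>The tests overwrite \<open>rN\<close> and \<open>rT\<close>, so the outer loop relies on
  register 0, on \<open>rS\<close> and on array 4, which they leave alone.\<close>

definition p_main :: hcom where
  "p_main = HSeq (Asg rS (NAdd (NMul (NV 0) (NV 1)) (NC 1))) (HSeq (Asg rN (NV 0)) (HSeq (Asg rT (NV rS))
     (HSeq (fill3 1 e_A) (HSeq (fl_prog 1 4) (HSeq (Asg rres (NC 1))
       (HSeq (HFor rK (NAdd (NV 0) (NC 1)) p_test) (Asg 0 (NV rres))))))))"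

lemma wrwa_test: "wr p_test = {rm, rN, rT, rcnt, rcnt1, rres}" "4 \<notin> wa p_test"
  by (auto simp: p_test_def)

context sized_dvd
begin

lemma wp_main:
  assumes h: "okh h" "hreg h 0 = n" "hreg h 1 = d"
    and X: "\<And>i j k. i < n \<Longrightarrow> j \<le> i \<Longrightarrow> k \<le> d \<Longrightarrow>
        hmem h 0 ((i * (i + 1) div 2 + j) * (d + 1) + k) = coeff (P i j) k"
    and Xc: "\<And>i j k. i < n \<Longrightarrow> j \<le> i \<Longrightarrow> k \<le> d \<Longrightarrow> coeff (P i j) k \<in> cls 1"
    and sym: "\<And>i j. i < n \<Longrightarrow> j < n \<Longrightarrow> P i j = P j i"
    and deg: "\<And>i j. i < n \<Longrightarrow> j < n \<Longrightarrow> degree (P i j) \<le> d"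
    and S: "S = n * d + 1"
    and A: "A = (\<lambda>i j. - P i j)"
    and L: "4 * S + 2 \<le> L" "n + 1 \<le> L"
    and inv: "\<And>K. K \<le> n \<Longrightarrow> inverse (lcg (gpoly (flC A n K) S)) \<in> cls 1"
    and E: "2 * stp (deg_mom S (stp 2 n)) S \<le> E" and En: "stp 2 n \<le> E"
  shows "wp p_main (\<lambda>h'. hreg h' 0 =
     (if \<forall>K\<le>n. npos (mom1 (flC A n K) S) S = npos (mom2 (flC A n K) S) S then 1 else 0)) h"
proof -
  define good where "good K \<longleftrightarrow> npos (mom1 (flC A n K) S) S = npos (mom2 (flC A n K) S) S" for K
  have nm: "x < named" if "x < 17" for x using that by (simp add: named_def)
  have LL: "n \<le> L" "S \<le> L" "Suc 0 \<le> L" using L by auto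
  let ?h1 = "setr (setr (setr h rS S) rN n) rT S"
  have ok1: "okh ?h1" using LL by (intro okh_setr h) auto
  have r1: "hreg ?h1 rN = n" "hreg ?h1 rT = S" "hreg ?h1 1 = d" using h by simp_all
  let ?rest = "HSeq (fl_prog 1 4) (HSeq (Asg rres (NC 1))
       (HSeq (HFor rK (NAdd (NV 0) (NC 1)) p_test) (Asg 0 (NV rres))))"
  let ?Q = "\<lambda>h'. hreg h' 0 = (if \<forall>K\<le>n. good K then 1 else 0)"
  have ev: "ev e_A (setr (setr (setr ?h1 ri i) rj j) rl l) = coeff (A i j) l" if "i < n" "j < n" "l < S" for i j l
  proof (cases "l \<le> d")
    case True
    then show ?thesis
      using that h X[of i j l] X[of j i l] sym[of i j] by (simp add: e_A_def x_idx_def A)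
  next
    case False
    then have "coeff (P i j) l = 0" using deg[OF that(1,2)] by (simp add: coeff_eq_0)
    then show ?thesis using False h by (simp add: e_A_def A)
  qed
  have chk: "chk (\<lambda>_. 1) e_A (setr (setr (setr ?h1 ri i) rj j) rl l)" if "i < n" "j < n" "l < S" for i j l
    using that h X[of i j l] X[of j i l] Xc[of i j l] Xc[of j i l] nm LL E7 cls_0
    by (simp add: e_A_def x_idx_def)
  have "wp (HSeq (fill3 1 e_A) ?rest) ?Q ?h1"
    unfolding wp.simps(4)[of "fill3 1 e_A"]
  proof (rule wp_fill3[where \<delta> = "\<lambda>_. 1", OF r1(1) LL(1) r1(2) LL(2) _ _ _ _ ok1])
    show "5 \<le> E" using E7 by simp
    show "1 \<notin> arrs e_A" by (simp add: e_A_def)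
    show "dg (\<lambda>_. 1) e_A \<le> E" using E7 by (simp add: e_A_def)
    show "chk (\<lambda>_. 1) e_A (setr (setr (setr ?h1 ri i) rj j) rl l)" if "i < n" "j < n" "l < S" for i j l
      using chk[OF that] .
    fix h2 :: hstate
    assume reg2: "hreg h2 = hreg ?h1"
      and v2: "\<And>i j l. i < n \<Longrightarrow> j < n \<Longrightarrow> l < S \<Longrightarrow> hmem h2 1 ((i * n + j) * S + l) =
         ev e_A (setr (setr (setr ?h1 ri i) rj j) rl l)"
      and c2: "\<And>i j l. i < n \<Longrightarrow> j < n \<Longrightarrow> l < S \<Longrightarrow> hmem h2 1 ((i * n + j) * S + l) \<in> cls (dg (\<lambda>_. 1) e_A)"
    have dg: "dg (\<lambda>_. 1) e_A = 2" by (simp add: e_A_def)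
    \<comment> \<open>Exponent 2: one for the data and one for the subtraction from 0.\<close>
    have Ac: "coeff (A i j) l \<in> cls 2" if "i < n" "j < n" "l < S" for i j l
      using c2[OF that] unfolding v2[OF that] ev[OF that] dg .
    have ok2: "okh h2" using okh_reg[OF ok1 reg2] .
    show "wp ?rest ?Q h2"
    proof (rule wp_Seq[OF wp_fl[where A = A and \<kappa> = 2, OF ok2 _ LL(1) _ LL(2) _ _ _ _ En]])
      show "hreg h2 rN = n" "hreg h2 rT = S" using reg2 by simp_all
      show "hmem h2 1 ((i * n + j) * S + l) = coeff (A i j) l" if "i < n" "j < n" "l < S" for i j l
        using v2[OF that] ev[OF that] by simp
      show "coeff (A i j) l \<in> cls 2" if "i < n" "j < n" "l < S" for i j l using Ac[OF that] .
    next
      fix h3 :: hstate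
      assume C3: "\<forall>q\<le>n. \<forall>l<S. hmem h3 4 (q * S + l) = coeff (flC A n q) l" and u3: "unch (fl_prog 1 4) h2 h3"
      have reg3: "hreg h3 = hreg ?h1" using u3 reg2 by (auto simp: unch_def)
      let ?h4 = "setr h3 rres 1"
      have ok4: "okh ?h4" using LL okh_reg[OF ok1 reg3] by (intro okh_setr) auto
      have "wp (HFor rK (NAdd (NV 0) (NC 1)) p_test) (\<lambda>h'. hreg h' rres = (if \<forall>K\<le>n. good K then 1 else 0)) ?h4"
      proof (rule wp_For[where I = "\<lambda>K h'. hreg h' rres = (if \<forall>k<K. good k then 1 else 0) \<and> okh h'"])
        fix K h5 assume K: "K < nev (NAdd (NV 0) (NC 1)) ?h4"
          and I: "hreg h5 rres = (if \<forall>k<K. good k then 1 else 0) \<and> okh h5" and un: "unch p_test ?h4 h5"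
        have K: "K \<le> n" using K reg3 h by simp
        let ?f = "flC A n K"
        have "degree ?f \<le> K * d"
          by (rule conjunct1[OF fl_degree]) (use deg in \<open>simp add: A\<close>)
        also have "\<dots> \<le> n * d" by (rule mult_le_mono1[OF K])
        also have "\<dots> < S" by (simp add: S)
        finally have fd: "degree ?f < S" .
        have fc: "coeff ?f l \<in> cls (stp 2 n)" for l
        proof (cases "l < S")
          case True
          have "coeff ?f l \<in> cls (stp 2 K)" by (rule fl_cls(1)[of n S]) (use LL Ac K True in auto)
          then show ?thesis using cls_mono stp_mono[OF K] by blast
        next
          case False
          then show ?thesis using fd cls_0 by (simp add: coeff_eq_0)
        qed
        have ok: "okh (setr h5 rK K)" using I K L by (intro okh_setr) auto
        have regs: "hreg h5 rS = S" using un reg3 wrwa_test by (auto simp: unch_def)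
        have "hmem h5 4 = hmem h3 4" using un wrwa_test by (auto simp: unch_def)
        then have C5: "hmem h5 4 (K * S + l) = coeff ?f l" if "l < S" for l using C3 K that by simp
        have "wp p_test (\<lambda>h'. hreg h' rres = (if good K then hreg (setr h5 rK K) rres else 0) \<and> okh h') (setr h5 rK K)"
          unfolding good_def
          by (rule wp_test[OF fd L(1) fc _ inv[OF K] E ok]) (use regs C5 in \<open>auto simp: stp_def\<close>)
        then show "wp p_test (\<lambda>h''. hreg (setr h'' rK (hreg h5 rK)) rres = (if \<forall>k<Suc K. good k then 1 else 0) \<and>
           okh (setr h'' rK (hreg h5 rK))) (setr h5 rK K)"
        proof (rule wp_mono)
          fix h'' :: hstate
          assume *: "hreg h'' rres = (if good K then hreg (setr h5 rK K) rres else 0) \<and> okh h''"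
          have "hreg h5 rK \<le> L" using I nm by (simp add: okh_def)
          then show "hreg (setr h'' rK (hreg h5 rK)) rres = (if \<forall>k<Suc K. good k then 1 else 0) \<and>
            okh (setr h'' rK (hreg h5 rK))"
            using * I by (auto simp: less_Suc_eq intro!: okh_setr)
        qed
      next
        fix h' :: hstate assume "hreg h' rres = (if \<forall>k<nev (NAdd (NV 0) (NC 1)) ?h4. good k then 1 else 0) \<and> okh h'"
        then show "hreg h' rres = (if \<forall>K\<le>n. good K then 1 else 0)" using reg3 h by (simp add: less_Suc_eq_le)
      qed (use nm reg3 h L LL E7 ok4 in auto)
      then have "wp (HSeq (HFor rK (NAdd (NV 0) (NC 1)) p_test) (Asg 0 (NV rres))) ?Q ?h4"
        by (rule wp_Seq) (use nm E7 LL in auto)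
      then show "wp (HSeq (Asg rres (NC 1)) (HSeq (HFor rK (NAdd (NV 0) (NC 1)) p_test) (Asg 0 (NV rres)))) ?Q h3"
        using nm E7 LL by simp
    qed simp_all
  qed
  then show ?thesis unfolding p_main_def good_def using nm E7 LL h S by simp
qed

end

lemma psd_iff_form:
  assumes P: "P \<in> carrier_mat n n" "sym_mat P"
  shows "psd (eval_polymat P t) \<longleftrightarrow> (\<forall>v. (\<Sum>a<n. \<Sum>b<n. reval (- P $$ (a, b)) t * (v a * v b)) \<le> 0)"
proof -
  let ?M = "eval_polymat P t"
  have M: "?M \<in> carrier_mat n n" using P by (simp add: eval_polymat_def)
  have s: "P $$ (i, j) = P $$ (j, i)" if "i < n" "j < n" for i j
  proof -
    have "P\<^sup>T $$ (i, j) = P $$ (j, i)" using P that by simp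
    then show ?thesis using P by (simp add: sym_mat_def)
  qed
  have "sym_mat ?M" unfolding sym_mat_def using M s P
    by (auto simp: eval_polymat_def intro!: eq_matI)
  moreover have form: "v \<bullet> (?M *\<^sub>v v) = - (\<Sum>a<n. \<Sum>b<n. reval (- P $$ (a, b)) t * (v $ a * v $ b))"
    if "v \<in> carrier_vec n" for v
  proof -
    have d: "dim_row P = n" "dim_col P = n" "dim_vec v = n" using P that by auto
    have "(?M *\<^sub>v v) $ a = (\<Sum>b<n. reval (P $$ (a, b)) t * v $ b)" if "a < n" for a
      using that d by (simp add: eval_polymat_def scalar_prod_def reval_def lessThan_atLeast0)
    then have "v \<bullet> (?M *\<^sub>v v) = (\<Sum>a<n. v $ a * (\<Sum>b<n. reval (P $$ (a, b)) t * v $ b))"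
      using M d by (simp add: scalar_prod_def lessThan_atLeast0)
    then show ?thesis by (simp add: sum_distrib_left sum_negf mult_ac)
  qed
  moreover have "(\<forall>v \<in> carrier_vec n. (\<Sum>a<n. \<Sum>b<n. reval (- P $$ (a, b)) t * (v $ a * v $ b)) \<le> 0) \<longleftrightarrow>
    (\<forall>v. (\<Sum>a<n. \<Sum>b<n. reval (- P $$ (a, b)) t * (v a * v b)) \<le> (0::real))" (is "?l \<longleftrightarrow> ?r")
  proof
    assume l: ?l
    show ?r
    proof
      fix v :: "nat \<Rightarrow> real"
      have "vec n v \<in> carrier_vec n" by simp
      with l have "(\<Sum>a<n. \<Sum>b<n. reval (- P $$ (a, b)) t * (vec n v $ a * vec n v $ b)) \<le> 0" by (rule bspec)
      moreover have "(\<Sum>a<n. \<Sum>b<n. reval (- P $$ (a, b)) t * (vec n v $ a * vec n v $ b)) =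
         (\<Sum>a<n. \<Sum>b<n. reval (- P $$ (a, b)) t * (v a * v b))"
        by (intro sum.cong refl) simp
      ultimately show "(\<Sum>a<n. \<Sum>b<n. reval (- P $$ (a, b)) t * (v a * v b)) \<le> 0" by linarith
    qed
  qed auto
  ultimately show ?thesis using M by (auto simp: psd_def)
qed

section \<open>Encoding lengths\<close>

text \<open>The bound on lengths only has to be some polynomial; closure under sums and products
  yields it from the shape of the expression.\<close>

definition poly_fun :: "(nat \<Rightarrow> nat) \<Rightarrow> bool" where
  "poly_fun F \<longleftrightarrow> (\<exists>p. \<forall>x. F x = poly p x)"

lemma poly_fun_intros:
  "poly_fun (\<lambda>x. c)" "poly_fun (\<lambda>x. x)"
  "poly_fun F \<Longrightarrow> poly_fun G \<Longrightarrow> poly_fun (\<lambda>x. F x + G x)"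
  "poly_fun F \<Longrightarrow> poly_fun G \<Longrightarrow> poly_fun (\<lambda>x. F x * G x)"
proof -
  show "poly_fun (\<lambda>x. c)" unfolding poly_fun_def by (rule exI[of _ "[:c:]"]) simp
  show "poly_fun (\<lambda>x. x)" unfolding poly_fun_def by (rule exI[of _ "[:0, 1:]"]) simp
  assume "poly_fun F" "poly_fun G"
  then obtain p q where "\<forall>x. F x = poly p x" "\<forall>x. G x = poly q x" unfolding poly_fun_def by blast
  then show "poly_fun (\<lambda>x. F x + G x)" "poly_fun (\<lambda>x. F x * G x)"
    unfolding poly_fun_def by (auto intro: exI[of _ "p + q"] exI[of _ "p * q"])
qed

lemma floorlog_le: "m < 2 ^ c \<Longrightarrow> floorlog 2 m \<le> c"
  by (simp add: floorlog_leD floorlog_le_iff)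

text \<open>The reduced denominator divides \<open>M\<close> and the numerator is at most
  \<open>M * M\<close>; this makes \<open>c\<close> and \<open>2 * c\<close> digits and two
  signs.\<close>

lemma rat_bits_le:
  assumes v: "of_nat M * v \<in> \<int>" "\<bar>v\<bar> \<le> of_nat M" and M: "0 < M" "M < 2 ^ c"
  shows "rat_bits v \<le> 2 + 3 * c"
proof -
  obtain p q where pq: "quotient_of v = (p, q)" by (cases "quotient_of v")
  have q: "q > 0" "coprime p q" using quotient_of_denom_pos[OF pq] quotient_of_coprime[OF pq] by auto
  have vpq: "v = of_int p / of_int q" using quotient_of_div[OF pq] .
  obtain z where z: "of_nat M * v = of_int z" using v(1) by (auto elim: Ints_cases)
  have "(of_int (int M * p) :: rat) = of_int (z * q)" using z q unfolding vpq by (simp add: field_simps)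
  then have "int M * p = z * q" by (simp only: of_int_eq_iff)
  then have "q dvd int M * p" by simp
  then have "q dvd int M" using q(2) by (metis coprime_commute coprime_dvd_mult_left_iff)
  then have qM: "q \<le> int M" using M(1) by (intro zdvd_imp_le) auto
  have "\<bar>(of_int p :: rat)\<bar> = \<bar>v\<bar> * of_int q" using q unfolding vpq by (simp add: abs_divide)
  also have "\<dots> \<le> of_nat M * of_nat M"
  proof (rule mult_mono)
    show "of_int q \<le> (of_nat M :: rat)" using qM by (metis of_int_le_iff of_int_of_nat_eq)
  qed (use v q in auto)
  finally have "(of_int \<bar>p\<bar> :: rat) \<le> of_int (int (M * M))" by simp
  then have "\<bar>p\<bar> \<le> int (M * M)" by (simp only: of_int_le_iff)
  then have pM: "nat \<bar>p\<bar> \<le> M * M" by linarith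
  have "M * M < 2 ^ c * 2 ^ c" using M by (intro mult_strict_mono) auto
  then have "nat \<bar>p\<bar> < 2 ^ (2 * c)" using pM by (simp add: mult_2 power_add)
  then have "floorlog 2 (nat \<bar>p\<bar>) \<le> 2 * c" by (rule floorlog_le)
  moreover have "floorlog 2 (nat \<bar>q\<bar>) \<le> c" by (rule floorlog_le) (use qM q M in linarith)
  ultimately show ?thesis unfolding rat_bits_def pq int_bits_def by simp
qed

text \<open>A multiple of the denominator that also exceeds the absolute value, so that divisibility
  of \<open>B\<close> by it gives both properties required by \<open>cls 1\<close>.\<close>

definition rat_size :: "rat \<Rightarrow> nat" where
  "rat_size x = (case quotient_of x of (p, q) \<Rightarrow> nat q * (nat \<bar>p\<bar> + 1))"

lemma less_floorlog: "m < 2 ^ floorlog 2 m"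
  using floorlog_le_iff[of 2 m "floorlog 2 m"] floorlog_bounds[of m 2] by (cases "m = 0") auto

lemma rat_size_le: "rat_size x \<le> 2 ^ rat_bits x" "1 \<le> rat_size x"
proof -
  obtain p q where pq: "quotient_of x = (p, q)" by (cases "quotient_of x")
  have q: "q > 0" using quotient_of_denom_pos[OF pq] .
  have "nat q * (nat \<bar>p\<bar> + 1) \<le> 2 ^ floorlog 2 (nat q) * 2 ^ floorlog 2 (nat \<bar>p\<bar>)"
    unfolding Suc_eq_plus1[symmetric] by (intro mult_mono Suc_leI less_imp_le less_floorlog) auto
  also have "\<dots> \<le> 2 ^ rat_bits x"
    unfolding power_add[symmetric] rat_bits_def pq int_bits_def using q by (intro power_increasing) auto
  finally show "rat_size x \<le> 2 ^ rat_bits x" by (simp add: rat_size_def pq)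
  show "1 \<le> rat_size x" using q by (simp add: rat_size_def pq)
qed

lemma rat_size_bounds:
  assumes "rat_size x dvd B" "0 < B"
  shows "of_nat B * x \<in> \<int>" "\<bar>x\<bar> \<le> of_nat B"
proof -
  obtain p q where pq: "quotient_of x = (p, q)" by (cases "quotient_of x")
  have q: "q > 0" using quotient_of_denom_pos[OF pq] .
  have x: "x = of_int p / of_int q" using quotient_of_div[OF pq] .
  from assms obtain r where r: "B = nat q * (nat \<bar>p\<bar> + 1) * r" by (auto simp: rat_size_def pq elim: dvdE)
  have "of_nat (nat q) = (of_int q :: rat)" using q by simp
  then have "of_nat B * x = of_nat ((nat \<bar>p\<bar> + 1) * r) * of_int p"
    using q unfolding r x by (simp add: field_simps)
  then show "of_nat B * x \<in> \<int>" by (metis Ints_mult Ints_of_int Ints_of_nat)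
  have "\<bar>x\<bar> = of_int \<bar>p\<bar> / of_int q" using q unfolding x by simp
  also have "\<dots> \<le> of_int \<bar>p\<bar> / 1" using q by (intro divide_left_mono) auto
  also have "\<dots> = of_nat (nat \<bar>p\<bar>)" by simp
  also have "\<dots> \<le> of_nat B"
  proof (rule of_nat_mono)
    have "1 * (nat \<bar>p\<bar> + 1) * 1 \<le> nat q * (nat \<bar>p\<bar> + 1) * r"
      using assms(2) q unfolding r by (intro mult_le_mono) (auto simp: Suc_le_eq)
    then have "nat \<bar>p\<bar> + 1 \<le> B" unfolding r by (simp only: mult_1_left mult_1_right)
    then show "nat \<bar>p\<bar> \<le> B" by simp
  qed
  finally show "\<bar>x\<bar> \<le> of_nat B" .
qed


lemma stp_mono2: "\<kappa> \<le> \<kappa>' \<Longrightarrow> q \<le> q' \<Longrightarrow> stp \<kappa> q \<le> stp \<kappa>' q'"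
  unfolding stp_def by (intro add_mono mult_le_mono) auto

lemma deg_mom_mono: "S \<le> S' \<Longrightarrow> e \<le> e' \<Longrightarrow> deg_mom S e \<le> deg_mom S' e'"
  unfolding deg_mom_def deg_psum_def by (intro add_mono mult_le_mono) auto

lemma prod_rat_size: "prod_list (map rat_size xs) \<le> 2 ^ sum_list (map rat_bits xs)" "1 \<le> prod_list (map rat_size xs)"
proof (induction xs)
  case (Cons x xs)
  { case 1 then show ?case using Cons(1) rat_size_le(1)[of x] by (simp add: power_add mult_mono) }
  { case 2
    have "1 * 1 \<le> rat_size x * prod_list (map rat_size xs)"
      using Cons(2) rat_size_le(2) by (intro mult_le_mono)
    then show ?case by simp }
qed simp_all

lemma dvd_prod_list: "x \<in> set xs \<Longrightarrow> (x :: nat) dvd prod_list xs"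
  by (induction xs) auto

lemma length_le_bits: "length xs \<le> sum_list (map rat_bits xs)"
proof (induction xs)
  case (Cons x xs)
  have "1 \<le> rat_bits x" by (simp add: rat_bits_def int_bits_def split: prod.splits)
  with Cons show ?case by simp
qed simp

text \<open>Forming \<open>gpoly\<close> takes no division, so the bound is available before the
  leading coefficients enter \<open>B\<close>.\<close>

lemma (in sized_dvd) lcg_cls:
  assumes deg: "degree f < S" and S: "2 * S + 1 \<le> L" and f: "\<And>l. coeff f l \<in> cls e"
  shows "lcg (gpoly f S) \<in> cls (e + 5)"
proof -
  have "coeff (gpoly f S) j \<in> cls (e + 5)" if j: "j \<le> S" for j
  proof -
    have n: "of_nat k \<in> cls 1" if "k \<le> 2 * S + 1" for k using that S LB by (intro cls_of_nat) simp
    have "of_nat j - of_nat (1 + 2 * S) \<in> cls (max 1 1 + 1)" using j by (intro cls_diff n) auto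
    then have *: "(of_nat j - of_nat (1 + 2 * S)) * coeff f (j - 1) \<in> cls (max 1 1 + 1 + e)"
      using f by (intro cls_mult) auto
    have "j = 0 \<Longrightarrow> S \<ge> 1" using deg by simp
    then have "of_nat (j + 1) * coeff f (j + 1) \<in> cls (1 + e)" using f j deg by (intro cls_mult n) auto
    moreover have "(if j = 0 then 0 else (of_nat j - of_nat (1 + 2 * S)) * coeff f (j - 1)) \<in> cls (max 1 1 + 1 + e)"
      using * cls_0 by simp
    ultimately have "coeff (gpoly f S) j \<in> cls (max (1 + e) (max 1 1 + 1 + e) + 1)"
      unfolding coeff_gpoly by (rule cls_add)
    then show ?thesis by (rule cls_mono) simp
  qed
  from this[of "degree (gpoly f S)"] show ?thesis
    using degree_gpoly[OF deg] cls_1 by (simp add: lcg_def)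
qed

text \<open>Through this inequality \<open>n\<close>, \<open>d\<close> and \<open>S\<close>, hence
  all loop lengths, are linear in the dimension of the input.\<close>

lemma input_facts:
  assumes "1 \<le> n"
  shows "n * d + n \<le> length (polymat_coeffs n d P)"
proof -
  have "2 * n \<le> (n + 1) * n" using assms by (intro mult_le_mono1) simp
  then have "n \<le> (n + 1) * n div 2" by linarith
  then have "n \<le> (n + 1) choose 2" unfolding choose_two by simp
  then have "n * (d + 1) \<le> ((n + 1) choose 2) * (d + 1)" by (rule mult_le_mono1)
  then show ?thesis unfolding length_polymat_coeffs by simp
qed

definition deg_bound :: "nat \<Rightarrow> nat" where
  "deg_bound x = 2 * stp (deg_mom x (stp 2 x)) x + 7"

text \<open>Here \<open>x\<close> majorises \<open>L\<close>, \<open>n\<close>, \<open>S\<close> and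
  the number of input bits. \<open>x * x\<close> comes from \<open>fact L \<le> 2 ^ (L * L)\<close>,
  the summand \<open>x\<close> from the data, the next factor from the exponent of \<open>B0\<close>
  in the bound for \<open>B\<close>, and \<open>deg_bound x\<close> is \<open>E\<close>.\<close>

definition bits_bound :: "nat \<Rightarrow> nat" where
  "bits_bound y = (let x = 6 * y + 6; e = stp 2 x + 5 in
     2 + 3 * ((x * x + x) * (e + 2 * e * (x + 1)) * deg_bound x + 1))"

lemma poly_fun_bits: "poly_fun bits_bound"
proof -
  have stp: "poly_fun (\<lambda>x. stp (F x) (G x))" if "poly_fun F" "poly_fun G" for F G
    unfolding stp_def by (intro poly_fun_intros that)
  have mom: "poly_fun (\<lambda>x. deg_mom (F x) (G x))" if "poly_fun F" "poly_fun G" for F G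
    unfolding deg_mom_def deg_psum_def by (intro poly_fun_intros that)
  have bnd: "poly_fun (\<lambda>x. deg_bound (F x))" if "poly_fun F" for F
    unfolding deg_bound_def by (intro poly_fun_intros stp mom that)
  show ?thesis
    unfolding bits_bound_def Let_def by (intro poly_fun_intros stp bnd)
qed

lemma exec_p_main:
  assumes inst: "(n, d, P) \<in> polymat_instances"
  defines "xs \<equiv> polymat_coeffs n d P"
  shows "\<exists>T V s'. exec (hcomp p_main named) (init_state [n, d] xs) T V s' \<and>
    reg s' 0 = (if \<forall>t::real. psd (eval_polymat P t) then 1 else 0) \<and>
    T \<le> htime (6 * length xs + 6) p_main \<and>
    (\<forall>v \<in> of_nat ` set [n, d] \<union> set xs \<union> V. rat_bits v \<le> bits_bound (sum_list (map rat_bits xs)))"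
proof -
  define len where "len = length xs"
  define bits where "bits = sum_list (map rat_bits xs)"
  \<comment> \<open>As \<open>S \<le> len\<close>, this covers \<open>4 * S + 2 \<le> L\<close> and
    \<open>n + 1 \<le> L\<close>.\<close>
  define L where "L = 6 * len + 6"
  define S where "S = n * d + 1"
  define A where "A i j = - P $$ (i, j)" for i j
  define X where "X = 6 * bits + 6"
  have n1: "1 \<le> n" and Pc: "P \<in> carrier_mat n n" and Psym: "sym_mat P"
    and Pdeg: "\<And>i j. i < n \<Longrightarrow> j < n \<Longrightarrow> degree (P $$ (i, j)) \<le> d"
    using inst by (auto simp: polymat_instances_def)
  have len: "n * d + n \<le> len" using input_facts[OF n1] by (simp add: len_def xs_def)
  have "d \<le> n * d" using mult_le_mono1[OF n1, of d] by (simp only: mult_1_left)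
  then have dn: "n \<le> len" "d \<le> len" using len by linarith+
  have LS: "4 * S + 2 \<le> L" "n + 1 \<le> L" "d \<le> L" "2 * S + 1 \<le> L" "n \<le> L" "S \<le> L"
  proof -
    have "S \<le> len" using len n1 by (simp add: S_def)
    then show "4 * S + 2 \<le> L" "n + 1 \<le> L" "d \<le> L" "2 * S + 1 \<le> L" "n \<le> L" "S \<le> L"
      using dn by (simp_all add: L_def)
  qed
  have lenbits: "len \<le> bits" using length_le_bits by (simp add: len_def bits_def)
  then have LX: "L \<le> X" "bits \<le> X" "n \<le> X" using LS by (auto simp: L_def X_def)
  have sym: "P $$ (i, j) = P $$ (j, i)" if "i < n" "j < n" for i j
  proof -
    have "P\<^sup>T $$ (i, j) = P $$ (j, i)" using Pc that by simp
    then show ?thesis using Psym by (simp add: sym_mat_def)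
  qed
  \<comment> \<open>The factorial supplies the small divisors, the product the denominators and
    absolute values of the data.\<close>
  define B0 where "B0 = fact L * prod_list (map rat_size xs)"
  have L_fact: "L \<le> fact L" by (rule fact_ge_self)
  have B0L: "L \<le> B0"
  proof -
    have "L * 1 \<le> fact L * prod_list (map rat_size xs)" using L_fact prod_rat_size(2) by (intro mult_le_mono)
    then show ?thesis by (simp add: B0_def)
  qed
  have dvdB0: "k dvd B0" if "1 \<le> k" "k \<le> L" for k
    using dvd_fact[OF that] by (simp add: B0_def)
  \<comment> \<open>A preliminary instance, for its size classes: the leading coefficients must be
    bounded before the final \<open>B\<close> can contain them. 7 is the least exponent that the
    locale admits.\<close>
  interpret A: sized_dvd B0 L 7
    by unfold_locales (use B0L dvdB0 in \<open>auto simp: L_def\<close>)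
  have xsdvd: "rat_size x dvd B0" if "x \<in> set xs" for x
    using dvd_prod_list[of "rat_size x" "map rat_size xs"] that by (simp add: B0_def)
  have B0pos: "0 < B0" using B0L by (simp add: L_def)
  have nth: "(i * (i + 1) div 2 + j) * (d + 1) + k < len" if "i < n" "j \<le> i" "k \<le> d" for i j k
  proof -
    have "i * (i + 1) div 2 + j < n * (n + 1) div 2"
      using tri_mono[of "Suc i" n] tri_Suc[of i] that by linarith
    then have "Suc (i * (i + 1) div 2 + j) * (d + 1) \<le> (n * (n + 1) div 2) * (d + 1)"
      by (intro mult_le_mono1) simp
    moreover have "len = (n * (n + 1) div 2) * (d + 1)"
      unfolding len_def xs_def length_polymat_coeffs by (simp add: choose_two mult.commute)
    ultimately show ?thesis unfolding mult_Suc using that(3) by linarith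
  qed
  have coeff_xs: "coeff (P $$ (i, j)) k \<in> set xs" if "i < n" "j \<le> i" "k \<le> d" for i j k
    using nth[OF that] nth_polymat_coeffs[OF that, of P] unfolding len_def xs_def by (metis nth_mem)
  have coeff_all: "coeff (P $$ (i, j)) k \<in> insert 0 (set xs)" if "i < n" "j < n" for i j k
  proof (cases "k \<le> d")
    case True
    then show ?thesis using coeff_xs[of i j k] coeff_xs[of j i k] sym[OF that] that by (cases "j \<le> i") auto
  next
    case False
    then show ?thesis using Pdeg[OF that] by (simp add: coeff_eq_0)
  qed
  let ?f = "\<lambda>K. flC A n K"
  let ?l = "\<lambda>K. lcg (gpoly (?f K) S)"
  have fdeg: "degree (?f K) < S" if "K \<le> n" for K
  proof -
    have "degree (?f K) \<le> K * d"
      by (rule conjunct1[OF fl_degree]) (use Pdeg in \<open>simp add: A_def\<close>)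
    also have "\<dots> \<le> n * d" by (rule mult_le_mono1[OF that])
    finally show ?thesis by (simp add: S_def)
  qed
  define e where "e = stp 2 n + 5"
  have lc: "?l K \<in> A.cls e" if K: "K \<le> n" for K
  proof -
    have x1: "x \<in> A.cls 1" if "x \<in> insert 0 (set xs)" for x
      using that rat_size_bounds[OF xsdvd B0pos, of x] A.cls_0 by (auto simp: A.cls_def)
    have "coeff (A i j) l \<in> A.cls 2" if "i < n" "j < n" for i j l
    proof -
      have "coeff (A i j) l \<in> A.cls 1" unfolding A_def coeff_minus
        by (intro A.cls_minus x1 coeff_all that)
      then show ?thesis by (rule A.cls_mono) simp
    qed
    then have "coeff (?f K) l \<in> A.cls (stp 2 K)" if "l < S" for l
      by (intro A.fl_cls(1)[of n S]) (use LS K that in auto)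
    then have c: "coeff (?f K) l \<in> A.cls (stp 2 n)" for l
      using A.cls_mono[OF _ stp_mono[OF K]] A.cls_0 fdeg[OF K] by (cases "l < S") (auto simp: coeff_eq_0)
    show ?thesis unfolding e_def by (rule A.lcg_cls[OF fdeg[OF K] LS(4) c])
  qed
  define z where "z K = nat \<bar>\<lfloor>of_nat (B0 ^ e) * ?l K\<rfloor>\<bar>" for K
  have z: "of_nat (z K) = of_nat (B0 ^ e) * \<bar>?l K\<bar>" "1 \<le> z K" "z K \<le> B0 ^ (2 * e)" if K: "K \<le> n" for K
  proof -
    obtain y where y: "of_nat (B0 ^ e) * ?l K = of_int y"
      using lc[OF K] by (auto simp: A.cls_def elim: Ints_cases)
    then have zy: "z K = nat \<bar>y\<bar>" by (simp only: z_def floor_of_int)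
    have "(of_nat (z K) :: rat) = \<bar>of_int y\<bar>" by (simp add: zy)
    also have "\<dots> = of_nat (B0 ^ e) * \<bar>?l K\<bar>" unfolding y[symmetric] by (simp add: abs_mult)
    finally show *: "of_nat (z K) = of_nat (B0 ^ e) * \<bar>?l K\<bar>" .
    have "?l K \<noteq> 0" by (simp add: lcg_def)
    then have "of_nat (z K) \<noteq> (0::rat)" unfolding * using B0pos by simp
    then show "1 \<le> z K" by simp
    have "(of_nat (z K) :: rat) \<le> of_nat (B0 ^ e) * of_nat (B0 ^ e)"
      unfolding * using lc[OF K] by (intro mult_left_mono) (auto simp: A.cls_def)
    also have "\<dots> = of_nat (B0 ^ (2 * e))" by (simp add: mult_2 power_add)
    finally show "z K \<le> B0 ^ (2 * e)" by (simp only: of_nat_le_iff)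
  qed
  \<comment> \<open>Since \<open>z K\<close> is \<open>B0 ^ e * \<bar>?l K\<bar>\<close>, the
    quotient of \<open>B\<close> by \<open>?l K\<close> is, up to sign, \<open>B0 ^ (2 * e)\<close>
    times the other factors \<open>z\<close>. The factor \<open>B0 ^ e\<close> also bounds the
    inverse itself.\<close>
  define B where "B = B0 ^ e * (\<Prod>K\<le>n. z K)"
  have e1: "1 \<le> e" by (simp add: e_def)
  have zprod: "1 \<le> (\<Prod>K\<le>n. z K)" using z(2) by (intro prod_ge_1) auto
  have B0B: "B0 dvd B" unfolding B_def using e1 by (intro dvd_mult2 dvd_power) auto
  have Bpos: "0 < B" unfolding B_def
    by (rule mult_pos_pos) (use zprod B0pos in \<open>simp, linarith\<close>)
  define E where "E = deg_bound L"
  interpret C: sized_dvd B L E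
  proof unfold_locales
    show "L \<le> B" using B0L dvd_imp_le[OF B0B Bpos] by simp
    show "k dvd B" if "1 \<le> k" "k \<le> L" for k using dvdB0[OF that] B0B dvd_trans by blast
  qed (auto simp: E_def deg_bound_def L_def)
  have inv: "inverse (?l K) \<in> C.cls 1" if K: "K \<le> n" for K
  proof -
    obtain r where r: "(\<Prod>K\<le>n. z K) = z K * r" using K by (metis atMost_iff dvdE dvd_prodI finite_atMost)
    have nz: "?l K \<noteq> 0" by (simp add: lcg_def)
    have "of_nat B * \<bar>inverse (?l K)\<bar> = of_nat (B0 ^ e * r) * (of_nat (z K) * \<bar>inverse (?l K)\<bar>)"
      by (simp add: B_def r)
    also have "of_nat (z K) * \<bar>inverse (?l K)\<bar> = of_nat (B0 ^ e)"
      unfolding z(1)[OF K] using nz by (simp add: abs_mult[symmetric])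
    finally have i: "of_nat B * \<bar>inverse (?l K)\<bar> \<in> \<int>" by simp
    then have "of_nat B * inverse (?l K) \<in> \<int>" by (cases "inverse (?l K) \<ge> 0") auto
    moreover have "\<bar>inverse (?l K)\<bar> \<le> of_nat B"
    proof -
      have "(1 :: rat) \<le> of_nat (z K)" using of_nat_mono[OF z(2)[OF K], where 'a = rat] by simp
      from mult_left_mono[OF this abs_ge_zero]
      have "\<bar>inverse (?l K)\<bar> * 1 \<le> \<bar>inverse (?l K)\<bar> * of_nat (z K)" .
      also have "\<dots> = of_nat (B0 ^ e)"
        unfolding z(1)[OF K] using nz by simp
      also have "\<dots> \<le> of_nat B"
      proof (rule of_nat_mono)
        have "B0 ^ e * 1 \<le> B0 ^ e * (\<Prod>K\<le>n. z K)" using zprod by (rule mult_le_mono2)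
        then show "B0 ^ e \<le> B" by (simp add: B_def)
      qed
      finally show ?thesis by simp
    qed
    ultimately show ?thesis by (simp add: C.cls_def)
  qed
  have inC: "x \<in> C.cls 1" if "x \<in> set xs" for x
    using rat_size_bounds[OF dvd_trans[OF xsdvd[OF that] B0B] Bpos] by (simp add: C.cls_def)
  have mono: "stp 2 n \<le> stp 2 L" "deg_mom S (stp 2 n) \<le> deg_mom L (stp 2 L)"
    using LS by (intro stp_mono2 deg_mom_mono; simp)+
  have E_ok: "2 * stp (deg_mom S (stp 2 n)) S \<le> E" "stp 2 n \<le> E"
  proof -
    have *: "stp (deg_mom S (stp 2 n)) S \<le> stp (deg_mom L (stp 2 L)) L" using mono LS by (intro stp_mono2)
    then show "2 * stp (deg_mom S (stp 2 n)) S \<le> E" unfolding E_def deg_bound_def by linarith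
    have "stp 2 n \<le> deg_mom S (stp 2 n)" by (simp add: deg_mom_def)
    also have "\<dots> \<le> S * (deg_mom S (stp 2 n) + 6)"
    proof -
      have "1 * (deg_mom S (stp 2 n) + 6) \<le> S * (deg_mom S (stp 2 n) + 6)" by (intro mult_le_mono1) (simp add: S_def)
      then show ?thesis by (rule order_trans[rotated]) simp
    qed
    finally have "stp 2 n \<le> stp (deg_mom S (stp 2 n)) S"
      unfolding stp_def[of "deg_mom S (stp 2 n)"] by (rule trans_le_add2)
    then show "stp 2 n \<le> E" using * unfolding E_def deg_bound_def by linarith
  qed
  let ?h = "\<lparr>hreg = (\<lambda>i. if i = 0 then n else if i = 1 then d else 0), hmem = mem (init_state [n, d] xs)\<rparr>"
  have corr: "C.corr ?h (init_state [n, d] xs)"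
    by (auto simp: C.corr_def init_state_def nth_Cons' less_Suc_eq numeral_2_eq_2)
  have ok: "C.okh ?h" using LS by (simp add: C.okh_def)
  have "C.wp p_main (\<lambda>h'. hreg h' 0 = (if \<forall>K\<le>n. npos (mom1 (?f K) S) S = npos (mom2 (?f K) S) S then 1 else 0)) ?h"
  proof (rule C.wp_main[where P = "\<lambda>i j. P $$ (i, j)" and d = d, OF ok _ _ _ _ _ _ S_def _ LS(1,2) inv E_ok])
    show "hmem ?h 0 ((i * (i + 1) div 2 + j) * (d + 1) + k) = coeff (P $$ (i, j)) k"
      if "i < n" "j \<le> i" "k \<le> d" for i j k
      using nth[OF that] nth_polymat_coeffs[OF that, of P]
      by (simp only: init_state_def len_def xs_def hstate.simps state.simps simp_thms if_True)
    show "coeff (P $$ (i, j)) k \<in> C.cls 1" if "i < n" "j \<le> i" "k \<le> d" for i j k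
      using inC[OF coeff_xs[OF that]] .
    show "A = (\<lambda>i j. - P $$ (i, j))" by (intro ext) (simp add: A_def)
  qed (use sym Pdeg in auto)
  from C.hcomp_run[OF this corr ok order_refl] obtain T V s' h' where
    run: "exec (hcomp p_main named) (init_state [n, d] xs) T V s'" "T \<le> htime L p_main" "V \<subseteq> C.cls E"
    and h': "C.corr h' s'" "hreg h' 0 = (if \<forall>K\<le>n. npos (mom1 (?f K) S) S = npos (mom2 (?f K) S) S then 1 else 0)"
    unfolding run_def by blast
  have dec: "(\<forall>K\<le>n. npos (mom1 (?f K) S) S = npos (mom2 (?f K) S) S) \<longleftrightarrow> (\<forall>t::real. psd (eval_polymat P t))"
  proof -
    have "A a b = A b a" if "a < n" "b < n" for a b using sym[OF that] by (simp add: A_def)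
    then have "psd (eval_polymat P t) \<longleftrightarrow> (\<forall>K\<le>n. reval (?f K) t \<ge> 0)" for t
      unfolding psd_iff_form[OF Pc Psym] using fl_nonpos_iff[of n A t] by (simp add: A_def)
    moreover have "npos (mom1 (?f K) S) S = npos (mom2 (?f K) S) S \<longleftrightarrow> (\<forall>t::real. reval (?f K) t \<ge> 0)" if "K \<le> n" for K
      by (rule npos_mom_iff[OF fdeg[OF that]])
    ultimately show ?thesis by blast
  qed
  \<comment> \<open>The number \<open>B\<close> has polynomial length: it contains
    \<open>n + 1\<close> factors \<open>z K\<close>, each at most
    \<open>B0 ^ (2 * e)\<close>.\<close>
  have B_le: "B \<le> 2 ^ ((L * L + bits) * (e + 2 * e * (n + 1)))"
  proof -
    have "fact L \<le> L ^ L" using fact_le_power[of L, where 'a = nat] by simp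
    also have "\<dots> \<le> (2 ^ L) ^ L" by (intro power_mono) (auto intro: less_imp_le less_exp)
    finally have "fact L \<le> (2::nat) ^ (L * L)" by (simp add: power_mult)
    then have B0: "B0 \<le> 2 ^ (L * L + bits)"
      unfolding B0_def bits_def power_add by (intro mult_mono prod_rat_size(1)) auto
    have "(\<Prod>K\<le>n. z K) \<le> (\<Prod>K\<le>n. B0 ^ (2 * e))" using z(3) by (intro prod_mono) auto
    also have "\<dots> = B0 ^ (2 * e * (n + 1))"
      by (simp only: prod_constant card_atMost power_mult[symmetric] Suc_eq_plus1)
    finally have "B \<le> B0 ^ (e + 2 * e * (n + 1))" unfolding B_def power_add[of B0 e] by (rule mult_le_mono2)
    also have "\<dots> \<le> (2 ^ (L * L + bits)) ^ (e + 2 * e * (n + 1))" using B0 by (intro power_mono) auto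
    finally show ?thesis by (simp only: power_mult)
  qed
  have size: "rat_bits v \<le> bits_bound bits" if "v \<in> C.cls E" for v
  proof -
    let ?c = "(L * L + bits) * (e + 2 * e * (n + 1)) * E"
    have "B ^ E \<le> (2 ^ ((L * L + bits) * (e + 2 * e * (n + 1)))) ^ E" using B_le by (intro power_mono) auto
    then have "B ^ E \<le> 2 ^ ?c" by (simp only: power_mult)
    also have "\<dots> < 2 ^ (?c + 1)" by simp
    finally have "B ^ E < 2 ^ (?c + 1)" .
    then have "rat_bits v \<le> 2 + 3 * (?c + 1)"
      using that Bpos by (intro rat_bits_le[of "B ^ E"]) (auto simp: C.cls_def)
    also have "\<dots> \<le> bits_bound bits"
      unfolding bits_bound_def Let_def X_def[symmetric] E_def deg_bound_def e_def using LX
      by (intro add_mono mult_le_mono stp_mono2 deg_mom_mono) auto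
    finally show ?thesis .
  qed
  have in_cls: "x \<in> C.cls E" if "x \<in> C.cls 1" for x using C.cls_mono[OF that C.E1] .
  have "of_nat k \<in> C.cls 1" if "k \<in> set [n, d]" for k
    using that LS C.LB by (intro C.cls_of_nat) auto
  then have "v \<in> C.cls E" if "v \<in> of_nat ` set [n, d] \<union> set xs \<union> V" for v
    using that run(3) in_cls inC by blast
  moreover have "reg s' 0 = (if \<forall>t::real. psd (eval_polymat P t) then 1 else 0)"
    using h' unfolding dec C.corr_def by (simp add: named_def)
  ultimately show ?thesis using run(1,2) size unfolding bits_def L_def len_def by blast
qed

theorem lemma3p3:
  shows "\<exists>c :: com. decides_strongly_poly c polymat_instances
           (\<lambda>(n, d, P). [n, d])
           (\<lambda>(n, d, P). polymat_coeffs n d P)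
           (\<lambda>(n, d, P). \<forall>t :: real. psd (eval_polymat P t))"
proof -
  obtain p where "\<forall>L. htime L p_main = poly p L" using htime_poly by blast
  \<comment> \<open>An input of dimension \<open>l\<close> has \<open>L = 6 * l + 6\<close>, hence
    the composition with \<open>[:6, 6:]\<close>.\<close>
  then have p: "htime (6 * l + 6) p_main = poly (pcompose p [:6, 6:]) l" for l
    by (simp add: poly_pcompose mult.commute add.commute)
  obtain q where q: "\<And>x. bits_bound x = poly q x" using poly_fun_bits unfolding poly_fun_def by blast
  have "decides_strongly_poly (hcomp p_main named) polymat_instances
           (\<lambda>(n, d, P). [n, d])
           (\<lambda>(n, d, P). polymat_coeffs n d P)
           (\<lambda>(n, d, P). \<forall>t :: real. psd (eval_polymat P t))"
    unfolding decides_strongly_poly_def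
    by (rule exI[of _ "pcompose p [:6, 6:]"], rule exI[of _ q])
      (use exec_p_main in \<open>auto simp only: p q split: prod.splits\<close>)
  then show ?thesis by blast
qed

end
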